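(* Every word is strongly concise in the class of profinite linear groups. That is, for every word $w$ and every profinite group $G$ that is linear, if $|w\{G\}|<2^{\aleph_0}$, then the verbal subgroup $w(G)$ is finite.
   Context: A word $w$ in $k$ variables is an element of the free group on $k$ generators; for a group $G$ it defines by substitution a map $w\colon G^k\to G$. The set of $w$-values is $w\{G\}=\{w(g_1,\dots,g_k)\mid g_i\in G\}$ and the verbal subgroup is the abstract subgroup $w(G)=\langle w\{G\}\rangle$. A word $w$ is strongly concise in a class $\mathfrak{C}$ of profinite groups if, for every $G$ in $\mathfrak{C}$, the subgroup $w(G)$ is finite whenever $|w\{G\}|<2^{\aleph_0}$. A group is linear if it embeds (as an abstract group) in a matrix group $\mathrm{GL}_n(K)$ for some $n\in\mathbb{N}$ and some field $K$; a profinite linear group is a profinite group with such an embedding. *)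

theory Defs
  imports "HOL-Algebra.Generated_Groups" "HOL-Analysis.T1_Spaces"
    "HOL-Library.Equipollence" "Jordan_Normal_Form.Determinant"
begin

text \<open>The free group on the generators \<open>x\<^sub>0, \<dots>, x\<^sub>k\<^sub>-\<^sub>1\<close>, as the group of reduced words.
  The letter \<open>(i, True)\<close> stands for \<open>x\<^sub>i\<close> and \<open>(i, False)\<close> for its inverse.\<close>

type_synonym letter = "nat \<times> bool"
type_synonym word = "letter list"

definition inv_letter :: "letter \<Rightarrow> letter" where
  "inv_letter a = (fst a, \<not> snd a)"

definition reduced :: "word \<Rightarrow> bool" where
  "reduced w \<longleftrightarrow> successively (\<lambda>a b. b \<noteq> inv_letter a) w"

fun cons_cancel :: "letter \<Rightarrow> word \<Rightarrow> word" where
  "cons_cancel a [] = [a]"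
| "cons_cancel a (b # w) = (if b = inv_letter a then w else a # b # w)"

definition free_group :: "nat \<Rightarrow> word monoid" where
  "free_group k = \<lparr>carrier = {w. reduced w \<and> fst ` set w \<subseteq> {..<k}},
     monoid.mult = foldr cons_cancel, one = []\<rparr>"

definition letter_value :: "('a, 'm) monoid_scheme \<Rightarrow> (nat \<Rightarrow> 'a) \<Rightarrow> letter \<Rightarrow> 'a" where
  "letter_value G g a = (if snd a then g (fst a) else inv\<^bsub>G\<^esub> (g (fst a)))"

definition word_value :: "('a, 'm) monoid_scheme \<Rightarrow> word \<Rightarrow> (nat \<Rightarrow> 'a) \<Rightarrow> 'a" where
  "word_value G w g = foldr (\<lambda>a x. letter_value G g a \<otimes>\<^bsub>G\<^esub> x) w \<one>\<^bsub>G\<^esub>"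

definition word_values :: "('a, 'm) monoid_scheme \<Rightarrow> nat \<Rightarrow> word \<Rightarrow> 'a set" where
  "word_values G k w = word_value G w ` ({..<k} \<rightarrow>\<^sub>E carrier G)"

definition verbal_subgroup :: "('a, 'm) monoid_scheme \<Rightarrow> nat \<Rightarrow> word \<Rightarrow> 'a set" where
  "verbal_subgroup G k w = generate G (word_values G k w)"

locale profinite_group = group G for G (structure) +
  fixes T :: "'a topology"
  assumes topspace_eq: "topspace T = carrier G"
    and continuous_mult: "continuous_map (prod_topology T T) T (\<lambda>(x, y). x \<otimes> y)"
    and continuous_inv: "continuous_map T T (\<lambda>x. inv x)"
    and compact: "compact_space T"
    and Hausdorff: "Hausdorff_space T"
    and totally_disconnected: "connectedin T S \<Longrightarrow> x \<in> S \<Longrightarrow> y \<in> S \<Longrightarrow> x = y"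

definition GL :: "'k::field itself \<Rightarrow> nat \<Rightarrow> 'k mat monoid" where
  "GL K n = units_of (ring_mat K n ())"

text \<open>The embedding is one of abstract groups. A formula cannot quantify over types, so the
  field is a parameter; statements for an arbitrary type \<open>'k\<close> of class \<open>field\<close> cover
  linear groups over all fields.\<close>

definition linear_over :: "'k::field itself \<Rightarrow> ('a, 'm) monoid_scheme \<Rightarrow> bool" where
  "linear_over K G \<longleftrightarrow> (\<exists>n. \<exists>h. h \<in> mon G (GL K n))"

definition profinite_linear_groups ::
    "'k::field itself \<Rightarrow> (('a, 'm) monoid_scheme \<times> 'a topology) set" where
  "profinite_linear_groups K = {(G, T). profinite_group G T \<and> linear_over K G}"

text \<open>A word is given together with the number \<open>k\<close> of its variables, as an element of
  \<open>free_group k\<close>; a class of profinite groups is a set of pairs of a group and its topology.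
  The type \<open>nat set\<close> has \<open>2\<close> to the power \<open>\<aleph>\<^sub>0\<close> elements.\<close>

definition strongly_concise ::
    "nat \<Rightarrow> word \<Rightarrow> (('a, 'm) monoid_scheme \<times> 'a topology) set \<Rightarrow> bool" where
  "strongly_concise k w C \<longleftrightarrow>
    (\<forall>(G, T)\<in>C. word_values G k w \<prec> (UNIV :: nat set set) \<longrightarrow> finite (verbal_subgroup G k w))"


lemma inv_letter_inv_letter [simp]: "inv_letter (inv_letter a) = a"
  by (simp add: inv_letter_def)

lemma fst_inv_letter [simp]: "fst (inv_letter a) = fst a"
  by (simp add: inv_letter_def)

lemma reduced_Nil [simp]: "reduced []"
  by (simp add: reduced_def)

lemma reduced_Cons: "reduced (a # w) \<longleftrightarrow> reduced w \<and> (w = [] \<or> hd w \<noteq> inv_letter a)"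
  by (cases w) (auto simp: reduced_def)

lemma reduced_cons_cancel: "reduced w \<Longrightarrow> reduced (cons_cancel a w)"
  by (cases w) (auto simp: reduced_Cons)

lemma reduced_foldr_cons_cancel: "reduced v \<Longrightarrow> reduced (foldr cons_cancel u v)"
  by (induction u) (auto intro: reduced_cons_cancel)

lemma cons_cancel_reduced: "reduced (a # w) \<Longrightarrow> cons_cancel a w = a # w"
  by (cases w) (auto simp: reduced_Cons)

lemma cons_cancel_inverse:
  assumes "reduced w"
  shows "cons_cancel a (cons_cancel (inv_letter a) w) = w"
proof (cases w)
  case (Cons b v)
  with assms show ?thesis
    by (cases v) (auto simp: reduced_Cons)
qed simp

lemma foldr_cons_cancel_assoc1:
  assumes "reduced x" "reduced w"
  shows "foldr cons_cancel (cons_cancel a x) w = cons_cancel a (foldr cons_cancel x w)"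
proof (cases x)
  case (Cons b v)
  then show ?thesis
    using cons_cancel_inverse[OF reduced_foldr_cons_cancel[OF assms(2)]] by simp
qed simp

lemma foldr_cons_cancel_assoc:
  assumes "reduced v" "reduced w"
  shows "foldr cons_cancel (foldr cons_cancel u v) w = foldr cons_cancel u (foldr cons_cancel v w)"
  by (induction u)
    (simp_all add: foldr_cons_cancel_assoc1 reduced_foldr_cons_cancel assms)

lemma set_cons_cancel: "set (cons_cancel a w) \<subseteq> insert a (set w)"
  by (cases w) auto

lemma set_foldr_cons_cancel: "set (foldr cons_cancel u v) \<subseteq> set u \<union> set v"
proof (induction u)
  case (Cons a u)
  then show ?case
    using set_cons_cancel[of a "foldr cons_cancel u v"] by auto
qed simp

lemma free_group_mult_closed:
  assumes "u \<in> carrier (free_group k)" "v \<in> carrier (free_group k)"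
  shows "foldr cons_cancel u v \<in> carrier (free_group k)"
  using assms set_foldr_cons_cancel[of u v]
  by (fastforce simp: free_group_def reduced_foldr_cons_cancel)

lemma free_group_left_inverse:
  assumes "u \<in> carrier (free_group k)"
  shows "\<exists>v\<in>carrier (free_group k). foldr cons_cancel v u = []"
  using assms
proof (induction u)
  case Nil
  then show ?case by (intro bexI[of _ "[]"]) (auto simp: free_group_def)
next
  case (Cons a u)
  then have u: "u \<in> carrier (free_group k)" "reduced u" "reduced (a # u)" "fst a < k"
    by (auto simp: free_group_def reduced_Cons)
  then obtain v where v: "v \<in> carrier (free_group k)" "foldr cons_cancel v u = []"
    using Cons.IH by blast
  have a: "[inv_letter a] \<in> carrier (free_group k)" "reduced [inv_letter a]"
    using u by (auto simp: free_group_def reduced_Cons)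
  have "foldr cons_cancel (foldr cons_cancel v [inv_letter a]) (a # u) = []"
    using foldr_cons_cancel_assoc[OF a(2) u(3), of v] v by simp
  then show ?case
    using free_group_mult_closed[OF v(1) a(1)] by blast
qed

theorem group_free_group: "group (free_group k)"
proof (rule groupI)
  show "\<exists>v\<in>carrier (free_group k). v \<otimes>\<^bsub>free_group k\<^esub> u = \<one>\<^bsub>free_group k\<^esub>"
    if "u \<in> carrier (free_group k)" for u
    using free_group_left_inverse[OF that] by (simp add: free_group_def)
qed (use free_group_mult_closed in \<open>auto simp: free_group_def foldr_cons_cancel_assoc\<close>)

context group
begin

lemma letter_value_closed: "g (fst a) \<in> carrier G \<Longrightarrow> letter_value G g a \<in> carrier G"
  by (simp add: letter_value_def)

lemma letter_value_inv_letter: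
  "g (fst a) \<in> carrier G \<Longrightarrow> letter_value G g (inv_letter a) = inv (letter_value G g a)"
  by (simp add: letter_value_def inv_letter_def)

lemma word_value_closed: "g ` fst ` set w \<subseteq> carrier G \<Longrightarrow> word_value G w g \<in> carrier G"
  by (induction w) (auto simp: word_value_def letter_value_closed)

lemma word_value_cons_cancel:
  assumes "g (fst a) \<in> carrier G" "g ` fst ` set w \<subseteq> carrier G"
  shows "word_value G (cons_cancel a w) g = letter_value G g a \<otimes> word_value G w g"
proof (cases w)
  case Nil
  then show ?thesis by (simp add: word_value_def)
next
  case (Cons b v)
  have "word_value G v g \<in> carrier G"
    using assms Cons by (intro word_value_closed) auto
  moreover have "word_value G (c # v) g = letter_value G g c \<otimes> word_value G v g" for c v
    by (simp add: word_value_def)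
  ultimately show ?thesis
    using assms Cons
    by (auto simp: letter_value_inv_letter letter_value_closed m_assoc[symmetric])
qed

text \<open>Substitution is the homomorphism from the free group that extends \<open>x\<^sub>i \<mapsto> g i\<close>.\<close>

theorem word_value_hom:
  assumes g: "g \<in> {..<k} \<rightarrow> carrier G"
  shows "(\<lambda>w. word_value G w g) \<in> hom (free_group k) G"
proof (rule homI)
  have in_carrier: "g ` fst ` set w \<subseteq> carrier G" if "fst ` set w \<subseteq> {..<k}" for w
    using g that by auto
  show "word_value G w g \<in> carrier G" if "w \<in> carrier (free_group k)" for w
    using that by (intro word_value_closed in_carrier) (simp add: free_group_def)
  have "word_value G (foldr cons_cancel u v) g = word_value G u g \<otimes> word_value G v g"
    if "fst ` set u \<subseteq> {..<k}" "fst ` set v \<subseteq> {..<k}" for u v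
    using that(1)
  proof (induction u)
    case Nil
    then show ?case
      using word_value_closed[OF in_carrier[OF that(2)]] by (simp add: word_value_def)
  next
    case (Cons a u)
    have uv: "fst ` set (foldr cons_cancel u v) \<subseteq> {..<k}"
      using set_foldr_cons_cancel[of u v] Cons.prems that(2) by fastforce
    have a: "g (fst a) \<in> carrier G"
      using g Cons.prems by auto
    have "word_value G (foldr cons_cancel (a # u) v) g
        = letter_value G g a \<otimes> (word_value G u g \<otimes> word_value G v g)"
      using word_value_cons_cancel[OF a in_carrier[OF uv]] Cons by simp
    also have "\<dots> = (letter_value G g a \<otimes> word_value G u g) \<otimes> word_value G v g"
      using Cons.prems that(2)
      by (intro m_assoc[symmetric] letter_value_closed a word_value_closed in_carrier) auto
    finally show ?case by (simp add: word_value_def)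
  qed
  then show "word_value G (u \<otimes>\<^bsub>free_group k\<^esub> v) g = word_value G u g \<otimes> word_value G v g"
    if "u \<in> carrier (free_group k)" "v \<in> carrier (free_group k)" for u v
    using that by (simp add: free_group_def)
qed

lemma word_value_generator: "g i \<in> carrier G \<Longrightarrow> word_value G [(i, True)] g = g i"
  by (simp add: word_value_def letter_value_def)

end

lemma group_GL: "group (GL TYPE('k::field) n)"
  unfolding GL_def by (intro monoid.units_group ring.is_monoid ring_mat)

lemma carrier_GL: "carrier (GL TYPE('k::field) n) = {A \<in> carrier_mat n n. det A \<noteq> 0}"
proof -
  have "A \<in> Units (ring_mat TYPE('k) n ()) \<longleftrightarrow> A \<in> carrier_mat n n \<and> det A \<noteq> 0" for A
    using det_non_zero_imp_unit[of A n "()"] unit_imp_det_non_zero[of A n "()"]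
    by (auto simp: Units_def ring_mat_def)
  then show ?thesis
    by (auto simp: GL_def units_of_carrier)
qed

end

theory Submission
  imports Defs "HOL-Algebra.Sylow" "HOL-Algebra.Group_Action" "HOL-Algebra.Multiplicative_Group"
    "HOL-Algebra.Algebraic_Closure_Type" "HOL-Number_Theory.Cong" "HOL-Analysis.Urysohn"
    "HOL-Library.Function_Algebras" "Jordan_Normal_Form.Char_Poly" "Jordan_Normal_Form.Matrix_Kernel"
begin

text \<open>Let \<open>G\<close> be profinite and linear, with fewer than \<open>2\<close> to the \<open>\<aleph>\<^sub>0\<close> values of \<open>w\<close>. The matrix
  entries of \<open>w\<close>, as functions of one variable, lie in a finite-dimensional translation-invariant
  space of functions on \<open>G\<close>; hence there is an open normal subgroup \<open>M\<close> such that a function of this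
  space vanishing near \<open>1\<close> vanishes on \<open>M\<close>. On a product of cosets of \<open>M\<close> the image of \<open>w\<close> is compact
  and of cardinality less than the continuum, so it has an isolated point, and \<open>w\<close> is constant on
  a nonempty open subset, hence, one coordinate after the other, on the whole product. So \<open>M\<close> is
  marginal for \<open>w\<close>, there are finitely many values, and \<open>M\<close> centralizes them.

  By Dietzmann's lemma it remains to see that a value \<open>v\<close> has finite order. Averaging over the cosets
  of \<open>M\<close> gives a crossed homomorphism from \<open>G\<close> to the abelianization of \<open>M\<close> that is a power map on the
  latter and trivial on \<open>v\<close>, so a power \<open>b\<close> of \<open>v\<close> lies in the derived subgroup of \<open>M\<close>. As \<open>b\<close> also
  centralizes \<open>M\<close>, its eigenvalues are roots of unity, and a power \<open>u\<close> of \<open>b\<close> is unipotent. In positive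
  characteristic \<open>u\<close> is torsion. In characteristic \<open>0\<close> suppose \<open>u \<noteq> 1\<close>, pass to the subgroup generated
  by the arguments of \<open>w\<close>, and reduce it modulo an ideal of finite index that contains a prime \<open>q\<close> larger
  than the index of \<open>M\<close> and modulo which \<open>u\<close> stays nontrivial. In the resulting finite group \<open>M\<close> has
  a supplement of order prime to \<open>q\<close>, which contains the image of \<open>v\<close> by marginality, whereas the
  image of \<open>u\<close> is a nontrivial \<open>q\<close>-element.\<close>

text \<open>The embedding is one of abstract groups: matrix entries need not be continuous, and a
  Zariski closed set need not be closed in the topology of \<open>G\<close>. The link between the
  two structures is that translations are homeomorphisms and also preserve the space of functions of
  degree at most the length of \<open>w\<close>. Its finite dimension takes over the role of
  noetherianity and yields \<open>M\<close>. Averaging over cosets needs an abelian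
  \<open>M\<close>, so it controls a value only modulo the derived subgroup, and linear algebra has
  to deal with the rest. In characteristic 0 a nontrivial unipotent matrix has infinite order, so
  \<open>u\<close> must be shown to be trivial, and eigenvalues no longer see it. Finitely many
  generators put all matrix entries into a finitely generated domain, where every nonzero element is
  invertible modulo a proper ideal of finite index that contains a prime \<open>q\<close>. Applied
  to the product of a nonzero entry of \<open>u - 1\<close> and the factorial of the index of
  \<open>M\<close>, this meets both demands at once: \<open>u\<close> survives the reduction, and
  \<open>q\<close> exceeds the index.\<close>

hide_const (open) Module.smult up_ring.monom up_ring.coeff Divisibility.prime Polynomials.degree
  Polynomials.lead_coeff Finite_Cartesian_Product.mat

no_notation Polynomials.var ("X\<index>")
no_notation Finite_Cartesian_Product.vec_nth (infixl "$" 90)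
no_notation fps_nth (infixl "$" 75)

section \<open>Marginal subgroups\<close>

text \<open>Assignments are total functions on \<open>nat\<close>, so that the number of variables
  does not occur; the letters of \<open>w\<close> read only finitely many of their values.\<close>

definition marginal :: "('a, 'm) monoid_scheme \<Rightarrow> word \<Rightarrow> 'a set \<Rightarrow> bool" where
  "marginal G w M \<longleftrightarrow> (\<forall>g x. range g \<subseteq> carrier G \<longrightarrow> range x \<subseteq> M \<longrightarrow>
     word_value G w (\<lambda>i. x i \<otimes>\<^bsub>G\<^esub> g i) = word_value G w g)"

lemma marginalD:
  "\<lbrakk>marginal G w M; range g \<subseteq> carrier G; range x \<subseteq> M\<rbrakk>
    \<Longrightarrow> word_value G w (\<lambda>i. x i \<otimes>\<^bsub>G\<^esub> g i) = word_value G w g"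
  by (auto simp: marginal_def)

lemma (in group) inv_mult_cancel:
  assumes "x \<in> carrier G" "y \<in> carrier G"
  shows "inv x \<otimes> (x \<otimes> y) = y" "x \<otimes> (inv x \<otimes> y) = y"
  using assms by (simp_all add: m_assoc[symmetric])

lemma (in group) group_hom_conj:
  assumes "x \<in> carrier G"
  shows "group_hom G G (\<lambda>y. x \<otimes> y \<otimes> inv x)"
  using assms by unfold_locales (auto simp: hom_def m_assoc inv_mult_cancel)

lemma (in subgroup) coset_absorb:
  assumes "group G" "h \<in> H" "x \<in> carrier G"
  shows "H #> (h \<otimes> x) = H #> x"
proof -
  interpret group G by fact
  show ?thesis
    using assms coset_mult_assoc[OF subset, of h x] coset_join2[OF _ subgroup_axioms, of h] by auto
qed

lemma (in group_hom) word_value_hom_image: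
  assumes "range g \<subseteq> carrier G"
  shows "word_value H w (\<lambda>i. h (g i)) = h (word_value G w g)"
proof (induction w)
  case Nil
  then show ?case by (simp add: word_value_def)
next
  case (Cons a w)
  have "g (fst a) \<in> carrier G" "word_value G w g \<in> carrier G"
    using assms G.word_value_closed[of g w] by auto
  then show ?case
    using Cons by (auto simp: word_value_def letter_value_def)
qed

lemma (in group) word_value_in_subgroup:
  assumes "subgroup H G" "range g \<subseteq> H"
  shows "word_value G w g \<in> H"
proof (induction w)
  case Nil
  then show ?case using assms by (simp add: word_value_def subgroup.one_closed)
next
  case (Cons a w)
  then show ?case
    using assms by (auto simp: word_value_def letter_value_def intro!: subgroup.m_closed[OF assms(1)] subgroup.m_inv_closed[OF assms(1)])
qed

lemma (in group) word_value_subgroup: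
  assumes "subgroup H G" "range g \<subseteq> H"
  shows "word_value (G\<lparr>carrier := H\<rparr>) w g = word_value G w g"
proof -
  interpret H: group "G\<lparr>carrier := H\<rparr>"
    using assms subgroup_imp_group by blast
  have "group_hom (G\<lparr>carrier := H\<rparr>) G (\<lambda>x. x)"
    using assms subgroup.subset by unfold_locales (auto simp: hom_def)
  then show ?thesis
    using group_hom.word_value_hom_image[of "G\<lparr>carrier := H\<rparr>" G "\<lambda>x. x" g w] assms by simp
qed

lemma (in group) marginal_subgroup:
  assumes "subgroup H G" "marginal G w M"
  shows "marginal (G\<lparr>carrier := H\<rparr>) w (H \<inter> M)"
  unfolding marginal_def
proof (intro allI impI)
  fix g x :: "nat \<Rightarrow> 'a"
  assume a: "range g \<subseteq> carrier (G\<lparr>carrier := H\<rparr>)" "range x \<subseteq> H \<inter> M"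
  have "range (\<lambda>i. x i \<otimes> g i) \<subseteq> H"
    using a subgroup.m_closed[OF assms(1)] by (simp add: image_subset_iff)
  moreover have "word_value G w (\<lambda>i. x i \<otimes> g i) = word_value G w g"
    using a assms subgroup.subset[OF assms(1)] by (intro marginalD[OF assms(2)]) auto
  ultimately show "word_value (G\<lparr>carrier := H\<rparr>) w (\<lambda>i. x i \<otimes>\<^bsub>G\<lparr>carrier := H\<rparr>\<^esub> g i)
      = word_value (G\<lparr>carrier := H\<rparr>) w g"
    using a assms by (simp add: word_value_subgroup)
qed

lemma (in group_hom) marginal_image:
  assumes "h ` carrier G = carrier H" "M \<subseteq> carrier G" "marginal G w M"
  shows "marginal H w (h ` M)"
  unfolding marginal_def
proof (intro allI impI)
  fix g x :: "nat \<Rightarrow> 'c"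
  assume a: "range g \<subseteq> carrier H" "range x \<subseteq> h ` M"
  \<comment> \<open>Surjectivity lifts the whole assignment, and the factors from the image of
    \<open>M\<close> lift into \<open>M\<close> itself.\<close>
  have "\<forall>i. \<exists>y. y \<in> carrier G \<and> h y = g i" using a assms(1) by (metis image_iff range_subsetD)
  then obtain g' where g': "\<And>i. g' i \<in> carrier G" "\<And>i. h (g' i) = g i" by metis
  have "\<forall>i. \<exists>y. y \<in> M \<and> h y = x i" using a by (metis image_iff range_subsetD)
  then obtain x' where x': "\<And>i. x' i \<in> M" "\<And>i. h (x' i) = x i" by metis
  have "x i \<otimes>\<^bsub>H\<^esub> g i = h (x' i \<otimes> g' i)" for i
    using g' x' assms(2) by (metis hom_mult subsetD)
  moreover have "range g' \<subseteq> carrier G" "range (\<lambda>i. x' i \<otimes> g' i) \<subseteq> carrier G" "range x' \<subseteq> M"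
    using g' x' subsetD[OF assms(2)] by auto
  ultimately show "word_value H w (\<lambda>i. x i \<otimes>\<^bsub>H\<^esub> g i) = word_value H w g"
    using word_value_hom_image[of "\<lambda>i. x' i \<otimes> g' i" w] word_value_hom_image[of g' w]
      marginalD[OF assms(3), of g' x'] g' by simp
qed

text \<open>Conjugation by \<open>x\<close> multiplies each argument by an element of the normal
  subgroup \<open>H\<close>, so it fixes the value; being an endomorphism, it also conjugates the
  value.\<close>

lemma (in normal) marginal_commutes:
  assumes "marginal G w H" "range g \<subseteq> carrier G" "x \<in> H"
  shows "x \<otimes> word_value G w g = word_value G w g \<otimes> x"
proof -
  have xc: "x \<in> carrier G" using assms(3) subset by blast
  have gc: "g i \<in> carrier G" for i using assms by auto
  have "word_value G w (\<lambda>i. x \<otimes> g i \<otimes> inv x) = x \<otimes> word_value G w g \<otimes> inv x"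
    using group_hom.word_value_hom_image[OF group_hom_conj[OF xc], of g w] assms by auto
  moreover have "x \<otimes> g i \<otimes> inv x = (x \<otimes> (g i \<otimes> inv x \<otimes> inv (g i))) \<otimes> g i" for i
    using xc gc[of i] by (simp add: m_assoc)
  moreover have "x \<otimes> (g i \<otimes> inv x \<otimes> inv (g i)) \<in> H" for i
    using assms(3) gc inv_op_closed2[of "g i" "inv x"] by (simp add: is_subgroup subgroup.m_inv_closed)
  ultimately have "word_value G w g = x \<otimes> word_value G w g \<otimes> inv x"
    using marginalD[OF assms(1,2), of "\<lambda>i. x \<otimes> (g i \<otimes> inv x \<otimes> inv (g i))"]
    by (simp add: image_subset_iff)
  moreover have "word_value G w g \<in> carrier G" using word_value_closed[of g w] assms(2) by auto
  ultimately show ?thesis using xc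
    by (metis inv_solve_right m_closed)
qed

text \<open>With a representative \<open>t C\<close> of each coset \<open>C\<close>, take the product over \<open>C\<close> of the elements
  \<open>x t(C) t(xC)\<^sup>-\<^sup>1\<close> of \<open>H\<close>.\<close>

lemma (in normal) crossed_hom_exists:
  assumes comm: "\<And>x y. x \<in> H \<Longrightarrow> y \<in> H \<Longrightarrow> x \<otimes> y = y \<otimes> x"
    and fin: "finite (rcosets H)"
  obtains \<delta> where "\<And>x. x \<in> carrier G \<Longrightarrow> \<delta> x \<in> H"
    and "\<And>x y. x \<in> carrier G \<Longrightarrow> y \<in> carrier G \<Longrightarrow> \<delta> (x \<otimes> y) = \<delta> x \<otimes> (x \<otimes> \<delta> y \<otimes> inv x)"
    and "\<And>x. x \<in> H \<Longrightarrow> \<delta> x = x [^] card (rcosets H)"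
proof -
  let ?B = "G\<lparr>carrier := H\<rparr>"
  interpret B: group ?B using is_subgroup subgroup_imp_group by blast
  interpret B: comm_group ?B
    by (rule B.group_comm_groupI) (use comm in auto)
  define t where "t C = (SOME x. x \<in> C)" for C :: "'a set"
  have t: "t C \<in> carrier G" "H #> t C = C" if C: "C \<in> rcosets H" for C
  proof -
    obtain c where c: "c \<in> carrier G" "C = H #> c" using C by (auto simp: RCOSETS_def)
    then have "c \<in> C" using rcos_self[OF c(1) is_subgroup] by simp
    then have "t C \<in> C" unfolding t_def by (rule someI)
    then show "t C \<in> carrier G" "H #> t C = C"
      using c r_coset_subset_G[OF subset] repr_independence[OF _ c(1) is_subgroup] by auto
  qed
  \<comment> \<open>The permutation of the cosets induced by left multiplication with
    \<open>l\<close>. By normality the choice of the representative does not matter, which is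
    \<open>s_coset\<close>.\<close>
  define s where "s l C = H #> (l \<otimes> t C)" for l C
  have s_coset: "s l (H #> x) = H #> (l \<otimes> x)" if l: "l \<in> carrier G" and x: "x \<in> carrier G" for l x
  proof -
    have C: "H #> x \<in> rcosets H" using x rcosetsI subset by blast
    have "t (H #> x) \<in> H #> x" using rcos_self[OF t(1)[OF C] is_subgroup] t(2)[OF C] by simp
    then obtain b where b: "b \<in> H" "t (H #> x) = b \<otimes> x" by (auto simp: r_coset_def)
    have bc: "b \<in> carrier G" using b subset by auto
    have "l \<otimes> (b \<otimes> x) = (l \<otimes> b \<otimes> inv l) \<otimes> (l \<otimes> x)"
      using l x bc by (simp add: m_assoc inv_mult_cancel)
    moreover have "l \<otimes> b \<otimes> inv l \<in> H" using inv_op_closed2 l b by auto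
    ultimately show ?thesis
      unfolding s_def b(2) using l x coset_absorb[OF is_group, of _ "l \<otimes> x"] by simp
  qed
  have s_in: "s l C \<in> rcosets H" if "l \<in> carrier G" "C \<in> rcosets H" for l C
    using that t rcosetsI subset unfolding s_def by auto
  have s_mult: "s (l \<otimes> l') C = s l (s l' C)" if "l \<in> carrier G" "l' \<in> carrier G" "C \<in> rcosets H" for l l' C
  proof -
    have "C = H #> t C" "t C \<in> carrier G" using t that by auto
    then show ?thesis using s_coset that by (metis m_assoc m_closed)
  qed
  have s_one: "s \<one> C = C" if "C \<in> rcosets H" for C
    using t[OF that] unfolding s_def by simp
  have s_bij: "bij_betw (s l) (rcosets H) (rcosets H)" if l: "l \<in> carrier G" for l
    by (rule bij_betwI[where g = "s (inv l)"])
      (use l s_in s_mult[of "inv l" l] s_mult[of l "inv l"] s_one in \<open>auto\<close>)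
  define f where "f l C = l \<otimes> t C \<otimes> inv (t (s l C))" for l C
  have f_in: "f l C \<in> H" if "l \<in> carrier G" "C \<in> rcosets H" for l C
  proof -
    have "H #> (l \<otimes> t C) = H #> t (s l C)" using t s_in that by (simp add: s_def)
    then show ?thesis unfolding f_def using t s_in that 
      by (metis coset_join1 coset_mult_inv2 is_subgroup inv_closed m_closed subset)
  qed
  \<comment> \<open>Insert \<open>t (s l' C)\<close> and its inverse to split the product.\<close>
  have f_mult: "f (l \<otimes> l') C = (l \<otimes> f l' C \<otimes> inv l) \<otimes> f l (s l' C)"
    if "l \<in> carrier G" "l' \<in> carrier G" "C \<in> rcosets H" for l l' C
    unfolding f_def s_mult[OF that] using that t s_in
    by (simp add: m_assoc inv_mult_cancel)
  define \<delta> where "\<delta> l = (\<Otimes>\<^bsub>?B\<^esub>C\<in>rcosets H. f l C)" for l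
  have \<delta>_in: "\<delta> x \<in> H" if "x \<in> carrier G" for x
    using B.finprod_closed[of "f x" "rcosets H"] f_in[OF that] by (auto simp: \<delta>_def)
  have conj: "(\<Otimes>\<^bsub>?B\<^esub>C\<in>A. l \<otimes> u C \<otimes> inv l) = l \<otimes> (\<Otimes>\<^bsub>?B\<^esub>C\<in>A. u C) \<otimes> inv l"
    if l: "l \<in> carrier G" and "finite A" and "u \<in> A \<rightarrow> H" for l A and u :: "'a set \<Rightarrow> 'a"
    using that(2,3)
  proof (induction A rule: finite_induct)
    case (insert C A)
    have H: "l \<otimes> y \<otimes> inv l \<in> H" if "y \<in> H" for y using that l inv_op_closed2 by auto
    have 1: "(\<Otimes>\<^bsub>?B\<^esub>C\<in>A. u C) \<in> H"
      using B.finprod_closed[of u A] insert by auto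
    have 2: "u C \<in> H" using insert by auto
    have "(\<Otimes>\<^bsub>?B\<^esub>C\<in>insert C A. l \<otimes> u C \<otimes> inv l)
        = (l \<otimes> u C \<otimes> inv l) \<otimes> (\<Otimes>\<^bsub>?B\<^esub>C\<in>A. l \<otimes> u C \<otimes> inv l)"
      using insert H by (subst B.finprod_insert) auto
    also have "\<dots> = (l \<otimes> u C \<otimes> inv l) \<otimes> (l \<otimes> (\<Otimes>\<^bsub>?B\<^esub>C\<in>A. u C) \<otimes> inv l)"
      using insert by auto
    also have "\<dots> = l \<otimes> (u C \<otimes> (\<Otimes>\<^bsub>?B\<^esub>C\<in>A. u C)) \<otimes> inv l"
      using l mem_carrier[OF 1] mem_carrier[OF 2] by (simp add: m_assoc inv_mult_cancel)
    also have "u C \<otimes> (\<Otimes>\<^bsub>?B\<^esub>C\<in>A. u C) = (\<Otimes>\<^bsub>?B\<^esub>C\<in>insert C A. u C)"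
      using insert by (subst B.finprod_insert) auto
    finally show ?case .
  qed (use l in auto)
  have "\<delta> (x \<otimes> y) = \<delta> x \<otimes> (x \<otimes> \<delta> y \<otimes> inv x)" if x: "x \<in> carrier G" and y: "y \<in> carrier G" for x y
  proof -
    have H: "x \<otimes> f y C \<otimes> inv x \<in> H" if "C \<in> rcosets H" for C
      using f_in x y that inv_op_closed2 by auto
    have "\<delta> (x \<otimes> y) = (\<Otimes>\<^bsub>?B\<^esub>C\<in>rcosets H. (x \<otimes> f y C \<otimes> inv x) \<otimes>\<^bsub>?B\<^esub> f x (s y C))"
      unfolding \<delta>_def by (rule B.finprod_cong') (use f_mult x y f_in s_in H is_subgroup in \<open>auto simp: subgroup.m_closed\<close>)
    also have "\<dots> = (\<Otimes>\<^bsub>?B\<^esub>C\<in>rcosets H. x \<otimes> f y C \<otimes> inv x) \<otimes> (\<Otimes>\<^bsub>?B\<^esub>C\<in>rcosets H. f x (s y C))"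
      using H f_in s_in x y by (subst B.finprod_multf) auto
    also have "(\<Otimes>\<^bsub>?B\<^esub>C\<in>rcosets H. x \<otimes> f y C \<otimes> inv x) = x \<otimes> \<delta> y \<otimes> inv x"
      unfolding \<delta>_def using f_in y by (intro conj x fin) auto
    \<comment> \<open>Since \<open>s y\<close> permutes the cosets, the shifted product is again
      \<open>\<delta> x\<close>.\<close>
    also have "(\<Otimes>\<^bsub>?B\<^esub>C\<in>rcosets H. f x (s y C)) = (\<Otimes>\<^bsub>?B\<^esub>C\<in>s y ` (rcosets H). f x C)"
      using s_bij[OF y] f_in x s_in y by (intro B.finprod_reindex[symmetric]) (auto simp: bij_betw_def)
    also have "s y ` (rcosets H) = rcosets H" using s_bij[OF y] by (simp add: bij_betw_def)
    also have "(\<Otimes>\<^bsub>?B\<^esub>C\<in>rcosets H. f x C) = \<delta> x" by (simp add: \<delta>_def)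
    also have "x \<otimes> \<delta> y \<otimes> inv x \<otimes> \<delta> x = \<delta> x \<otimes> (x \<otimes> \<delta> y \<otimes> inv x)"
      using comm \<delta>_in x y inv_op_closed2 by auto
    finally show ?thesis .
  qed
  moreover have "\<delta> x = x [^] card (rcosets H)" if x: "x \<in> H" for x
  proof -
    have xc: "x \<in> carrier G" using x by (rule mem_carrier)
    \<comment> \<open>An element of \<open>H\<close> fixes every coset, so each factor of the
      product is \<open>x\<close> itself.\<close>
    have "f x C = x" if C: "C \<in> rcosets H" for C
    proof -
      have "s x C = C" unfolding s_def using t[OF C] xc x
        by (metis coset_mult_assoc coset_join2 is_subgroup subset)
      then show ?thesis unfolding f_def using t[OF C] xc by (simp add: m_assoc)
    qed
    then have "\<delta> x = (\<Otimes>\<^bsub>?B\<^esub>C\<in>rcosets H. x)"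
      unfolding \<delta>_def using x by (intro B.finprod_cong') auto
    also have "\<dots> = x [^]\<^bsub>?B\<^esub> card (rcosets H)"
      using x by (intro B.finprod_const) auto
    also have "\<dots> = x [^] card (rcosets H)"
      by (rule nat_pow_consistent[symmetric])
    finally show ?thesis .
  qed
  ultimately show thesis using that \<delta>_in by blast
qed

text \<open>For a crossed homomorphism \<open>\<delta>\<close> to \<open>H\<close>, the map \<open>x \<mapsto> \<delta> x \<otimes> x\<close> is an endomorphism that moves elements
  within their cosets, so it fixes the values of \<open>w\<close> and \<open>\<delta>\<close> is trivial on them.\<close>

lemma (in normal) abelian_marginal_torsion:
  fixes j :: nat
  assumes comm: "\<And>x y. x \<in> H \<Longrightarrow> y \<in> H \<Longrightarrow> x \<otimes> y = y \<otimes> x"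
    and fin: "finite (rcosets H)" and marg: "marginal G w H" and g: "range g \<subseteq> carrier G"
    and j: "word_value G w g [^] j \<in> H"
  shows "word_value G w g [^] (j * card (rcosets H)) = \<one>"
proof -
  obtain \<delta> where \<delta>: "\<And>x. x \<in> carrier G \<Longrightarrow> \<delta> x \<in> H"
    "\<And>x y. x \<in> carrier G \<Longrightarrow> y \<in> carrier G \<Longrightarrow> \<delta> (x \<otimes> y) = \<delta> x \<otimes> (x \<otimes> \<delta> y \<otimes> inv x)"
    "\<And>x. x \<in> H \<Longrightarrow> \<delta> x = x [^] card (rcosets H)"
    using crossed_hom_exists[OF comm fin] by metis
  let ?v = "word_value G w g"
  have v: "?v \<in> carrier G" using word_value_closed[of g w] g by auto
  have \<delta>c: "\<delta> x \<in> carrier G" if "x \<in> carrier G" for x using \<delta>(1)[OF that] by simp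
  have "group_hom G G (\<lambda>x. \<delta> x \<otimes> x)"
    by unfold_locales (auto simp: hom_def \<delta>(2) \<delta>c m_assoc inv_mult_cancel)
  then have "word_value G w (\<lambda>i. \<delta> (g i) \<otimes> g i) = \<delta> ?v \<otimes> ?v"
    using group_hom.word_value_hom_image[of G G _ g w] g by auto
  moreover have "word_value G w (\<lambda>i. \<delta> (g i) \<otimes> g i) = ?v"
    using marginalD[OF marg g, of "\<lambda>i. \<delta> (g i)"] g \<delta>(1) by auto
  ultimately have \<delta>v: "\<delta> ?v = \<one>" using v \<delta>c[OF v] by (simp add: r_cancel_one)
  \<comment> \<open>Where a crossed homomorphism is trivial, it is trivial on all powers. On the
    power that lies in \<open>H\<close> it is also the power map, and the two facts give the
    claim.\<close>
  have "\<delta> (?v [^] i) = \<one>" for i :: nat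
  proof (induction i)
    case 0
    have "\<delta> \<one> = \<one>" using \<delta>(3)[of \<one>] by (simp add: one_closed)
    then show ?case by simp
  next
    case (Suc i)
    then show ?case using \<delta>(2)[of "?v [^] i" ?v] v \<delta>v by (simp add: r_inv)
  qed
  then show ?thesis using \<delta>(3)[OF j] v by (simp add: nat_pow_pow)
qed

section \<open>Passage to quotient groups\<close>

lemma (in group_hom) rcosets_image:
  assumes "h ` carrier G = carrier H" "subgroup M G"
  shows "rcosets\<^bsub>H\<^esub> (h ` M) = (\<lambda>C. h ` C) ` (rcosets M)"
proof -
  have "h ` (M #> a) = h ` M #>\<^bsub>H\<^esub> h a" if "a \<in> carrier G" for a
    using that subgroup.subset[OF assms(2)] by (force simp: r_coset_def)
  moreover have "rcosets M = (\<lambda>a. M #> a) ` carrier G"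
    by (auto simp: RCOSETS_def)
  moreover have "rcosets\<^bsub>H\<^esub> (h ` M) = (\<lambda>a. h ` M #>\<^bsub>H\<^esub> h a) ` carrier G"
    unfolding RCOSETS_def assms(1)[symmetric] by auto
  ultimately show ?thesis
    by (simp add: image_image cong: image_cong)
qed

lemma (in normal) group_hom_factor: "group_hom G (G Mod H) (\<lambda>x. H #> x)"
  by (intro group_hom.intro group_hom_axioms.intro is_group factorgroup_is_group r_coset_hom_Mod)

lemma (in normal) factor_eq_iff:
  assumes "x \<in> carrier G" "y \<in> carrier G"
  shows "H #> x = H #> y \<longleftrightarrow> x \<otimes> inv y \<in> H"
  using assms rcos_module[OF is_group, of y x] rcos_self[OF assms(1) is_subgroup]
    repr_independence[OF _ assms(2) is_subgroup] by auto

lemma (in normal) factor_eq_self_iff: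
  "x \<in> carrier G \<Longrightarrow> H #> x = H \<longleftrightarrow> x \<in> H"
  using factor_eq_iff[of x \<one>] subset by simp

lemma (in normal) factor_derived_comm:
  assumes K: "subgroup K G" "derived G K \<subseteq> H"
    and "X \<in> (\<lambda>x. H #> x) ` K" "Y \<in> (\<lambda>x. H #> x) ` K"
  shows "X \<otimes>\<^bsub>G Mod H\<^esub> Y = Y \<otimes>\<^bsub>G Mod H\<^esub> X"
proof -
  obtain x y where xy: "x \<in> K" "X = H #> x" "y \<in> K" "Y = H #> y" using assms by auto
  then have c: "x \<in> carrier G" "y \<in> carrier G" using subgroup.subset[OF K(1)] by auto
  have "x \<otimes> y \<otimes> inv x \<otimes> inv y \<in> derived G K"
    unfolding derived_def using xy by (intro generate.incl) auto
  then have "(x \<otimes> y) \<otimes> inv (y \<otimes> x) \<in> H" using K c by (auto simp: inv_mult_group m_assoc)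
  then have "H #> (x \<otimes> y) = H #> (y \<otimes> x)" using c by (simp add: factor_eq_iff)
  then show ?thesis using xy c by (simp add: rcos_sum)
qed

text \<open>Modulo the derived subgroup of \<open>H\<close> the image of \<open>H\<close> is abelian
  and still marginal; \<open>e\<close> is the index of this image.\<close>

lemma (in normal) marginal_torsion_mod_derived:
  fixes j :: nat
  assumes fin: "finite (rcosets H)" and marg: "marginal G w H" and g: "range g \<subseteq> carrier G"
    and j: "word_value G w g [^] j \<in> H"
  obtains e :: nat where "e > 0" "word_value G w g [^] (j * e) \<in> derived G H"
proof -
  let ?D = "derived G H"
  interpret D: normal ?D G using derived_is_normal normal_axioms by blast
  let ?Q = "G Mod ?D" and ?\<pi> = "\<lambda>x. ?D #> x"
  interpret \<pi>: group_hom G ?Q ?\<pi> by (rule D.group_hom_factor)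
  have surj: "?\<pi> ` carrier G = carrier ?Q" by (simp add: carrier_FactGroup)
  interpret N: normal "?\<pi> ` H" ?Q
    by (rule surj_hom_normal_subgroup[OF \<pi>.group_hom_axioms surj])
  have cosets: "rcosets\<^bsub>?Q\<^esub> (?\<pi> ` H) = (\<lambda>C. ?\<pi> ` C) ` (rcosets H)"
    by (rule \<pi>.rcosets_image[OF surj is_subgroup])
  let ?v = "word_value G w g"
  have v: "?v \<in> carrier G" using word_value_closed[of g w] g by auto
  define e where "e = card (rcosets\<^bsub>?Q\<^esub> (?\<pi> ` H))"
  have fin': "finite (rcosets\<^bsub>?Q\<^esub> (?\<pi> ` H))" using fin cosets by simp
  have "e > 0"
    using fin' N.subgroup_in_rcosets[OF D.factorgroup_is_group] unfolding e_def card_gt_0_iff by auto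
  have pow: "?\<pi> (?v [^] i) = ?\<pi> ?v [^]\<^bsub>?Q\<^esub> i" for i :: nat
    using \<pi>.hom_nat_pow[OF v] by simp
  have val: "word_value ?Q w (\<lambda>i. ?\<pi> (g i)) = ?\<pi> ?v"
    using \<pi>.word_value_hom_image[OF g] .
  have "word_value ?Q w (\<lambda>i. ?\<pi> (g i)) [^]\<^bsub>?Q\<^esub> (j * card (rcosets\<^bsub>?Q\<^esub> (?\<pi> ` H))) = \<one>\<^bsub>?Q\<^esub>"
  proof (rule N.abelian_marginal_torsion)
    show "X \<otimes>\<^bsub>?Q\<^esub> Y = Y \<otimes>\<^bsub>?Q\<^esub> X" if "X \<in> ?\<pi> ` H" "Y \<in> ?\<pi> ` H" for X Y
      using D.factor_derived_comm[OF is_subgroup] that by blast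
    show "marginal ?Q w (?\<pi> ` H)" by (rule \<pi>.marginal_image[OF surj subset marg])
    show "range (\<lambda>i. ?\<pi> (g i)) \<subseteq> carrier ?Q" using g \<pi>.hom_closed by (simp add: image_subset_iff)
    show "word_value ?Q w (\<lambda>i. ?\<pi> (g i)) [^]\<^bsub>?Q\<^esub> j \<in> ?\<pi> ` H"
      unfolding val pow[symmetric] using j by blast
  qed (rule fin')
  then have "?\<pi> (?v [^] (j * e)) = ?D" unfolding val pow e_def by simp
  then have "?v [^] (j * e) \<in> ?D" using D.factor_eq_self_iff v by simp
  with \<open>e > 0\<close> show thesis using that by blast
qed

text \<open>The orbits of \<open>P\<close> on \<open>X\<close> have lengths that are powers of
  \<open>q\<close>; if all were longer than 1, then \<open>q\<close> would divide the size of
  \<open>X\<close>. The set \<open>X\<close> is left variable because one application has to leave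
  out a coset that is fixed anyway.\<close>

lemma (in group) p_group_fixed_coset:
  assumes fin: "finite (carrier G)" and S: "subgroup S G" and P: "subgroup P G"
    and card_P: "card P = q ^ a" and q: "prime (q::nat)"
    and X: "X \<subseteq> rcosets S" "\<And>C p. C \<in> X \<Longrightarrow> p \<in> P \<Longrightarrow> C #> p \<in> X" and ndvd: "\<not> q dvd card X"
  obtains C where "C \<in> X" "\<And>p. p \<in> P \<Longrightarrow> C #> p = C"
proof -
  let ?P = "G\<lparr>carrier := P\<rparr>"
  interpret P: group ?P using P subgroup_imp_group by blast
  have Pc: "p \<in> carrier G" if "p \<in> P" for p using that subgroup.subset[OF P] by auto
  have Xc: "C \<subseteq> carrier G" if "C \<in> X" for C
    by (rule subgroup.rcosets_carrier[OF S is_group subsetD[OF X(1) that]])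
  have Pinv: "inv p \<in> P" if "p \<in> P" for p by (rule subgroup.m_inv_closed[OF P that])
  have finX: "finite X" 
    using finite_subset[OF X(1)] fin by (simp add: RCOSETS_def)
  \<comment> \<open>Right multiplication by the inverse is a left action; the restriction to
    \<open>X\<close> is what \<open>Bij\<close> asks for.\<close>
  define \<phi> where "\<phi> p = (\<lambda>C\<in>X. C #> inv p)" for p
  have comp: "C #> a #> b = C #> (a \<otimes> b)" if "C \<in> X" "a \<in> P" "b \<in> P" for C a b
    using coset_mult_assoc Xc Pc that by auto
  have bij: "\<phi> p \<in> Bij X" if p: "p \<in> P" for p
  proof -
    have "bij_betw (\<phi> p) X X"
      by (rule bij_betwI[where g = "\<lambda>C. C #> p"])
        (use p X(2) Pinv comp Xc Pc in \<open>auto simp: \<phi>_def coset_mult_one\<close>)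
    then show ?thesis by (simp add: Bij_def \<phi>_def)
  qed
  interpret act: group_action ?P X \<phi>
  proof (intro group_action.intro group_hom.intro group_hom_axioms.intro P.is_group group_BijGroup)
    show "\<phi> \<in> hom ?P (BijGroup X)"
    proof (rule homI)
      fix x y assume "x \<in> carrier ?P" "y \<in> carrier ?P"
      then have xy: "x \<in> P" "y \<in> P" by auto
      have "\<phi> (x \<otimes> y) = compose X (\<phi> x) (\<phi> y)"
        unfolding compose_def by (rule ext) (use xy X(2) Pinv comp Pc in \<open>auto simp: \<phi>_def inv_mult_group\<close>)
      then show "\<phi> (x \<otimes>\<^bsub>?P\<^esub> y) = \<phi> x \<otimes>\<^bsub>BijGroup X\<^esub> \<phi> y"
        using xy bij by (simp add: BijGroup_def)
    qed (simp add: BijGroup_def bij)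
  qed
  have "\<exists>O'\<in>orbits ?P X \<phi>. \<not> q dvd card O'"
  proof (rule ccontr)
    assume "\<not> ?thesis"
    then have "q dvd (\<Sum>O'\<in>orbits ?P X \<phi>. card O')" by (intro dvd_sum) auto
    also have "\<dots> = card X" using act.disjoint_sum[OF finX, of "\<lambda>_. 1::nat"] by simp
    finally show False using ndvd by simp
  qed
  then obtain C where C: "C \<in> X" "\<not> q dvd card (orbit ?P \<phi> C)" by (auto simp: orbits_def)
  have "card (orbit ?P \<phi> C) dvd q ^ a"
    using act.orbit_stabilizer_theorem[OF C(1)] dvd_triv_left[of "card (orbit ?P \<phi> C)" "card (stabilizer ?P \<phi> C)"]
    by (simp add: Coset.order_def card_P)
  then obtain i where "card (orbit ?P \<phi> C) = q ^ i" using divides_primepow_nat[OF q] by auto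
  with C(2) have "card (orbit ?P \<phi> C) = 1" by (cases i) auto
  moreover have "C \<in> orbit ?P \<phi> C" using act.orbit_refl C(1) by blast
  ultimately have "orbit ?P \<phi> C = {C}" by (auto simp: card_1_singleton_iff)
  then have "\<phi> p C = C" if "p \<in> P" for p using that by (auto simp: orbit_def)
  then have "C #> p = C" if "p \<in> P" for p
    using Pinv[OF that] C(1) Pc[OF that] by (fastforce simp: \<phi>_def)
  then show thesis using that C(1) by blast
qed

lemma (in group) coset_fixed_iff:
  assumes "subgroup S G" "x \<in> carrier G" "p \<in> carrier G" "S #> x #> p = S #> x"
  shows "x \<otimes> p \<otimes> inv x \<in> S"
proof -
  have "x \<otimes> p \<in> S #> x"
    using assms(2-4) rcos_self[OF _ assms(1), of "x \<otimes> p"] coset_mult_assoc[OF subgroup.subset[OF assms(1)]] by simp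
  then show ?thesis using subgroup.rcos_module_imp[OF assms(1) is_group assms(2)] by blast
qed

text \<open>Let \<open>P\<close> act by right multiplication: if it fixes the coset
  \<open>S #> x\<close>, then conjugation by \<open>x\<close> maps \<open>P\<close> into
  \<open>S\<close>.\<close>

lemma (in group) sylow_conj:
  assumes fin: "finite (carrier G)" and S: "subgroup S G" and P: "subgroup P G"
    and "card P = q ^ a" "prime (q::nat)" "\<not> q dvd card (rcosets S)"
  obtains x where "x \<in> carrier G" "\<And>p. p \<in> P \<Longrightarrow> x \<otimes> p \<otimes> inv x \<in> S"
proof -
  have Pc: "p \<in> carrier G" if "p \<in> P" for p using that subgroup.subset[OF P] by auto
  have "C #> p \<in> rcosets S" if "C \<in> rcosets S" "p \<in> P" for C p
    using that Pc coset_mult_assoc[OF subgroup.subset[OF S]] by (auto simp: RCOSETS_def)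
  then obtain C where C: "C \<in> rcosets S" "\<And>p. p \<in> P \<Longrightarrow> C #> p = C"
    using p_group_fixed_coset[OF fin S P assms(4,5), of "rcosets S"] assms(6) by blast
  then obtain x where "x \<in> carrier G" "C = S #> x" by (auto simp: RCOSETS_def)
  then show thesis using that coset_fixed_iff[OF S] C(2) Pc by metis
qed

section \<open>Coprime supplements in finite groups\<close>

lemma (in group) prime_order_comm:
  assumes "prime (Coset.order G)" "x \<in> carrier G" "y \<in> carrier G"
  shows "x \<otimes> y = y \<otimes> x"
proof (cases "y = \<one>")
  case False
  \<comment> \<open>The centralizer of \<open>y\<close> contains both \<open>\<one>\<close> and
    \<open>y\<close>, so by Lagrange it is the whole group.\<close>
  let ?C = "{z \<in> carrier G. z \<otimes> y = y \<otimes> z}"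
  have "subgroup ?C G"
  proof
    show "a \<otimes> b \<in> ?C" if "a \<in> ?C" "b \<in> ?C" for a b
      using that assms(3) m_assoc[of a b y] m_assoc[of a y b] m_assoc[of y a b] by auto
    show "inv a \<in> ?C" if "a \<in> ?C" for a
    proof -
      have a: "a \<in> carrier G" "a \<otimes> y = y \<otimes> a" using that by auto
      have "y \<otimes> inv a = inv a \<otimes> (a \<otimes> y) \<otimes> inv a"
        using a(1) assms(3) by (simp add: inv_mult_cancel)
      also have "\<dots> = inv a \<otimes> y" unfolding a(2) using a(1) assms(3) by (simp add: m_assoc)
      finally show ?thesis using a(1) by simp
    qed
  qed (use assms in auto)
  then have "card ?C dvd Coset.order G" by (metis dvd_triv_right lagrange)
  moreover have fin: "finite (carrier G)"
    using assms(1) by (metis not_prime_0 order_gt_0_iff_finite neq0_conv)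
  moreover have "card ?C > 1"
  proof -
    have "card {\<one>, y} \<le> card ?C" using fin assms by (intro card_mono) auto
    then show ?thesis using False by simp
  qed
  ultimately have "card ?C = card (carrier G)"
    using assms(1) by (metis Coset.order_def nat_neq_iff prime_nat_iff)
  then have "?C = carrier G" using fin by (intro card_subset_eq) auto
  then show ?thesis using assms(2) by auto
qed (use assms in auto)

text \<open>The normalizer of \<open>Y\<close>. The condition is an equivalence so that closure
  under inverses also holds for infinite \<open>Y\<close>.\<close>

definition conj_stabilizer :: "('a, 'm) monoid_scheme \<Rightarrow> 'a set \<Rightarrow> 'a set" where
  "conj_stabilizer G Y =
    {z \<in> carrier G. \<forall>p\<in>carrier G. p \<in> Y \<longleftrightarrow> z \<otimes>\<^bsub>G\<^esub> p \<otimes>\<^bsub>G\<^esub> inv\<^bsub>G\<^esub> z \<in> Y}"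

text \<open>For finite \<open>Y\<close> one inclusion suffices, because an injective map of
  \<open>Y\<close> into itself is onto.\<close>

lemma (in group) conj_stabilizerI:
  assumes "finite Y" "Y \<subseteq> carrier G" "z \<in> carrier G" "\<And>p. p \<in> Y \<Longrightarrow> z \<otimes> p \<otimes> inv z \<in> Y"
  shows "z \<in> conj_stabilizer G Y"
proof -
  have inj: "inj_on (\<lambda>p. z \<otimes> p \<otimes> inv z) (carrier G)"
    using assms(3) by (auto simp: inj_on_def)
  then have surj: "(\<lambda>p. z \<otimes> p \<otimes> inv z) ` Y = Y"
    using assms by (intro endo_inj_surj) (auto intro: inj_on_subset)
  have "p \<in> Y" if "p \<in> carrier G" "z \<otimes> p \<otimes> inv z \<in> Y" for p
  proof -
    have "z \<otimes> p \<otimes> inv z \<in> (\<lambda>p. z \<otimes> p \<otimes> inv z) ` Y" using that(2) surj by simp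
    then obtain y where "y \<in> Y" "z \<otimes> p \<otimes> inv z = z \<otimes> y \<otimes> inv z" by blast
    then show ?thesis using inj_onD[OF inj, of p y] that(1) subsetD[OF assms(2)] by simp
  qed
  then show ?thesis using assms(3,4) unfolding conj_stabilizer_def by blast
qed

lemma (in group) subgroup_conj_stabilizer: "subgroup (conj_stabilizer G Y) G"
proof
  have assoc: "a \<otimes> b \<otimes> p \<otimes> inv (a \<otimes> b) = a \<otimes> (b \<otimes> p \<otimes> inv b) \<otimes> inv a"
    if "a \<in> carrier G" "b \<in> carrier G" "p \<in> carrier G" for a b p
    using that by (simp add: m_assoc inv_mult_group)
  show "a \<otimes> b \<in> conj_stabilizer G Y" if "a \<in> conj_stabilizer G Y" "b \<in> conj_stabilizer G Y" for a b
    using that by (simp add: conj_stabilizer_def assoc)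
  show "inv a \<in> conj_stabilizer G Y" if a: "a \<in> conj_stabilizer G Y" for a
  proof -
    have ac: "a \<in> carrier G" using a by (simp add: conj_stabilizer_def)
    have "p \<in> Y \<longleftrightarrow> inv a \<otimes> p \<otimes> inv (inv a) \<in> Y" if p: "p \<in> carrier G" for p
    proof -
      have "inv a \<otimes> p \<otimes> a \<in> carrier G" using ac p by simp
      then have "inv a \<otimes> p \<otimes> a \<in> Y \<longleftrightarrow> a \<otimes> (inv a \<otimes> p \<otimes> a) \<otimes> inv a \<in> Y"
        using a unfolding conj_stabilizer_def by blast
      also have "a \<otimes> (inv a \<otimes> p \<otimes> a) \<otimes> inv a = p"
        using ac p by (simp add: m_assoc inv_mult_cancel)
      finally show ?thesis using ac by simp
    qed
    then show ?thesis using ac by (simp add: conj_stabilizer_def)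
  qed
qed (auto simp: conj_stabilizer_def)

lemma (in group) subset_conj_stabilizer:
  assumes "subgroup Y G" "finite Y"
  shows "Y \<subseteq> conj_stabilizer G Y"
proof
  fix y assume y: "y \<in> Y"
  show "y \<in> conj_stabilizer G Y"
    by (rule conj_stabilizerI)
      (use assms y in \<open>auto simp: subgroup.mem_carrier subgroup.m_closed subgroup.m_inv_closed\<close>)
qed

lemma (in group) conj_stabilizer_normal:
  assumes "subgroup Y G" "conj_stabilizer G Y = carrier G"
  shows "Y \<lhd> G"
  unfolding normal_inv_iff
proof (intro conjI ballI assms(1))
  fix x h assume "x \<in> carrier G" "h \<in> Y"
  then have "x \<in> conj_stabilizer G Y" "h \<in> carrier G" "h \<in> Y"
    using assms(2) subgroup.mem_carrier[OF assms(1)] by simp_all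
  then show "x \<otimes> h \<otimes> inv x \<in> Y" unfolding conj_stabilizer_def by blast
qed

text \<open>A subgroup \<open>Y\<close> of index \<open>q\<close> has a strictly larger normalizer,
  whose order can only be that of \<open>G\<close>. So \<open>Y\<close> is normal with a quotient of
  prime order, and the derived subgroup lies in \<open>Y\<close>.\<close>

lemma (in group) derived_p_group:
  assumes ord: "Coset.order G = q ^ a" and "a > 0" and q: "prime (q::nat)"
  shows "derived G (carrier G) \<noteq> carrier G"
proof -
  have q2: "q \<ge> 2" using q by (rule prime_ge_2_nat)
  have fin: "finite (carrier G)"
    using ord q2 order_gt_0_iff_finite by auto
  obtain b where a: "a = Suc b" using \<open>a > 0\<close> gr0_implies_Suc by blast
  obtain Y where Y: "subgroup Y G" "card Y = q ^ b"
    using sylow_thm[OF q is_group _ fin, of b q] ord a by auto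
  have Yfin: "finite Y" using fin Y(1) finite_subset subgroup.subset by blast
  have "card (rcosets Y) * q ^ b = q * q ^ b" using lagrange[OF Y(1)] ord a Y(2) by simp
  then have index: "card (rcosets Y) = q" using q2 by simp
  have Yin: "Y \<in> rcosets Y" by (rule subgroup.subgroup_in_rcosets[OF Y(1) is_group])
  have Yc: "y \<in> carrier G" if "y \<in> Y" for y by (rule subgroup.mem_carrier[OF Y(1) that])
  \<comment> \<open>\<open>Y\<close> itself is always fixed. Without it \<open>q - 1\<close> cosets
    are left, and a fixed one among them yields an element of the normalizer outside
    \<open>Y\<close>.\<close>
  let ?X = "rcosets Y - {Y}"
  have stable: "C #> p \<in> ?X" if C: "C \<in> ?X" and p: "p \<in> Y" for C p
  proof
    obtain c where c: "c \<in> carrier G" "C = Y #> c" using C by (auto simp: RCOSETS_def)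
    have eq: "C #> p = Y #> (c \<otimes> p)" using c Yc[OF p] coset_mult_assoc[OF subgroup.subset[OF Y(1)]] by simp
    then show "C #> p \<in> rcosets Y" using c Yc[OF p] by (auto simp: RCOSETS_def)
    have "c \<otimes> p \<notin> Y"
    proof
      assume "c \<otimes> p \<in> Y"
      then have "(c \<otimes> p) \<otimes> inv p \<in> Y" using p by (simp add: subgroup.m_closed[OF Y(1)] subgroup.m_inv_closed[OF Y(1)])
      then have "c \<in> Y" using c Yc[OF p] by (simp add: m_assoc)
      then show False using C c Y(1) coset_join2 by simp
    qed
    then show "C #> p \<notin> {Y}" using eq rcos_self[OF _ Y(1), of "c \<otimes> p"] c Yc[OF p] by auto
  qed
  have ndvd: "\<not> q dvd card ?X"
  proof -
    have "card ?X = q - 1" using index Yin by simp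
    then show ?thesis using q2 by (auto dest!: dvd_imp_le)
  qed
  obtain C where C: "C \<in> ?X" "\<And>p. p \<in> Y \<Longrightarrow> C #> p = C"
    using p_group_fixed_coset[OF fin Y(1) Y(1) Y(2) q Diff_subset stable ndvd] by metis
  obtain c where c: "c \<in> carrier G" "C = Y #> c" using C by (auto simp: RCOSETS_def)
  have "c \<notin> Y" using C(1) c coset_join2[OF c(1) Y(1)] by auto
  have "c \<otimes> p \<otimes> inv c \<in> Y" if "p \<in> Y" for p
    using coset_fixed_iff[OF Y(1) c(1) Yc[OF that]] C(2)[OF that] c(2) by simp
  then have cN: "c \<in> conj_stabilizer G Y"
    using conj_stabilizerI[OF Yfin subgroup.subset[OF Y(1)] c(1)] by blast
  let ?N = "conj_stabilizer G Y"
  have Nfin: "finite ?N" using fin subgroup.subset[OF subgroup_conj_stabilizer] finite_subset by metis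
  have "Y \<subset> ?N" using subset_conj_stabilizer[OF Y(1) Yfin] cN \<open>c \<notin> Y\<close> by blast
  then have "q ^ b < card ?N" using Y(2) psubset_card_mono[OF Nfin] by metis
  moreover have "card ?N dvd q ^ a"
    using lagrange[OF subgroup_conj_stabilizer[of Y]] unfolding ord by (metis dvd_triv_right)
  then obtain i where i: "i \<le> a" "card ?N = q ^ i" using divides_primepow_nat[OF q] by auto
  ultimately have "b < i" using q2 by (simp add: power_strict_increasing_iff)
  then have "i = a" using i(1) a by simp
  then have "card ?N = Coset.order G" using i(2) ord by simp
  then have "?N = carrier G"
    using fin subgroup.subset[OF subgroup_conj_stabilizer] by (intro card_subset_eq) (auto simp: Coset.order_def)
  then interpret Y: normal Y G using conj_stabilizer_normal[OF Y(1)] by simp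
  have "Coset.order (G Mod Y) = q" using index by (simp add: FactGroup_def Coset.order_def)
  then have "comm_group (G Mod Y)"
    using group.prime_order_comm[OF Y.factorgroup_is_group] q
    by (intro group.group_comm_groupI Y.factorgroup_is_group) auto
  then have "derived G (carrier G) \<subseteq> Y" by (rule derived_minimal[OF Y.normal_axioms])
  moreover have "Y \<noteq> carrier G" using \<open>c \<notin> Y\<close> c by blast
  ultimately show ?thesis using Y.subset by blast
qed

lemma (in group) derived_p_subgroup:
  assumes "subgroup S G" "card S = q ^ a" "a > 0" "prime (q::nat)"
  shows "derived G S \<noteq> S"
proof -
  interpret S: group "G\<lparr>carrier := S\<rparr>" using assms(1) subgroup_imp_group by blast
  have "derived (G\<lparr>carrier := S\<rparr>) S \<noteq> S"
    using S.derived_p_group[of q a] assms by (simp add: Coset.order_def)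
  then show ?thesis using derived_consistent[OF _ assms(1), of S] by simp
qed

lemma (in group) subgroup_pow_card:
  assumes "subgroup S G" "x \<in> S"
  shows "x [^] card S = \<one>"
proof -
  interpret S: group "G\<lparr>carrier := S\<rparr>" using assms(1) subgroup_imp_group by blast
  have "x [^]\<^bsub>G\<lparr>carrier := S\<rparr>\<^esub> card S = \<one>"
    using S.pow_order_eq_1[of x] assms(2) by (simp add: Coset.order_def)
  then show ?thesis by (simp add: nat_pow_consistent[symmetric])
qed

lemma (in group) pow_coprime_eq_one:
  assumes "x \<in> carrier G" "x [^] (m::nat) = \<one>" "x [^] (n::nat) = \<one>" "coprime m n"
  shows "x = \<one>"
proof -
  have "ord x dvd m" "ord x dvd n" using assms pow_eq_id by auto
  then have "ord x = 1" using assms(4) by (metis coprime_common_divisor_nat nat_dvd_1_iff_1)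
  then show ?thesis using assms(1) ord_eq_1 by auto
qed

lemma (in group) pow_cong_one:
  assumes x: "x \<in> carrier G" "x [^] (n::nat) = \<one>" and m: "[m = 1] (mod n)"
  shows "x [^] m = x"
proof -
  obtain k l where "1 + k * n = m + l * n" using m cong_iff_lin_nat by blast
  then have "x [^] (1 + n * k) = x [^] (m + n * l)" by (simp only: mult.commute)
  then have "x [^] (1::nat) \<otimes> (x [^] n) [^] k = x [^] m \<otimes> (x [^] n) [^] l"
    by (simp only: nat_pow_pow[OF x(1)] nat_pow_mult[OF x(1)])
  then show ?thesis using x by simp
qed

lemma (in group) conj_eq_one:
  assumes "x \<in> carrier G" "y \<in> carrier G" "x \<otimes> y \<otimes> inv x = \<one>"
  shows "y = \<one>"
proof -
  have "y = inv x \<otimes> (x \<otimes> y \<otimes> inv x) \<otimes> x"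
    using assms(1,2) by (simp add: m_assoc inv_mult_cancel)
  also have "\<dots> = \<one>" unfolding assms(3) using assms(1) by simp
  finally show ?thesis .
qed

lemma (in group) subgroup_nat_pow:
  assumes "subgroup S G" "x \<in> S"
  shows "x [^] (n::nat) \<in> S"
  using assms by (induction n) (auto simp: subgroup.one_closed subgroup.m_closed)

text \<open>A Sylow \<open>q\<close>-subgroup \<open>S\<close> of \<open>M\<close> is normal in \<open>G\<close> by the Frattini argument. A crossed homomorphism to
  \<open>S\<close> modulo its derived subgroup is bijective on the latter quotient, so its kernel is a supplement of \<open>M\<close>.\<close>

lemma (in group) no_proper_supplement_imp_coprime:
  assumes fin: "finite (carrier G)" and M: "M \<lhd> G" and q: "prime (q::nat)"
    and index: "\<not> q dvd card (rcosets M)"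
    and min: "\<And>H. subgroup H G \<Longrightarrow> (\<And>z. z \<in> carrier G \<Longrightarrow> \<exists>m\<in>M. m \<otimes> z \<in> H) \<Longrightarrow> H = carrier G"
  shows "\<not> q dvd Coset.order G"
proof
  assume dvd: "q dvd Coset.order G"
  interpret M: normal M G by fact
  let ?M = "G\<lparr>carrier := M\<rparr>"
  interpret GM: group ?M using M.is_subgroup subgroup_imp_group by blast
  have ordG: "card (rcosets M) * card M = Coset.order G" using lagrange[OF M.is_subgroup] .
  have Mfin: "finite M" using fin M.subset finite_subset by blast
  have "card M \<noteq> 0" using Mfin M.one_closed by (metis card_0_eq empty_iff)
  moreover have "q dvd card M" using dvd index q unfolding ordG[symmetric] by (simp add: prime_dvd_mult_iff)
  moreover have "\<not> is_unit q" using q by auto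
  ultimately obtain r where r: "card M = q ^ multiplicity q (card M) * r" "\<not> q dvd r"
    using multiplicity_decompose' by metis
  define a where "a = multiplicity q (card M)"
  have cardM: "card M = q ^ a * r" using r a_def by simp
  have "a > 0" using cardM \<open>q dvd card M\<close> r(2) by (cases a) auto
  obtain S where S': "subgroup S ?M" and cardS: "card S = q ^ a"
    using sylow_thm[OF q GM.is_group, of a r] cardM Mfin by (auto simp: Coset.order_def)
  have S: "subgroup S G" using incl_subgroup[OF M.is_subgroup S'] .
  have SM: "S \<subseteq> M" using subgroup.subset[OF S'] by simp
  have q0: "q ^ a \<noteq> 0" using q by simp
  have "card (rcosets\<^bsub>?M\<^esub> S) * q ^ a = r * q ^ a"
    using GM.lagrange[OF S'] cardM cardS by (simp add: Coset.order_def mult.commute)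
  then have indexS: "card (rcosets\<^bsub>?M\<^esub> S) = r"
    using q0 mult_right_cancel[of "q ^ a"] by blast
  have Sfin: "finite S" using SM Mfin finite_subset by blast
  \<comment> \<open>By Sylow's theorem inside \<open>M\<close>, each conjugate of \<open>S\<close>
    is carried back to \<open>S\<close> by an element of \<open>M\<close>. So the normalizer is a
    supplement of \<open>M\<close>, and \<open>min\<close> makes it everything.\<close>
  have "conj_stabilizer G S = carrier G"
  proof (rule min[OF subgroup_conj_stabilizer])
    fix z assume z: "z \<in> carrier G"
    let ?P = "(\<lambda>p. z \<otimes> p \<otimes> inv z) ` S"
    interpret conj: group_hom G G "\<lambda>p. z \<otimes> p \<otimes> inv z" by (rule group_hom_conj[OF z])
    have "subgroup ?P G" by (rule conj.subgroup_img_is_subgroup[OF S])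
    moreover have "?P \<subseteq> M" using SM M.inv_op_closed2[OF z] by auto
    ultimately have P: "subgroup ?P ?M" using subgroup_incl M.is_subgroup by blast
    have "inj_on (\<lambda>p. z \<otimes> p \<otimes> inv z) S"
      using z subgroup.mem_carrier[OF S] by (auto simp: inj_on_def)
    then have "card ?P = q ^ a" using cardS card_image by metis
    then obtain x where x: "x \<in> M" "\<And>p. p \<in> ?P \<Longrightarrow> x \<otimes>\<^bsub>?M\<^esub> p \<otimes>\<^bsub>?M\<^esub> inv\<^bsub>?M\<^esub> x \<in> S"
      using GM.sylow_conj[OF _ S' P _ q] indexS r(2) Mfin by auto
    have xc: "x \<in> carrier G" using x(1) by simp
    have inv_x: "inv\<^bsub>?M\<^esub> x = inv x" using m_inv_consistent[OF M.is_subgroup x(1)] .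
    have "x \<otimes> z \<in> conj_stabilizer G S"
    proof (rule conj_stabilizerI[OF Sfin subgroup.subset[OF S]])
      fix p assume p: "p \<in> S"
      then have pc: "p \<in> carrier G" using subgroup.mem_carrier[OF S] by blast
      have "x \<otimes> (z \<otimes> p \<otimes> inv z) \<otimes> inv x \<in> S" using x(2)[OF imageI[OF p]] inv_x by simp
      then show "x \<otimes> z \<otimes> p \<otimes> inv (x \<otimes> z) \<in> S"
        using xc z pc by (simp add: m_assoc inv_mult_group)
    qed (use xc z in simp)
    then show "\<exists>m\<in>M. m \<otimes> z \<in> conj_stabilizer G S" using x(1) by blast
  qed
  then interpret S: normal S G using conj_stabilizer_normal[OF S] by blast
  let ?D = "derived G S"
  interpret D: normal ?D G using derived_is_normal S.normal_axioms by blast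
  have DS: "?D \<subseteq> S" using derived_incl[OF _ S] by blast
  let ?Q = "G Mod ?D" and ?\<pi> = "\<lambda>x. ?D #> x"
  interpret Q: group ?Q by (rule D.factorgroup_is_group)
  interpret \<pi>: group_hom G ?Q ?\<pi> by (rule D.group_hom_factor)
  have surj: "?\<pi> ` carrier G = carrier ?Q" by (simp add: carrier_FactGroup)
  interpret N: normal "?\<pi> ` S" ?Q
    by (rule S.surj_hom_normal_subgroup[OF \<pi>.group_hom_axioms surj])
  define r' where "r' = card (rcosets\<^bsub>?Q\<^esub> (?\<pi> ` S))"
  have finQ: "finite (carrier ?Q)" using fin surj by (metis finite_imageI)
  have finN: "finite (rcosets\<^bsub>?Q\<^esub> (?\<pi> ` S))" using finQ by (simp add: RCOSETS_def)
  \<comment> \<open>Counting shows that the image of \<open>S\<close> has index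
    \<open>card (rcosets M) * r\<close>, which is prime to \<open>q\<close>.\<close>
  have "r' * card (?\<pi> ` S) * card ?D = Coset.order ?Q * card ?D"
    using Q.lagrange[OF N.is_subgroup] by (simp add: r'_def)
  also have "\<dots> = card (rcosets M) * (q ^ a * r)"
    using lagrange[OF D.is_subgroup] ordG cardM by (simp add: FactGroup_def Coset.order_def)
  finally have "r' * (card (?\<pi> ` S) * card ?D) = card (rcosets M) * r * q ^ a"
    by (simp add: ac_simps)
  moreover have "card (?\<pi> ` S) * card ?D = q ^ a"
  proof -
    interpret GS: group "G\<lparr>carrier := S\<rparr>" using S subgroup_imp_group by blast
    have "subgroup ?D (G\<lparr>carrier := S\<rparr>)" using subgroup_incl[OF D.is_subgroup S DS] .
    then have "card (rcosets\<^bsub>G\<lparr>carrier := S\<rparr>\<^esub> ?D) * card ?D = q ^ a"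
      using GS.lagrange[of ?D] cardS by (simp add: Coset.order_def)
    moreover have "rcosets\<^bsub>G\<lparr>carrier := S\<rparr>\<^esub> ?D = ?\<pi> ` S"
      by (auto simp: RCOSETS_def r_coset_def)
    ultimately show ?thesis by simp
  qed
  ultimately have "r' = card (rcosets M) * r" using q0 mult_right_cancel[of "q ^ a"] by metis
  then have "\<not> q dvd r'" using index r(2) q by (simp add: prime_dvd_mult_iff)
  then have "coprime r' (q ^ a)"
    using q by (metis coprime_commute coprime_power_left_iff prime_imp_coprime)
  \<comment> \<open>\<open>u\<close> inverts \<open>r'\<close> modulo \<open>q ^ a\<close>, so
    raising to the power \<open>u\<close> extracts roots of order \<open>r'\<close> in the image of
    \<open>S\<close>.\<close>
  then obtain u where u: "[r' * u = 1] (mod q ^ a)" 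
    using cong_solve_coprime_nat[of r' "q ^ a"] by (metis One_nat_def)
  have pow_qa: "X [^]\<^bsub>?Q\<^esub> (q ^ a) = \<one>\<^bsub>?Q\<^esub>" if X: "X \<in> ?\<pi> ` S" for X
  proof -
    obtain x where x: "x \<in> S" "X = ?\<pi> x" using X by blast
    have "x [^] (q ^ a) = \<one>" using subgroup_pow_card[OF S x(1)] cardS by simp
    moreover have "?\<pi> x [^]\<^bsub>?Q\<^esub> (q ^ a) = ?\<pi> (x [^] (q ^ a))"
      using \<pi>.hom_nat_pow[of x "q ^ a"] x(1) by simp
    ultimately show ?thesis using x(2) \<pi>.hom_one by simp
  qed
  have root: "(X [^]\<^bsub>?Q\<^esub> u) [^]\<^bsub>?Q\<^esub> r' = X" if X: "X \<in> ?\<pi> ` S" for X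
  proof -
    have Xc: "X \<in> carrier ?Q" using X N.mem_carrier by blast
    have "(X [^]\<^bsub>?Q\<^esub> u) [^]\<^bsub>?Q\<^esub> r' = X [^]\<^bsub>?Q\<^esub> (r' * u)"
      using Q.nat_pow_pow[OF Xc, of u r'] by (simp add: mult.commute)
    also have "\<dots> = X" by (rule Q.pow_cong_one[OF Xc pow_qa[OF X] u])
    finally show ?thesis .
  qed
  have commN: "X \<otimes>\<^bsub>?Q\<^esub> Y = Y \<otimes>\<^bsub>?Q\<^esub> X" if "X \<in> ?\<pi> ` S" "Y \<in> ?\<pi> ` S" for X Y
    using D.factor_derived_comm[OF S _ that] by blast
  obtain \<delta> where \<delta>: "\<And>X. X \<in> carrier ?Q \<Longrightarrow> \<delta> X \<in> ?\<pi> ` S"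
    "\<And>X Y. X \<in> carrier ?Q \<Longrightarrow> Y \<in> carrier ?Q \<Longrightarrow>
      \<delta> (X \<otimes>\<^bsub>?Q\<^esub> Y) = \<delta> X \<otimes>\<^bsub>?Q\<^esub> (X \<otimes>\<^bsub>?Q\<^esub> \<delta> Y \<otimes>\<^bsub>?Q\<^esub> inv\<^bsub>?Q\<^esub> X)"
    "\<And>X. X \<in> ?\<pi> ` S \<Longrightarrow> \<delta> X = X [^]\<^bsub>?Q\<^esub> r'"
    using N.crossed_hom_exists[OF commN finN] unfolding r'_def by metis
  have \<delta>c: "\<delta> X \<in> carrier ?Q" if "X \<in> carrier ?Q" for X using \<delta>(1)[OF that] N.mem_carrier by blast
  have \<pi>c: "?\<pi> x \<in> carrier ?Q" if "x \<in> carrier G" for x using that \<pi>.hom_closed by blast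
  \<comment> \<open>The kernel of the crossed homomorphism, pulled back to \<open>G\<close>.\<close>
  let ?X = "{x \<in> carrier G. \<delta> (?\<pi> x) = \<one>\<^bsub>?Q\<^esub>}"
  have "\<delta> \<one>\<^bsub>?Q\<^esub> = \<one>\<^bsub>?Q\<^esub>" using \<delta>(3)[OF N.one_closed] Q.nat_pow_one by simp
  note \<delta>_one = this
  have "?X = carrier G"
  proof (rule min)
    show "subgroup ?X G"
    proof
      show "?X \<subseteq> carrier G" by blast
      show "\<one> \<in> ?X" using \<delta>_one \<pi>.hom_one by simp
      show "x \<otimes> y \<in> ?X" if "x \<in> ?X" "y \<in> ?X" for x y
      proof -
        have xy: "x \<in> carrier G" "y \<in> carrier G" "\<delta> (?\<pi> x) = \<one>\<^bsub>?Q\<^esub>" "\<delta> (?\<pi> y) = \<one>\<^bsub>?Q\<^esub>" using that by auto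
        have "\<delta> (?\<pi> (x \<otimes> y)) = \<one>\<^bsub>?Q\<^esub>"
          using \<pi>.hom_mult[OF xy(1,2)] \<delta>(2)[OF \<pi>c[OF xy(1)] \<pi>c[OF xy(2)]] xy(3,4) \<pi>c[OF xy(1)]
          by (metis Q.l_one Q.one_closed Q.r_inv Q.r_one)
        then show ?thesis using xy by simp
      qed
      show "inv x \<in> ?X" if "x \<in> ?X" for x
      proof -
        have x: "x \<in> carrier G" "\<delta> (?\<pi> x) = \<one>\<^bsub>?Q\<^esub>" using that by auto
        let ?x = "?\<pi> x" and ?y = "?\<pi> (inv x)"
        have c: "?x \<in> carrier ?Q" "?y \<in> carrier ?Q" using \<pi>c x(1) by auto
        have "?x \<otimes>\<^bsub>?Q\<^esub> ?y = \<one>\<^bsub>?Q\<^esub>" using \<pi>.hom_mult[of x "inv x"] x(1) \<pi>.hom_one by simp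
        then have "\<one>\<^bsub>?Q\<^esub> = ?x \<otimes>\<^bsub>?Q\<^esub> \<delta> ?y \<otimes>\<^bsub>?Q\<^esub> inv\<^bsub>?Q\<^esub> ?x"
          using \<delta>(2)[OF c] x(2) \<delta>_one \<delta>c[OF c(2)] c
          by (metis Q.inv_closed Q.l_one Q.m_closed)
        then have "\<delta> ?y = \<one>\<^bsub>?Q\<^esub>" using Q.conj_eq_one[OF c(1) \<delta>c[OF c(2)]] by simp
        then show ?thesis using x(1) by simp
      qed
    qed
    fix z assume z: "z \<in> carrier G"
    \<comment> \<open>On the image of \<open>S\<close> the map \<open>\<delta>\<close> is raising to
      the power \<open>r'\<close>, so it sends \<open>?Y\<close> to the inverse of its value at
      \<open>z\<close>. Multiplying \<open>z\<close> by a preimage of \<open>?Y\<close> in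
      \<open>S\<close> therefore lands in the kernel.\<close>
    let ?Y = "inv\<^bsub>?Q\<^esub> \<delta> (?\<pi> z) [^]\<^bsub>?Q\<^esub> u"
    have dz: "\<delta> (?\<pi> z) \<in> ?\<pi> ` S" using \<delta>(1) \<pi>c[OF z] by blast
    then have inv_dz: "inv\<^bsub>?Q\<^esub> \<delta> (?\<pi> z) \<in> ?\<pi> ` S" by (rule N.m_inv_closed)
    then have "?Y \<in> ?\<pi> ` S"
      by (rule Q.subgroup_nat_pow[OF N.is_subgroup])
    then obtain s where s: "s \<in> S" "?\<pi> s = ?Y" by auto
    have sc: "s \<in> carrier G" using s(1) by simp
    have "\<delta> (?\<pi> s) = inv\<^bsub>?Q\<^esub> \<delta> (?\<pi> z)" using \<delta>(3)[of "?\<pi> s"] s root[OF inv_dz] by auto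
    moreover have "?\<pi> s \<otimes>\<^bsub>?Q\<^esub> \<delta> (?\<pi> z) \<otimes>\<^bsub>?Q\<^esub> inv\<^bsub>?Q\<^esub> ?\<pi> s = \<delta> (?\<pi> z)"
      using commN[OF imageI[OF s(1)] dz] \<pi>c[OF sc] \<delta>c[OF \<pi>c[OF z]]
      by (metis Q.inv_solve_right' Q.m_closed)
    ultimately have "\<delta> (?\<pi> (s \<otimes> z)) = \<one>\<^bsub>?Q\<^esub>"
      using \<delta>(2)[OF \<pi>c[OF sc] \<pi>c[OF z]] \<pi>.hom_mult[OF sc z] Q.l_inv[OF \<delta>c[OF \<pi>c[OF z]]] by metis
    then show "\<exists>m\<in>M. m \<otimes> z \<in> ?X" using s(1) SM sc z by blast
  qed
  \<comment> \<open>By minimality \<open>\<delta>\<close> is trivial everywhere, although on the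
    image of \<open>S\<close> it is a power map with exponent prime to \<open>q\<close>. So this
    image is trivial, and \<open>S\<close> would be a nontrivial q-group equal to its derived
    subgroup.\<close>
  have "S \<subseteq> ?D"
  proof
    fix s assume s: "s \<in> S"
    then have "\<delta> (?\<pi> s) = \<one>\<^bsub>?Q\<^esub>" using \<open>?X = carrier G\<close> S.mem_carrier by blast
    then have "?\<pi> s [^]\<^bsub>?Q\<^esub> r' = \<one>\<^bsub>?Q\<^esub>" using \<delta>(3)[OF imageI[OF s]] by simp
    then have "?\<pi> s = \<one>\<^bsub>?Q\<^esub>"
      using Q.pow_coprime_eq_one[OF \<pi>c _ pow_qa[OF imageI[OF s]] \<open>coprime r' (q ^ a)\<close>] s by simp
    then show "s \<in> ?D" using D.factor_eq_self_iff[of s] s by simp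
  qed
  then show False using DS derived_p_subgroup[OF S cardS \<open>a > 0\<close> q] by blast
qed

text \<open>Take a supplement \<open>H\<close> of least cardinality. A supplement of
  \<open>H \<inter> M\<close> in \<open>H\<close> is again a supplement of \<open>M\<close> in
  \<open>G\<close>, hence not smaller, so the previous lemma applies to \<open>H\<close>.\<close>

lemma (in group) coprime_supplement_exists:
  assumes fin: "finite (carrier G)" and M: "M \<lhd> G" and q: "prime (q::nat)"
    and index: "\<not> q dvd card (rcosets M)"
  obtains X where "subgroup X G" "\<not> q dvd card X" "\<And>z. z \<in> carrier G \<Longrightarrow> \<exists>m\<in>M. m \<otimes> z \<in> X"
proof -
  interpret M: normal M G by fact
  define suppl where "suppl H \<longleftrightarrow> subgroup H G \<and> (\<forall>z\<in>carrier G. \<exists>m\<in>M. m \<otimes> z \<in> H)" for H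
  have "suppl (carrier G)"
    unfolding suppl_def using subgroup_self M.one_closed by blast
  then obtain H where H: "suppl H" and least: "\<And>H'. suppl H' \<Longrightarrow> card H \<le> card H'"
    using arg_min_nat_lemma[of suppl "carrier G" card] by metis
  have Hs: "subgroup H G" using H suppl_def by blast
  let ?H = "G\<lparr>carrier := H\<rparr>"
  interpret H: group ?H using Hs subgroup_imp_group by blast
  have Hfin: "finite H" using fin subgroup.subset[OF Hs] finite_subset by blast
  have normal: "H \<inter> M \<lhd> ?H"
    using normal_Int_subgroup[OF Hs M] by (simp add: Int_commute)
  have "\<not> q dvd Coset.order ?H"
  proof (rule H.no_proper_supplement_imp_coprime[OF _ normal q])
    \<comment> \<open>The second isomorphism theorem at the level of cosets: \<open>C\<close>
      corresponds to \<open>M <#> C\<close>.\<close>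
    have "card (rcosets\<^bsub>?H\<^esub> (H \<inter> M)) = card (rcosets M)"
    proof (rule bij_betw_same_card[OF bij_betw_imageI])
      let ?f = "\<lambda>C. M <#> C"
      interpret HM: normal "H \<inter> M" ?H by (rule normal)
      have f: "M <#> ((H \<inter> M) #>\<^bsub>?H\<^esub> x) = M #> x" if x: "x \<in> H" for x
      proof -
        have xc: "x \<in> carrier G" using x Hs subgroup.mem_carrier by metis
        have HMc: "H \<inter> M \<subseteq> carrier G" using M.subset by blast
        have "M <#> (H \<inter> M) = M"
        proof
          show "M <#> (H \<inter> M) \<subseteq> M" using M.m_closed by (auto simp: set_mult_def)
          show "M \<subseteq> M <#> (H \<inter> M)"
          proof
            fix m assume m: "m \<in> M"
            have "m = m \<otimes> \<one>" using m by simp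
            moreover have "\<one> \<in> H \<inter> M" using M.one_closed subgroup.one_closed[OF Hs] by simp
            ultimately show "m \<in> M <#> (H \<inter> M)" using m unfolding set_mult_def by blast
          qed
        qed
        then show ?thesis using setmult_rcos_assoc[OF M.subset HMc xc] by simp
      qed
      show "inj_on ?f (rcosets\<^bsub>?H\<^esub> (H \<inter> M))"
      proof (rule inj_onI)
        fix C D assume "C \<in> rcosets\<^bsub>?H\<^esub> (H \<inter> M)" "D \<in> rcosets\<^bsub>?H\<^esub> (H \<inter> M)" and eq: "M <#> C = M <#> D"
        then obtain x y where xy: "x \<in> H" "C = (H \<inter> M) #>\<^bsub>?H\<^esub> x" "y \<in> H" "D = (H \<inter> M) #>\<^bsub>?H\<^esub> y"
          by (auto simp: RCOSETS_def)
        then have "M #> x = M #> y" using eq f by simp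
        then have "x \<otimes> inv y \<in> M"
          using M.factor_eq_iff subgroup.mem_carrier[OF Hs] xy(1,3) by simp
        then have "x \<otimes>\<^bsub>?H\<^esub> inv\<^bsub>?H\<^esub> y \<in> H \<inter> M"
          using xy m_inv_consistent[OF Hs] subgroup.m_closed[OF Hs] subgroup.m_inv_closed[OF Hs] by simp
        then show "C = D" using HM.factor_eq_iff[of x y] xy by simp
      qed
      show "?f ` (rcosets\<^bsub>?H\<^esub> (H \<inter> M)) = rcosets M"
      proof
        show "?f ` (rcosets\<^bsub>?H\<^esub> (H \<inter> M)) \<subseteq> rcosets M"
          using f subgroup.mem_carrier[OF Hs] by (fastforce simp: RCOSETS_def)
        show "rcosets M \<subseteq> ?f ` (rcosets\<^bsub>?H\<^esub> (H \<inter> M))"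
        proof
          fix C assume "C \<in> rcosets M"
          then obtain z where z: "z \<in> carrier G" "C = M #> z" by (auto simp: RCOSETS_def)
          obtain m where m: "m \<in> M" "m \<otimes> z \<in> H" using H z by (auto simp: suppl_def)
          have "C = M #> (m \<otimes> z)" using M.coset_absorb[OF is_group m(1) z(1)] z(2) by simp
          then have "C = ?f ((H \<inter> M) #>\<^bsub>?H\<^esub> (m \<otimes> z))" using f[OF m(2)] by simp
          moreover have "(H \<inter> M) #>\<^bsub>?H\<^esub> (m \<otimes> z) \<in> rcosets\<^bsub>?H\<^esub> (H \<inter> M)"
            using m(2) unfolding RCOSETS_def by auto
          ultimately show "C \<in> ?f ` (rcosets\<^bsub>?H\<^esub> (H \<inter> M))" by blast
        qed
      qed
    qed
    then show "\<not> q dvd card (rcosets\<^bsub>?H\<^esub> (H \<inter> M))" using index by simp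
    fix K assume K: "subgroup K ?H" "\<And>z. z \<in> carrier ?H \<Longrightarrow> \<exists>m\<in>H \<inter> M. m \<otimes>\<^bsub>?H\<^esub> z \<in> K"
    have "suppl K"
      unfolding suppl_def
    proof (intro conjI ballI)
      show "subgroup K G" using incl_subgroup[OF Hs K(1)] .
      fix z assume z: "z \<in> carrier G"
      then obtain m where m: "m \<in> M" "m \<otimes> z \<in> H" using H by (auto simp: suppl_def)
      then obtain m' where m': "m' \<in> M" "m' \<otimes> (m \<otimes> z) \<in> K" using K(2)[of "m \<otimes> z"] by auto
      have "m' \<otimes> m \<otimes> z \<in> K" using m m' z by (simp add: m_assoc)
      then show "\<exists>m\<in>M. m \<otimes> z \<in> K" using M.m_closed[OF m'(1) m(1)] by blast
    qed
    then have "card H \<le> card K" by (rule least)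
    moreover have "K \<subseteq> H" using subgroup.subset[OF K(1)] by simp
    ultimately show "K = carrier ?H" using Hfin card_seteq by auto
  qed (simp add: Hfin)
  then show thesis using that[OF Hs] H by (auto simp: Coset.order_def suppl_def)
qed

text \<open>Marginality allows all arguments to be moved into a supplement of order prime to
  \<open>q\<close> without changing the value. So the order of the value is prime to
  \<open>q\<close>.\<close>

lemma (in normal) finite_marginal_coprime:
  assumes fin: "finite (carrier G)" and marg: "marginal G w H" and q: "prime (q::nat)"
    and index: "\<not> q dvd card (rcosets H)" and g: "range g \<subseteq> carrier G"
    and c: "word_value G w g [^] (i * q ^ j) = \<one>"
  shows "word_value G w g [^] (i::nat) = \<one>"
proof -
  obtain X where X: "subgroup X G" "\<not> q dvd card X" "\<And>z. z \<in> carrier G \<Longrightarrow> \<exists>m\<in>H. m \<otimes> z \<in> X"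
    using coprime_supplement_exists[OF fin normal_axioms q index] by blast
  have "\<forall>i. \<exists>m\<in>H. m \<otimes> g i \<in> X" using g X(3) by auto
  then obtain m where m: "\<And>i. m i \<in> H" "\<And>i. m i \<otimes> g i \<in> X" by metis
  let ?v = "word_value G w g"
  have v: "?v \<in> carrier G" using word_value_closed[of g w] g by auto
  have "word_value G w (\<lambda>i. m i \<otimes> g i) = ?v"
    using marginalD[OF marg g, of m] m(1) by auto
  moreover have "word_value G w (\<lambda>i. m i \<otimes> g i) \<in> X"
    by (rule word_value_in_subgroup[OF X(1)]) (use m(2) in auto)
  ultimately have "?v [^] card X = \<one>" using subgroup_pow_card[OF X(1)] by simp
  then have "(?v [^] i) [^] card X = \<one>"
    using v by (metis mult.commute nat_pow_one nat_pow_pow)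
  moreover have "(?v [^] i) [^] (q ^ j) = \<one>" using c v by (simp add: nat_pow_pow)
  moreover have "coprime (card X) (q ^ j)"
    using q X(2) by (metis coprime_commute coprime_power_left_iff prime_imp_coprime)
  ultimately show ?thesis using pow_coprime_eq_one v by blast
qed

section \<open>Finitely many torsion elements\<close>

text \<open>Collects \<open>j\<close> copies of \<open>v\<close> at the front of a product. A factor
  that moves to the right of a power of \<open>v\<close> turns into a conjugate, which is again in
  \<open>S\<close>, and the number of factors does not change.\<close>

lemma (in group) torsion_list_shorten:
  assumes S: "S \<subseteq> carrier G" and conj: "\<And>x y. x \<in> S \<Longrightarrow> y \<in> S \<Longrightarrow> inv x \<otimes> y \<otimes> x \<in> S"
    and "set xs \<subseteq> S" "v \<in> S" "j \<le> count_list xs v"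
  shows "\<exists>ys. set ys \<subseteq> S \<and> length ys + j = length xs \<and>
    foldr (\<otimes>) xs \<one> = v [^] j \<otimes> foldr (\<otimes>) ys \<one>"
  using assms(3,5)
proof (induction xs arbitrary: j)
  case Nil
  then show ?case by (intro exI[of _ "[]"]) simp
next
  case (Cons x xs)
  have closed: "foldr (\<otimes>) ys \<one> \<in> carrier G" if "set ys \<subseteq> S" for ys
    using that S by (induction ys) auto
  have c: "v \<in> carrier G" "x \<in> carrier G" using assms(4) Cons.prems S by auto
  show ?case
  proof (cases "j = 0")
    case True
    then show ?thesis using Cons.prems closed[of "x # xs"] by (intro exI[of _ "x # xs"]) simp
  next
    case j: False
    show ?thesis
    proof (cases "x = v")
      case True
      then have "j - 1 \<le> count_list xs v" using Cons.prems by simp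
      then obtain ys where ys: "set ys \<subseteq> S" "length ys + (j - 1) = length xs"
        "foldr (\<otimes>) xs \<one> = v [^] (j - 1) \<otimes> foldr (\<otimes>) ys \<one>"
        using Cons.IH[of "j - 1"] Cons.prems by auto
      have "foldr (\<otimes>) (x # xs) \<one> = (v \<otimes> v [^] (j - 1)) \<otimes> foldr (\<otimes>) ys \<one>"
        using ys(3) True c closed[OF ys(1)] by (simp add: m_assoc)
      also have "v \<otimes> v [^] (j - 1) = v [^] j"
        using j c(1) by (metis Suc_pred' neq0_conv nat_pow_Suc2)
      finally show ?thesis using ys j by (intro exI[of _ ys]) auto
    next
      case False
      then obtain ys where ys: "set ys \<subseteq> S" "length ys + j = length xs"
        "foldr (\<otimes>) xs \<one> = v [^] j \<otimes> foldr (\<otimes>) ys \<one>"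
        using Cons.IH[of j] Cons.prems by auto
      let ?x = "inv (v [^] j) \<otimes> x \<otimes> v [^] j"
      have x': "inv (v [^] i) \<otimes> x \<otimes> v [^] i \<in> S" for i :: nat
      proof (induction i)
        case (Suc i)
        have "inv (v [^] Suc i) \<otimes> x \<otimes> v [^] Suc i = inv v \<otimes> (inv (v [^] i) \<otimes> x \<otimes> v [^] i) \<otimes> v"
          using c by (simp add: m_assoc inv_mult_group)
        then show ?case using conj[OF assms(4) Suc] by simp
      qed (use Cons.prems c in simp)
      have "foldr (\<otimes>) (x # xs) \<one> = v [^] j \<otimes> foldr (\<otimes>) (?x # ys) \<one>"
        using c closed[OF ys(1)] ys(3) by (simp add: m_assoc inv_mult_cancel)
      then show ?thesis using ys x'[of j] by (intro exI[of _ "?x # ys"]) auto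
    qed
  qed
qed

text \<open>Dietzmann's lemma.\<close>

lemma (in group) finite_generate_torsion:
  assumes fin: "finite S" and S: "S \<subseteq> carrier G"
    and conj: "\<And>x y. x \<in> S \<Longrightarrow> y \<in> S \<Longrightarrow> inv x \<otimes> y \<otimes> x \<in> S"
    and torsion: "\<And>x. x \<in> S \<Longrightarrow> \<exists>e>0. x [^] (e::nat) = \<one>"
  shows "finite (generate G S)"
proof -
  obtain f where f: "\<And>x. x \<in> S \<Longrightarrow> f x > (0::nat)" "\<And>x. x \<in> S \<Longrightarrow> x [^] f x = \<one>"
    using torsion by metis
  define e where "e = prod f S"
  have e: "e > 0" "x [^] e = \<one>" if x: "x \<in> S" for x
  proof -
    show "e > 0" using f(1) by (simp add: e_def prod_pos)
    obtain k where k: "e = f x * k" using dvd_prodI[OF fin x, of f] unfolding e_def by (elim dvdE)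
    have "(x [^] f x) [^] k = \<one>" using f(2)[OF x] by simp
    then show "x [^] e = \<one>" using k nat_pow_pow[of x "f x" k] x S by auto
  qed
  have closed: "foldr (\<otimes>) ys \<one> \<in> carrier G" if "set ys \<subseteq> S" for ys
    using that S by (induction ys) auto
  define L where "L = card S * e"
  have short: "\<exists>ys. set ys \<subseteq> S \<and> length ys \<le> L \<and> foldr (\<otimes>) ys \<one> = foldr (\<otimes>) xs \<one>" if "set xs \<subseteq> S" for xs
    using that
  proof (induction "length xs" arbitrary: xs rule: less_induct)
    case less
    show ?case
    proof (cases "length xs \<le> L")
      case True
      then show ?thesis using less.prems by blast
    next
      case False
      have "\<exists>v\<in>S. e \<le> count_list xs v"
      proof (rule ccontr)
        assume "\<not> ?thesis"
        then have "(\<Sum>v\<in>S. count_list xs v) \<le> (\<Sum>v\<in>S. e)" by (intro sum_mono) auto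
        moreover have "(\<Sum>v\<in>S. count_list xs v) = length xs"
          using sum_count_set[OF less.prems fin] .
        ultimately show False using False by (simp add: L_def)
      qed
      then obtain v where v: "v \<in> S" "e \<le> count_list xs v" by blast
      then obtain ys where ys: "set ys \<subseteq> S" "length ys + e = length xs"
        "foldr (\<otimes>) xs \<one> = v [^] e \<otimes> foldr (\<otimes>) ys \<one>"
        using torsion_list_shorten[OF S conj less.prems v] by blast
      have "length ys < length xs" using ys(2) e(1)[OF v(1)] by simp
      then obtain zs where "set zs \<subseteq> S" "length zs \<le> L" "foldr (\<otimes>) zs \<one> = foldr (\<otimes>) ys \<one>"
        using less.hyps[OF _ ys(1)] by blast
      then show ?thesis using ys(3) e(2)[OF v(1)] closed[OF ys(1)] by auto
    qed
  qed
  have gen: "x \<in> (\<lambda>ys. foldr (\<otimes>) ys \<one>) ` {ys. set ys \<subseteq> S}" if "x \<in> generate G S" for x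
    using that
  proof (induction rule: generate.induct)
    case one
    then show ?case by (intro image_eqI[of _ _ "[]"]) auto
  next
    case (incl h)
    then show ?case using S by (intro image_eqI[of _ _ "[h]"]) auto
  next
    case (inv h)
    have h: "h \<in> carrier G" using inv S by auto
    \<comment> \<open>Torsion turns inverses into powers, so products without inverses
      suffice.\<close>
    have "h [^] (e - 1) \<otimes> h = \<one>"
      using e[OF inv] h by (metis Suc_pred' nat_pow_Suc)
    then have "inv h = h [^] (e - 1)" using h by (metis inv_equality nat_pow_closed)
    moreover have "foldr (\<otimes>) (replicate i h) \<one> = h [^] i" for i
      using h by (induction i) (simp_all add: nat_pow_Suc2[symmetric] del: nat_pow_Suc)
    ultimately show ?case using inv by (intro image_eqI[of _ _ "replicate (e - 1) h"]) auto
  next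
    case (eng h1 h2)
    then obtain xs ys where xs: "set xs \<subseteq> S" "h1 = foldr (\<otimes>) xs \<one>"
      and ys: "set ys \<subseteq> S" "h2 = foldr (\<otimes>) ys \<one>" by blast
    have "foldr (\<otimes>) (xs @ ys) \<one> = foldr (\<otimes>) xs \<one> \<otimes> foldr (\<otimes>) ys \<one>"
      using xs(1)
    proof (induction xs)
      case (Cons a xs)
      then show ?case using S closed[OF ys(1)] closed[of xs] by (simp add: m_assoc subset_iff)
    qed (use closed[OF ys(1)] in simp)
    then show ?case using xs ys by (intro image_eqI[of _ _ "xs @ ys"]) auto
  qed
  have "generate G S \<subseteq> (\<lambda>ys. foldr (\<otimes>) ys \<one>) ` {ys. set ys \<subseteq> S \<and> length ys \<le> L}"
  proof (intro subsetI)
    fix x assume "x \<in> generate G S"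
    then obtain xs where "set xs \<subseteq> S" "x = foldr (\<otimes>) xs \<one>"
      using gen by blast
    then obtain ys where "set ys \<subseteq> S \<and> length ys \<le> L" "x = foldr (\<otimes>) ys \<one>"
      using short[of xs] by metis
    then show "x \<in> (\<lambda>ys. foldr (\<otimes>) ys \<one>) ` {ys. set ys \<subseteq> S \<and> length ys \<le> L}"
      by (intro image_eqI[of _ _ ys]) simp_all
  qed
  then show ?thesis
    by (rule finite_subset) (intro finite_imageI finite_lists_length_le fin)
qed

section \<open>Ideals of finite index\<close>

text \<open>Rings and ideals are sets inside one fixed type, so that adjoining generators one by one
  never changes the type.\<close>

definition is_subring :: "'a::comm_ring_1 set \<Rightarrow> bool" where
  "is_subring R \<longleftrightarrow> 0 \<in> R \<and> 1 \<in> R \<and> (\<forall>x\<in>R. \<forall>y\<in>R. x + y \<in> R \<and> x * y \<in> R \<and> - x \<in> R)"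

definition is_ideal :: "'a::comm_ring_1 set \<Rightarrow> 'a set \<Rightarrow> bool" where
  "is_ideal R I \<longleftrightarrow> I \<subseteq> R \<and> 0 \<in> I \<and> (\<forall>x\<in>I. \<forall>y\<in>I. x + y \<in> I) \<and> (\<forall>r\<in>R. \<forall>x\<in>I. r * x \<in> I)"

definition finite_index :: "'a::comm_ring_1 set \<Rightarrow> 'a set \<Rightarrow> bool" where
  "finite_index R I \<longleftrightarrow> (\<exists>F. finite F \<and> F \<subseteq> R \<and> (\<forall>r\<in>R. \<exists>f\<in>F. r - f \<in> I))"

definition unit_mod :: "'a::comm_ring_1 set \<Rightarrow> 'a set \<Rightarrow> 'a \<Rightarrow> bool" where
  "unit_mod R I s \<longleftrightarrow> s \<in> R \<and> (\<exists>u\<in>R. s * u - 1 \<in> I)"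

text \<open>That \<open>s\<close> is a unit modulo \<open>I\<close>, and not merely outside
  \<open>I\<close>, makes the property pass to \<open>adjoin\<close>, where leading coefficients
  have to become invertible. For finitely generated domains of characteristic 0 it is a form of the
  Nullstellensatz over the integers: a maximal ideal of the localization at \<open>s\<close> has a
  finite residue field.\<close>

definition separating_ideals :: "'a::comm_ring_1 set \<Rightarrow> bool" where
  "separating_ideals R \<longleftrightarrow> is_subring R \<and> (\<forall>s\<in>R. s \<noteq> 0 \<longrightarrow> (\<exists>I. is_ideal R I \<and> finite_index R I \<and> 1 \<notin> I \<and>
     (\<exists>q::nat. prime q \<and> of_nat q \<in> I) \<and> unit_mod R I s))"

lemma is_subringD:
  assumes "is_subring R"
  shows "0 \<in> R" "1 \<in> R" "x \<in> R \<Longrightarrow> y \<in> R \<Longrightarrow> x + y \<in> R" "x \<in> R \<Longrightarrow> y \<in> R \<Longrightarrow> x * y \<in> R"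
    "x \<in> R \<Longrightarrow> - x \<in> R" "x \<in> R \<Longrightarrow> y \<in> R \<Longrightarrow> x - y \<in> R" "x \<in> R \<Longrightarrow> x ^ n \<in> R" "of_nat n \<in> R" "of_int z \<in> R"
proof -
  show *: "0 \<in> R" "1 \<in> R" "\<And>x y. x \<in> R \<Longrightarrow> y \<in> R \<Longrightarrow> x + y \<in> R"
    "\<And>x y. x \<in> R \<Longrightarrow> y \<in> R \<Longrightarrow> x * y \<in> R" "\<And>x. x \<in> R \<Longrightarrow> - x \<in> R"
    using assms by (auto simp: is_subring_def)
  show **: "\<And>x y. x \<in> R \<Longrightarrow> y \<in> R \<Longrightarrow> x - y \<in> R" using *(3,5) by (metis diff_conv_add_uminus)
  show "x \<in> R \<Longrightarrow> x ^ n \<in> R" by (induction n) (auto simp: *)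
  have nat: "of_nat n \<in> R" for n by (induction n) (auto simp: *)
  then show "of_nat n \<in> R" .
  show "of_int z \<in> R" by (cases z rule: int_diff_cases) (simp add: ** nat)
qed

lemma is_subring_sum: "is_subring R \<Longrightarrow> (\<And>i. i \<in> A \<Longrightarrow> f i \<in> R) \<Longrightarrow> sum f A \<in> R"
  by (induction A rule: infinite_finite_induct) (auto simp: is_subringD)

lemma is_idealD:
  assumes "is_subring R" "is_ideal R I"
  shows "x \<in> I \<Longrightarrow> x \<in> R" "0 \<in> I" "x \<in> I \<Longrightarrow> y \<in> I \<Longrightarrow> x + y \<in> I" "r \<in> R \<Longrightarrow> x \<in> I \<Longrightarrow> r * x \<in> I"
    "r \<in> R \<Longrightarrow> x \<in> I \<Longrightarrow> x * r \<in> I" "x \<in> I \<Longrightarrow> - x \<in> I" "x \<in> I \<Longrightarrow> y \<in> I \<Longrightarrow> x - y \<in> I"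
proof -
  show *: "\<And>x. x \<in> I \<Longrightarrow> x \<in> R" "0 \<in> I" "\<And>x y. x \<in> I \<Longrightarrow> y \<in> I \<Longrightarrow> x + y \<in> I" "\<And>r x. r \<in> R \<Longrightarrow> x \<in> I \<Longrightarrow> r * x \<in> I"
    using assms(2) by (auto simp: is_ideal_def)
  then show "r \<in> R \<Longrightarrow> x \<in> I \<Longrightarrow> x * r \<in> I" by (metis mult.commute)
  show **: "\<And>x. x \<in> I \<Longrightarrow> - x \<in> I"
    using *(4)[of "-1"] is_subringD(2,5)[OF assms(1)] by force
  show "x \<in> I \<Longrightarrow> y \<in> I \<Longrightarrow> x - y \<in> I" using *(3) ** by (metis diff_conv_add_uminus)
qed

lemma is_ideal_sum: "is_subring R \<Longrightarrow> is_ideal R I \<Longrightarrow> (\<And>i. i \<in> A \<Longrightarrow> f i \<in> I) \<Longrightarrow> sum f A \<in> I"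
  by (induction A rule: infinite_finite_induct) (auto simp: is_idealD)

lemma unit_mod_mult:
  assumes R: "is_subring R" "is_ideal R I" and "s \<in> R" "t \<in> R"
  shows "unit_mod R I (s * t) \<longleftrightarrow> unit_mod R I s \<and> unit_mod R I t"
proof
  assume "unit_mod R I (s * t)"
  then obtain u where "u \<in> R" "s * t * u - 1 \<in> I" by (auto simp: unit_mod_def)
  then have "s * (t * u) - 1 \<in> I" "t * (s * u) - 1 \<in> I" "t * u \<in> R" "s * u \<in> R"
    using assms by (auto simp: is_subringD ac_simps)
  then show "unit_mod R I s \<and> unit_mod R I t" using assms unfolding unit_mod_def by blast
next
  assume "unit_mod R I s \<and> unit_mod R I t"
  then obtain u v where uv: "u \<in> R" "s * u - 1 \<in> I" "v \<in> R" "t * v - 1 \<in> I" by (auto simp: unit_mod_def)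
  have "s * t * (u * v) - 1 = (s * u) * (t * v - 1) + (s * u - 1)" by (simp add: algebra_simps)
  also have "\<dots> \<in> I" using uv assms by (simp add: is_idealD[OF R] is_subringD)
  finally show "unit_mod R I (s * t)" using uv assms by (auto simp: unit_mod_def is_subringD)
qed

lemma unit_mod_cancel:
  assumes R: "is_subring R" "is_ideal R I" and "unit_mod R I s" "s * x \<in> I" "x \<in> R"
  shows "x \<in> I"
proof -
  obtain u where u: "u \<in> R" "s * u - 1 \<in> I" using assms by (auto simp: unit_mod_def)
  have "x = u * (s * x) - (s * u - 1) * x" by (simp add: algebra_simps)
  also have "\<dots> \<in> I"
    using is_idealD(4)[OF R u(1) assms(4)] is_idealD(5)[OF R assms(5) u(2)] by (rule is_idealD(7)[OF R])
  finally show ?thesis .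
qed

lemma separating_ideals_Ints:
  assumes "CHAR('a::idom) = 0"
  shows "separating_ideals (range (of_int :: int \<Rightarrow> 'a))"
proof -
  let ?Z = "range (of_int :: int \<Rightarrow> 'a)"
  have inj: "(of_int x :: 'a) = of_int y \<longleftrightarrow> x = y" for x y
    using of_int_eq_0_iff_char_dvd[of "x - y", where 'a = 'a] assms by simp
  have sub: "is_subring ?Z"
    unfolding is_subring_def
    by (auto simp flip: of_int_add of_int_mult of_int_minus) (metis of_int_0 rangeI, metis of_int_1 rangeI)
  show ?thesis
    unfolding separating_ideals_def
  proof (intro conjI sub ballI impI)
    fix s :: 'a assume "s \<in> ?Z" "s \<noteq> 0"
    then obtain z where z: "s = of_int z" "z \<noteq> 0" by (metis of_int_0 rangeE)
    \<comment> \<open>A prime larger than the absolute value of \<open>z\<close> does not divide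
      \<open>z\<close>; its multiples form the ideal.\<close>
    obtain q :: nat where q: "prime q" "q > nat \<bar>z\<bar>" using bigger_prime by blast
    let ?I = "range (\<lambda>k. of_int (int q * k) :: 'a)"
    have "is_ideal ?Z ?I"
      unfolding is_ideal_def
    proof (intro conjI ballI)
      show "?I \<subseteq> ?Z" by (auto simp del: of_int_mult)
      show "0 \<in> ?I" by (rule image_eqI[of _ _ 0]) auto
      show "x + y \<in> ?I" if "x \<in> ?I" "y \<in> ?I" for x y
        using that by (auto simp flip: of_int_add distrib_left simp del: of_int_mult)
      show "r * x \<in> ?I" if rx: "r \<in> ?Z" "x \<in> ?I" for r x
      proof -
        obtain a k where "r = of_int a" "x = of_int (int q * k)" using rx by auto
        then have "r * x = of_int (int q * (a * k))" by (simp add: ac_simps)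
        then show ?thesis by (rule range_eqI)
      qed
    qed
    moreover have "finite_index ?Z ?I"
      unfolding finite_index_def
    proof (intro exI[of _ "of_int ` {0..<int q}"] conjI ballI)
      fix r :: 'a assume "r \<in> ?Z"
      then obtain a where a: "r = of_int a" by auto
      have "a = int q * (a div int q) + a mod int q" by simp
      then have "r - of_int (a mod int q) = of_int (int q * (a div int q))"
        unfolding a by (metis add_diff_cancel_right' of_int_diff)
      moreover have "a mod int q \<in> {0..<int q}" using q prime_gt_0_nat by simp
      ultimately show "\<exists>f\<in>of_int ` {0..<int q}. r - f \<in> ?I" by blast
    qed auto
    moreover have "1 \<notin> ?I"
    proof
      assume "1 \<in> ?I"
      then obtain k where "(of_int 1 :: 'a) = of_int (int q * k)" by auto
      then have "int q * k = 1" by (metis inj)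
      then have "int q dvd 1" by (metis dvd_triv_left)
      then show False using q by (metis int_dvd_int_iff not_prime_unit of_nat_1)
    qed
    moreover have "of_nat q \<in> ?I" by (rule range_eqI[of _ _ 1]) simp
    moreover have "unit_mod ?Z ?I s"
    proof -
      have "\<not> int q dvd z" using q(2) z(2) zdvd_imp_le[of "int q" "\<bar>z\<bar>"] by auto
      then have "coprime z (int q)" using q(1) by (metis coprime_commute prime_imp_coprime prime_nat_int_transfer)
      then obtain u v where "u * z + v * int q = 1" by (metis bezout_int coprime_imp_gcd_eq_1)
      then have "z * u - 1 = int q * (- v)" by (simp add: algebra_simps)
      then have "s * of_int u - 1 = of_int (int q * (- v))" unfolding z(1)
        by (metis of_int_1 of_int_diff of_int_mult)
      then show ?thesis using z(1) unfolding unit_mod_def by blast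
    qed
    ultimately show "\<exists>I. is_ideal ?Z I \<and> finite_index ?Z I \<and> 1 \<notin> I \<and>
        (\<exists>q::nat. prime q \<and> of_nat q \<in> I) \<and> unit_mod ?Z I s"
      using q(1) by blast
  qed
qed

section \<open>Polynomials with coefficients in a subring or in an ideal of it\<close>

definition polys_over :: "'a::comm_ring_1 set \<Rightarrow> 'a poly set" where
  "polys_over R = {p. \<forall>i. coeff p i \<in> R}"

lemma polys_over_add: "is_subring R \<Longrightarrow> p \<in> polys_over R \<Longrightarrow> q \<in> polys_over R \<Longrightarrow> p + q \<in> polys_over R"
  by (simp add: polys_over_def is_subringD)

lemma polys_over_uminus: "is_subring R \<Longrightarrow> p \<in> polys_over R \<Longrightarrow> - p \<in> polys_over R"
  by (simp add: polys_over_def is_subringD)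

lemma polys_over_diff: "is_subring R \<Longrightarrow> p \<in> polys_over R \<Longrightarrow> q \<in> polys_over R \<Longrightarrow> p - q \<in> polys_over R"
  by (simp add: polys_over_def is_subringD)

lemma polys_over_mult: "is_subring R \<Longrightarrow> p \<in> polys_over R \<Longrightarrow> q \<in> polys_over R \<Longrightarrow> p * q \<in> polys_over R"
  by (simp add: polys_over_def coeff_mult is_subringD is_subring_sum)

lemma polys_over_monom: "is_subring R \<Longrightarrow> a \<in> R \<Longrightarrow> monom a n \<in> polys_over R"
  by (simp add: polys_over_def is_subringD)

lemma polys_over_const: "is_subring R \<Longrightarrow> a \<in> R \<Longrightarrow> [:a:] \<in> polys_over R"
  by (auto simp: polys_over_def coeff_pCons is_subringD split: nat.splits)

lemma polys_over_smult: "is_subring R \<Longrightarrow> a \<in> R \<Longrightarrow> p \<in> polys_over R \<Longrightarrow> smult a p \<in> polys_over R"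
  by (simp add: polys_over_def is_subringD)

lemma polys_over_ideal_add:
  "is_subring R \<Longrightarrow> is_ideal R I \<Longrightarrow> p \<in> polys_over I \<Longrightarrow> q \<in> polys_over I \<Longrightarrow> p + q \<in> polys_over I"
  by (simp add: polys_over_def is_idealD)

lemma polys_over_ideal_mult:
  "is_subring R \<Longrightarrow> is_ideal R I \<Longrightarrow> p \<in> polys_over R \<Longrightarrow> q \<in> polys_over I \<Longrightarrow> p * q \<in> polys_over I"
  by (simp add: polys_over_def coeff_mult is_idealD is_ideal_sum)

lemma polys_over_ideal_subset: "is_ideal R I \<Longrightarrow> polys_over I \<subseteq> polys_over R"
  by (auto simp: polys_over_def is_ideal_def)

definition adjoin :: "'a::comm_ring_1 set \<Rightarrow> 'a \<Rightarrow> 'a set" where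
  "adjoin R x = (\<lambda>p. poly p x) ` polys_over R"

lemma is_subring_adjoin:
  assumes R: "is_subring R"
  shows "is_subring (adjoin R x)" "R \<subseteq> adjoin R x" "x \<in> adjoin R x"
proof -
  have "poly p x + poly q x \<in> adjoin R x" "poly p x * poly q x \<in> adjoin R x" "- poly p x \<in> adjoin R x"
    if "p \<in> polys_over R" "q \<in> polys_over R" for p q
    using that polys_over_add[OF R that] polys_over_mult[OF R that] polys_over_uminus[OF R that(1)]
    unfolding adjoin_def by (metis imageI poly_add, metis imageI poly_mult, metis imageI poly_minus)
  moreover have sub: "a \<in> adjoin R x" if "a \<in> R" for a
    using polys_over_const[OF R that] unfolding adjoin_def by (intro image_eqI[of _ _ "[:a:]"]) auto
  ultimately show "is_subring (adjoin R x)"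
    unfolding is_subring_def using is_subringD(1,2)[OF R] by (auto simp: adjoin_def)
  show "R \<subseteq> adjoin R x" using sub by blast
  have "poly (monom 1 1) x = x" by (simp add: poly_monom)
  then show "x \<in> adjoin R x" using polys_over_monom[OF R is_subringD(2)[OF R], of 1]
    unfolding adjoin_def by (metis imageI)
qed

text \<open>Division over a ring that need not be a field: each step cancels the leading term at the
  price of a factor \<open>lead_coeff g\<close>.\<close>

lemma pseudo_division_over:
  assumes R: "is_subring (R :: 'a::idom set)" and g: "g \<in> polys_over R" "g \<noteq> 0" and f: "f \<in> polys_over R"
  shows "\<exists>e k r. k \<in> polys_over R \<and> r \<in> polys_over R \<and> smult (lead_coeff g ^ e) f = g * k + r \<and>
    (r = 0 \<or> degree r < degree g)"
  using f
proof (induction "degree f" arbitrary: f rule: less_induct)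
  case less
  show ?case
  proof (cases "f = 0 \<or> degree f < degree g")
    case True
    then show ?thesis using less.prems is_subringD(1)[OF R]
      by (intro exI[of _ 0] exI[of _ f]) (auto simp: polys_over_def)
  next
    case False
    define t where "t = monom (lead_coeff f) (degree f - degree g)"
    define f' where "f' = smult (lead_coeff g) f - t * g"
    have cR: "lead_coeff f \<in> R" "lead_coeff g \<in> R" using less.prems g by (auto simp: polys_over_def)
    have t: "t \<in> polys_over R" unfolding t_def by (rule polys_over_monom[OF R cR(1)])
    have f': "f' \<in> polys_over R" unfolding f'_def
      by (intro polys_over_diff polys_over_smult polys_over_mult R cR less.prems t g)
    have deg: "f' = 0 \<or> degree f' < degree f"
    proof (cases "f' = 0")
      case nz: False
      have fc: "lead_coeff f \<noteq> 0" using False by (metis leading_coeff_0_iff)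
      have "degree t = degree f - degree g" unfolding t_def by (rule degree_monom_eq[OF fc])
      moreover have "t \<noteq> 0" using fc unfolding t_def by (simp only: monom_eq_0_iff not_False_eq_True)
      ultimately have "degree (t * g) = degree f" using False g(2) degree_mult_eq[of t g] by simp
      moreover have "lead_coeff t = lead_coeff f" unfolding t_def by (rule lead_coeff_monom)
      then have "lead_coeff (t * g) = lead_coeff f * lead_coeff g" using lead_coeff_mult[of t g] by simp
      ultimately have "coeff f' (degree f) = 0" by (simp add: f'_def)
      moreover have "degree f' \<le> degree f"
        unfolding f'_def using \<open>degree (t * g) = degree f\<close> by (intro degree_diff_le) auto
      ultimately show ?thesis using nz by (metis leading_coeff_0_iff order_le_imp_less_or_eq)
    qed simp
    have "\<exists>e k r. k \<in> polys_over R \<and> r \<in> polys_over R \<and> smult (lead_coeff g ^ e) f' = g * k + r \<and>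
        (r = 0 \<or> degree r < degree g)"
    proof (cases "f' = 0")
      case True
      then show ?thesis using is_subringD(1)[OF R]
        by (intro exI[of _ 0] exI[of _ 0]) (auto simp: polys_over_def)
    next
      case nz: False
      then show ?thesis using less.hyps[OF _ f'] deg by blast
    qed
    then obtain e k r where ih: "k \<in> polys_over R" "r \<in> polys_over R"
      "smult (lead_coeff g ^ e) f' = g * k + r" "r = 0 \<or> degree r < degree g" by blast
    have "smult (lead_coeff g ^ Suc e) f = smult (lead_coeff g ^ e) f' + smult (lead_coeff g ^ e) (t * g)"
      by (simp add: f'_def smult_diff_right mult.commute)
    also have "\<dots> = g * (k + smult (lead_coeff g ^ e) t) + r"
      by (simp add: ih(3) distrib_left ac_simps)
    finally show ?thesis using ih
      by (intro exI[of _ "Suc e"] exI[of _ "k + smult (lead_coeff g ^ e) t"] exI[of _ r])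
        (auto intro!: polys_over_add polys_over_smult R t is_subringD(7)[OF R] cR)
  qed
qed

text \<open>Modulo \<open>I\<close> the leading coefficient of \<open>g\<close> is invertible, so a
  nonzero multiple of \<open>g\<close> has at least the degree of \<open>g\<close> and cannot be
  constant. The index \<open>j\<close> marks the top coefficient of \<open>k\<close> outside
  \<open>I\<close>.\<close>

lemma monic_mod_mult_in_ideal:
  assumes R: "is_subring R" "is_ideal R I" and g: "g \<in> polys_over R" "unit_mod R I (lead_coeff g)" "degree g > 0"
    and k: "k \<in> polys_over R" and c: "g * k - [:c:] \<in> polys_over I"
  shows "k \<in> polys_over I"
proof (rule ccontr)
  assume "k \<notin> polys_over I"
  then obtain i where i: "coeff k i \<notin> I" by (auto simp: polys_over_def)
  let ?S = "{i. coeff k i \<notin> I}"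
  have "?S \<subseteq> {..degree k}" using is_idealD(2)[OF R] by (auto intro: ccontr simp: coeff_eq_0)
  then have fin: "finite ?S" by (rule finite_subset) simp
  define j where "j = Max ?S"
  have j: "coeff k j \<notin> I" using Max_in[OF fin] i by (auto simp: j_def)
  have above: "coeff k i \<in> I" if "i > j" for i
    using Max_ge[OF fin, of i] that by (auto simp: j_def)
  let ?d = "degree g"
  have gR: "coeff g i \<in> R" and kR: "coeff k i \<in> R" for i using g(1) k by (auto simp: polys_over_def)
  have "coeff (g * k) (?d + j) = (\<Sum>i\<le>?d + j. coeff g i * coeff k (?d + j - i))" by (rule coeff_mult)
  also have "\<dots> = coeff g ?d * coeff k j + (\<Sum>i\<in>{..?d + j} - {?d}. coeff g i * coeff k (?d + j - i))"
    by (subst sum.remove[of _ ?d]) auto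
  finally have "coeff g ?d * coeff k j = coeff (g * k) (?d + j) - (\<Sum>i\<in>{..?d + j} - {?d}. coeff g i * coeff k (?d + j - i))"
    by simp
  moreover have "(\<Sum>i\<in>{..?d + j} - {?d}. coeff g i * coeff k (?d + j - i)) \<in> I"
  proof (rule is_ideal_sum[OF R])
    fix i assume i: "i \<in> {..?d + j} - {?d}"
    show "coeff g i * coeff k (?d + j - i) \<in> I"
    proof (cases "i < ?d")
      case True
      then show ?thesis using above[of "?d + j - i"] gR by (simp add: is_idealD[OF R])
    next
      case False
      then show ?thesis using i is_idealD(2)[OF R] by (simp add: coeff_eq_0)
    qed
  qed
  moreover have "coeff (g * k) (?d + j) \<in> I"
  proof -
    have "coeff (g * k - [:c:]) (?d + j) \<in> I" using c by (auto simp: polys_over_def)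
    moreover have "coeff [:c:] (?d + j) = 0" using g(3) by (simp add: coeff_pCons split: nat.splits)
    ultimately show ?thesis by simp
  qed
  ultimately have "coeff g ?d * coeff k j \<in> I" by (simp add: is_idealD(7)[OF R])
  then show False using unit_mod_cancel[OF R g(2) _ kR] j by blast
qed

lemma reduce_mod_monic:
  assumes R: "is_subring R" "is_ideal R I" and g: "g \<in> polys_over R" "unit_mod R I (lead_coeff g)" "degree g > 0"
    and f: "f \<in> polys_over R"
  shows "\<exists>k\<in>polys_over R. \<exists>i\<in>polys_over I. \<exists>r\<in>polys_over R. f = g * k + i + r \<and> degree r < degree g"
  using f
proof (induction "degree f" arbitrary: f rule: less_induct)
  case less
  have zero: "0 \<in> polys_over R" "0 \<in> polys_over I"
    using is_subringD(1)[OF R(1)] is_idealD(2)[OF R] by (auto simp: polys_over_def)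
  show ?case
  proof (cases "degree f < degree g")
    case True
    then show ?thesis using less.prems zero by force
  next
    case False
    obtain u where u: "u \<in> R" "lead_coeff g * u - 1 \<in> I" using g(2) by (auto simp: unit_mod_def)
    let ?c = "lead_coeff f" and ?m = "degree f - degree g"
    have cR: "?c \<in> R" using less.prems by (auto simp: polys_over_def)
    define t where "t = monom (?c * u) ?m"
    \<comment> \<open>\<open>u\<close> inverts the leading coefficient only modulo \<open>I\<close>.
      This term restores the exact cancellation in top degree and is absorbed by
      \<open>i\<close>.\<close>
    define e where "e = monom (?c * (lead_coeff g * u - 1)) (degree f)"
    have t: "t \<in> polys_over R" unfolding t_def using cR u(1) R(1) by (simp add: polys_over_monom is_subringD)
    have e: "e \<in> polys_over I" unfolding e_def using is_idealD(4)[OF R cR u(2)] is_idealD(2)[OF R]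
      by (auto simp: polys_over_def)
    define f' where "f' = f - g * t + e"
    have f': "f' \<in> polys_over R" unfolding f'_def
      using e polys_over_ideal_subset[OF R(2)] by (intro polys_over_add polys_over_diff polys_over_mult R t g less.prems) auto
    have deg: "degree (g * t) \<le> degree f"
      using degree_mult_le[of g t] False degree_monom_le[of "?c * u" ?m] unfolding t_def by linarith
    have "coeff (t * g) (degree f) = ?c * u * lead_coeff g"
      using False unfolding t_def coeff_monom_mult by simp
    then have coeff_gt: "coeff (g * t) (degree f) = lead_coeff g * (?c * u)"
      by (simp only: mult.commute)
    have "degree f' \<le> degree f"
      unfolding f'_def using deg degree_monom_le by (intro degree_add_le degree_diff_le) (auto simp: e_def)
    moreover have "coeff f' (degree f) = 0"
      unfolding f'_def using coeff_gt by (simp add: e_def algebra_simps)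
    moreover have "degree f > 0" using False g(3) by simp
    ultimately have "degree f' < degree f"
      by (metis degree_0 leading_coeff_0_iff order_le_imp_less_or_eq)
    then obtain k i r where ih: "k \<in> polys_over R" "i \<in> polys_over I" "r \<in> polys_over R"
      "f' = g * k + i + r" "degree r < degree g"
      using less.hyps f' by blast
    have "f = g * (k + t) + (i - e) + r"
      using ih(4) by (simp add: f'_def algebra_simps)
    moreover have "i - e \<in> polys_over I" using ih(2) e by (auto simp: polys_over_def is_idealD(7)[OF R])
    ultimately show ?thesis using ih polys_over_add[OF R(1) ih(1) t] by blast
  qed
qed

lemma finite_bounded_polys:
  fixes F :: "'a::comm_ring_1 set"
  assumes "finite F"
  shows "finite {p. degree p < d \<and> (\<forall>i. coeff p i \<in> F)}"
proof -
  have "p = (\<Sum>i<d. monom (coeff p i) i)" if "degree p < d" for p :: "'a poly"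
    using that by (intro poly_eqI) (auto simp: coeff_sum coeff_eq_0)
  then have "{p. degree p < d \<and> (\<forall>i. coeff p i \<in> F)} \<subseteq> (\<lambda>c. \<Sum>i<d. monom (c i) i) ` ({..<d} \<rightarrow>\<^sub>E F)"
    by (intro subsetI image_eqI[of _ _ "restrict (coeff _) {..<d}"]) (auto intro!: sum.cong)
  then show ?thesis
    by (rule finite_subset) (intro finite_imageI finite_PiE assms, simp)
qed

text \<open>\<open>J\<close> is the image under evaluation at \<open>x\<close> of the ideal
  generated by \<open>g\<close> and \<open>I\<close>. Division by \<open>g\<close> modulo
  \<open>I\<close> makes its index finite. The hypothesis \<open>ker\<close> says that the kernel of
  the evaluation consists of multiples of \<open>g\<close> up to units modulo \<open>I\<close>,
  which keeps \<open>J\<close> proper.\<close>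

lemma adjoin_quotient:
  fixes R :: "'a::idom set"
  assumes R: "is_subring R" "is_ideal R I" and fin: "finite_index R I" and one: "1 \<notin> I"
    and g: "g \<in> polys_over R" "unit_mod R I (lead_coeff g)" "degree g > 0"
    and ker: "\<And>h. h \<in> polys_over R \<Longrightarrow> poly h x = 0 \<Longrightarrow> \<exists>c k. unit_mod R I c \<and> k \<in> polys_over R \<and> smult c h = g * k"
  obtains J where "is_ideal (adjoin R x) J" "finite_index (adjoin R x) J" "1 \<notin> J" "I \<subseteq> J" "poly g x \<in> J"
proof -
  define J where "J = {poly (g * k + i) x |k i. k \<in> polys_over R \<and> i \<in> polys_over I}"
  note PI = subsetD[OF polys_over_ideal_subset[OF R(2)]]
  have zero: "0 \<in> polys_over R" "0 \<in> polys_over I"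
    using is_subringD(1)[OF R(1)] is_idealD(2)[OF R] by (auto simp: polys_over_def)
  have inJ: "poly (g * k + i) x \<in> J" if "k \<in> polys_over R" "i \<in> polys_over I" for k i
    using that by (auto simp: J_def)
  have ideal: "is_ideal (adjoin R x) J"
    unfolding is_ideal_def
  proof (intro conjI ballI)
    show "J \<subseteq> adjoin R x"
    proof
      fix a assume "a \<in> J"
      then obtain k i where a: "a = poly (g * k + i) x" "k \<in> polys_over R" "i \<in> polys_over I" by (auto simp: J_def)
      then have "g * k + i \<in> polys_over R" using PI g(1) by (intro polys_over_add polys_over_mult R) auto
      then show "a \<in> adjoin R x" unfolding a(1) adjoin_def by (rule imageI)
    qed
    show "0 \<in> J" using inJ[OF zero] by simp
    fix a assume "a \<in> J"
    then obtain k i where a: "a = poly (g * k + i) x" "k \<in> polys_over R" "i \<in> polys_over I" by (auto simp: J_def)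
    show "a + b \<in> J" if b: "b \<in> J" for b
    proof -
      obtain l j where b': "b = poly (g * l + j) x" "l \<in> polys_over R" "j \<in> polys_over I" using b by (auto simp: J_def)
      have "a + b = poly (g * (k + l) + (i + j)) x" by (simp add: a b' algebra_simps)
      then show ?thesis using inJ[OF polys_over_add[OF R(1) a(2) b'(2)] polys_over_ideal_add[OF R a(3) b'(3)]] by simp
    qed
    show "r * a \<in> J" if r: "r \<in> adjoin R x" for r
    proof -
      obtain p where p: "r = poly p x" "p \<in> polys_over R" using r by (auto simp: adjoin_def)
      have "r * a = poly (g * (p * k) + p * i) x" by (simp add: a p algebra_simps)
      then show ?thesis using inJ[OF polys_over_mult[OF R(1) p(2) a(2)] polys_over_ideal_mult[OF R p(2) a(3)]] by simp
    qed
  qed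
  obtain F where F: "finite F" "F \<subseteq> R" "\<And>r. r \<in> R \<Longrightarrow> \<exists>f\<in>F. r - f \<in> I" using fin by (auto simp: finite_index_def)
  then obtain \<phi> where \<phi>: "\<And>r. r \<in> R \<Longrightarrow> \<phi> r \<in> F" "\<And>r. r \<in> R \<Longrightarrow> r - \<phi> r \<in> I" by metis
  \<comment> \<open>Coefficients are representatives from \<open>F\<close>; the value 0 serves the
    positions from \<open>degree g\<close> on.\<close>
  let ?P = "{p. degree p < degree g \<and> (\<forall>i. coeff p i \<in> insert 0 F)}"
  have "finite_index (adjoin R x) J"
    unfolding finite_index_def
  proof (intro exI conjI ballI)
    show "finite ((\<lambda>p. poly p x) ` ?P)" using finite_bounded_polys[of "insert 0 F" "degree g"] F(1) by simp
    have "insert 0 F \<subseteq> R" using F(2) is_subringD(1)[OF R(1)] by simp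
    then have "?P \<subseteq> polys_over R" unfolding polys_over_def by blast
    then show "(\<lambda>p. poly p x) ` ?P \<subseteq> adjoin R x" by (auto simp: adjoin_def)
    fix a assume "a \<in> adjoin R x"
    then obtain p where p: "p \<in> polys_over R" "a = poly p x" by (auto simp: adjoin_def)
    obtain k i r where kir: "k \<in> polys_over R" "i \<in> polys_over I" "r \<in> polys_over R"
      "p = g * k + i + r" "degree r < degree g" using reduce_mod_monic[OF R g p(1)] by blast
    define r' where "r' = (\<Sum>j<degree g. monom (\<phi> (coeff r j)) j)"
    have coeff_r': "coeff r' j = (if j < degree g then \<phi> (coeff r j) else 0)" for j
      by (simp add: r'_def coeff_sum)
    have rR: "coeff r j \<in> R" for j using kir(3) by (auto simp: polys_over_def)
    have "r' \<in> ?P"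
    proof (intro CollectI conjI allI)
      have "degree r' \<le> degree g - 1" using coeff_r' by (intro degree_le) auto
      then show "degree r' < degree g" using g(3) by simp
      show "coeff r' j \<in> insert 0 F" for j using coeff_r' \<phi>(1)[OF rR] by simp
    qed
    moreover have "r - r' \<in> polys_over I"
    proof -
      have "coeff r j - coeff r' j \<in> I" for j
        using coeff_r' \<phi>(2)[OF rR] is_idealD(2)[OF R] kir(5) by (auto simp: coeff_eq_0)
      then show ?thesis by (simp add: polys_over_def)
    qed
    then have "i + (r - r') \<in> polys_over I" using kir(2) polys_over_ideal_add[OF R] by blast
    then have "poly (g * k + (i + (r - r'))) x \<in> J" by (rule inJ[OF kir(1)])
    then have "a - poly r' x \<in> J" by (simp add: p(2) kir(4) algebra_simps)
    ultimately show "\<exists>f\<in>(\<lambda>p. poly p x) ` ?P. a - f \<in> J" by blast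
  qed
  \<comment> \<open>If \<open>1 \<in> J\<close>, then \<open>?h\<close> below is in the kernel of
    the evaluation, so \<open>ker\<close> makes a unit \<open>c\<close> congruent to a multiple of
    \<open>g\<close> modulo \<open>I\<close>. Since \<open>g\<close> has positive degree, the
    multiplier vanishes modulo \<open>I\<close>, and so does \<open>c\<close>.\<close>
  moreover have "1 \<notin> J"
  proof
    assume "1 \<in> J"
    then obtain k i where ki: "1 = poly (g * k + i) x" "k \<in> polys_over R" "i \<in> polys_over I" by (auto simp: J_def)
    let ?h = "1 - (g * k + i)"
    have hR: "?h \<in> polys_over R"
      using PI[OF ki(3)] polys_over_const[OF R(1) is_subringD(2)[OF R(1)]]
      by (intro polys_over_diff polys_over_add polys_over_mult R g ki) (auto simp: one_pCons)
    then obtain c l where c: "unit_mod R I c" "l \<in> polys_over R" "smult c ?h = g * l"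
      using ker[of ?h] ki(1) by auto
    have cR: "c \<in> R" using c(1) by (simp add: unit_mod_def)
    have eq: "g * (l + smult c k) - [:c:] = - smult c i"
    proof -
      have "smult c ?h = [:c:] - g * smult c k - smult c i"
        by (simp add: smult_diff_right smult_add_right)
      then show ?thesis using c(3) by (simp add: algebra_simps)
    qed
    have ci: "- smult c i \<in> polys_over I" using ki(3) cR by (auto simp: polys_over_def is_idealD[OF R])
    have "l + smult c k \<in> polys_over I"
      by (rule monic_mod_mult_in_ideal[OF R g _ ci[folded eq]])
        (intro polys_over_add polys_over_smult R c ki cR)
    then have "g * (l + smult c k) \<in> polys_over I" using polys_over_ideal_mult[OF R g(1)] by blast
    moreover have "[:c:] = g * (l + smult c k) + smult c i" using eq by (simp add: algebra_simps)
    moreover have "smult c i \<in> polys_over I" using ki(3) cR by (auto simp: polys_over_def is_idealD[OF R])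
    ultimately have "[:c:] \<in> polys_over I" using polys_over_ideal_add[OF R] by simp
    then have "coeff [:c:] 0 \<in> I" unfolding polys_over_def by blast
    then have "c * 1 \<in> I" by simp
    then show False using unit_mod_cancel[OF R c(1) _ is_subringD(2)[OF R(1)]] one by blast
  qed
  moreover have "I \<subseteq> J"
  proof
    fix a assume a: "a \<in> I"
    then have "[:a:] \<in> polys_over I" using is_idealD(2)[OF R] by (auto simp: polys_over_def coeff_pCons split: nat.splits)
    then show "a \<in> J" using inJ[OF zero(1)] by fastforce
  qed
  moreover have "poly g x \<in> J"
    using inJ[of 1 0] zero(2) polys_over_const[OF R(1) is_subringD(2)[OF R(1)]] by (simp add: one_pCons)
  ultimately show thesis using that ideal by blast
qed

text \<open>Let \<open>s = f(x) \<noteq> 0\<close>. If \<open>x\<close> is transcendental over \<open>R\<close>, then \<open>s\<close> becomes a unit modulo \<open>x f(x) + 1\<close>;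
  if \<open>x\<close> is algebraic, then \<open>s\<close> divides a nonzero element of \<open>R\<close>.\<close>

lemma separating_ideals_adjoin:
  fixes R :: "'a::idom set"
  assumes "separating_ideals R"
  shows "separating_ideals (adjoin R x)"
proof -
  have R: "is_subring R" using assms by (simp add: separating_ideals_def)
  note A = is_subring_adjoin[OF R, of x]
  show ?thesis
    unfolding separating_ideals_def
  proof (intro conjI A(1) ballI impI)
    fix s assume "s \<in> adjoin R x" "s \<noteq> 0"
    then obtain f where f: "f \<in> polys_over R" "s = poly f x" unfolding adjoin_def by blast
    with \<open>s \<noteq> 0\<close> have f0: "f \<noteq> 0" by auto
    let ?goal = "\<exists>I. is_ideal (adjoin R x) I \<and> finite_index (adjoin R x) I \<and> 1 \<notin> I \<and>
      (\<exists>q::nat. prime q \<and> of_nat q \<in> I) \<and> unit_mod (adjoin R x) I s"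
    show ?goal
    proof (cases "\<exists>p. p \<in> polys_over R \<and> p \<noteq> 0 \<and> poly p x = 0")
      case False
      \<comment> \<open>This is the polynomial \<open>X * f + 1\<close>: modulo its value at
        \<open>x\<close>, the element \<open>- x\<close> is inverse to \<open>s\<close>.\<close>
      let ?g = "pCons 1 f"
      have lead: "lead_coeff ?g = lead_coeff f" using f0 by simp
      have "lead_coeff f \<in> R" "lead_coeff f \<noteq> 0" using f f0 by (auto simp: polys_over_def)
      then obtain I q where I: "is_ideal R I" "finite_index R I" "1 \<notin> I" "prime (q::nat)" "of_nat q \<in> I"
        "unit_mod R I (lead_coeff f)" using assms unfolding separating_ideals_def by blast
      have "?g \<in> polys_over R" using f(1) is_subringD(2)[OF R] by (auto simp: polys_over_def coeff_pCons split: nat.splits)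
      moreover have "\<exists>c k. unit_mod R I c \<and> k \<in> polys_over R \<and> smult c h = ?g * k"
        if "h \<in> polys_over R" "poly h x = 0" for h
      proof -
        have "h = 0" using False that by blast
        moreover have "unit_mod R I 1" using is_subringD(2)[OF R] is_idealD(2)[OF R I(1)]
          by (auto simp: unit_mod_def intro!: bexI[of _ 1])
        ultimately show ?thesis using is_subringD(1)[OF R]
          by (intro exI[of _ 1] exI[of _ 0]) (auto simp: polys_over_def)
      qed
      ultimately obtain J where J: "is_ideal (adjoin R x) J" "finite_index (adjoin R x) J" "1 \<notin> J" "I \<subseteq> J" "poly ?g x \<in> J"
        using adjoin_quotient[OF R I(1-3), of ?g x] I(6) f0 lead by auto
      have "- x \<in> adjoin R x" using A(1,3) is_subringD(5) by blast
      moreover have "s * (- x) - 1 = - poly ?g x" by (simp add: f(2) algebra_simps)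
      then have "s * (- x) - 1 \<in> J" using is_idealD(6)[OF A(1) J(1) J(5)] by (simp only:)
      ultimately have "unit_mod (adjoin R x) J s"
        using \<open>s \<in> adjoin R x\<close> unfolding unit_mod_def by blast
      then show ?goal using J I(4,5) by blast
    next
      case True
      define alg where "alg p \<longleftrightarrow> p \<in> polys_over R \<and> p \<noteq> 0 \<and> poly p x = 0" for p
      obtain g where g: "alg g" and g_min: "\<And>p. alg p \<Longrightarrow> degree g \<le> degree p"
        using arg_min_nat_lemma[of alg _ degree] True by (metis alg_def)
      have gR: "g \<in> polys_over R" "g \<noteq> 0" "poly g x = 0" using g by (auto simp: alg_def)
      have gdeg: "degree g > 0"
      proof (rule ccontr)
        assume "\<not> ?thesis"
        then obtain c where "g = [:c:]" using degree_eq_zeroE by blast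
        then show False using gR by simp
      qed
      \<comment> \<open>Polynomials over \<open>R\<close> whose value at \<open>x\<close> is a
        nonzero multiple of \<open>s\<close>. One of least degree turns out to be constant, which
        gives a nonzero multiple of \<open>s\<close> in \<open>R\<close>.\<close>
      define mult where "mult h \<longleftrightarrow> h \<in> polys_over R \<and> poly h x \<noteq> 0 \<and> (\<exists>t\<in>adjoin R x. poly h x = s * t)" for h
      have "mult f" using f \<open>s \<noteq> 0\<close> is_subringD(2)[OF A(1)] by (auto simp: mult_def intro!: bexI[of _ 1])
      then obtain h where h: "mult h" and h_min: "\<And>p. mult p \<Longrightarrow> degree h \<le> degree p"
        using arg_min_nat_lemma[of mult f degree] by metis
      have hR: "h \<in> polys_over R" "poly h x \<noteq> 0" using h by (auto simp: mult_def)
      obtain t where t: "t \<in> adjoin R x" "poly h x = s * t" using h by (auto simp: mult_def)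
      have h0: "h \<noteq> 0" using hR by auto
      \<comment> \<open>As \<open>g\<close> vanishes at \<open>x\<close>, the remainder of
        \<open>h\<close> modulo \<open>g\<close> has the value of \<open>h\<close> up to a nonzero
        factor from \<open>R\<close>, so it competes with \<open>h\<close> for least degree.\<close>
      have hdeg: "degree h < degree g"
      proof -
        obtain e k r where ekr: "k \<in> polys_over R" "r \<in> polys_over R" "smult (lead_coeff g ^ e) h = g * k + r"
          "r = 0 \<or> degree r < degree g" using pseudo_division_over[OF R gR(1,2) hR(1)] by blast
        have "poly (smult (lead_coeff g ^ e) h) x = poly (g * k + r) x" using ekr(3) by simp
        then have eq: "lead_coeff g ^ e * poly h x = poly r x" using gR(3) by simp
        then have "poly r x \<noteq> 0" using hR(2) gR(2) by auto
        moreover have "poly r x = s * (lead_coeff g ^ e * t)" using eq t(2) by (simp add: ac_simps)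
        moreover have "lead_coeff g \<in> R" using gR(1) by (auto simp: polys_over_def)
        then have "lead_coeff g ^ e * t \<in> adjoin R x"
          using A t(1) by (meson is_subringD(4,7) subsetD)
        ultimately have "mult r" using ekr(2) by (auto simp: mult_def)
        then have "degree h \<le> degree r" by (rule h_min)
        moreover have "r \<noteq> 0" using \<open>poly r x \<noteq> 0\<close> by auto
        ultimately show ?thesis using ekr(4) by simp
      qed
      \<comment> \<open>Divide \<open>g\<close> by \<open>h\<close>. The value of the remainder is a
        multiple of \<open>s\<close>, hence 0 by minimality of \<open>h\<close>; then the quotient
        vanishes at \<open>x\<close> and has smaller degree than \<open>g\<close>.\<close>
      have "degree h = 0"
      proof (rule ccontr)
        assume hpos: "degree h \<noteq> 0"
        obtain e k r where ekr: "k \<in> polys_over R" "r \<in> polys_over R" "smult (lead_coeff h ^ e) g = h * k + r"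
          "r = 0 \<or> degree r < degree h" using pseudo_division_over[OF R hR(1) h0 gR(1)] by blast
        have "poly (smult (lead_coeff h ^ e) g) x = poly (h * k + r) x" using ekr(3) by simp
        then have eq: "poly r x = - (poly h x * poly k x)" using gR(3) by (simp add: eq_neg_iff_add_eq_0 add.commute)
        have "poly r x = 0"
        proof (rule ccontr)
          assume nz: "poly r x \<noteq> 0"
          have "poly k x \<in> adjoin R x" using ekr(1) by (auto simp: adjoin_def)
          then have "- (t * poly k x) \<in> adjoin R x" using t(1) A(1) by (meson is_subringD(4,5))
          moreover have "poly r x = s * - (t * poly k x)" using eq t(2) by simp
          ultimately have "mult r" using nz ekr(2) unfolding mult_def by blast
          then have "degree h \<le> degree r" by (rule h_min)
          moreover have "r \<noteq> 0" using nz by auto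
          ultimately show False using ekr(4) by simp
        qed
        then have "poly k x = 0" using eq hR(2) by simp
        have "k \<noteq> 0"
        proof
          assume "k = 0"
          then have "degree r = degree g" using ekr(3) h0 by (metis add.left_neutral degree_smult_eq leading_coeff_0_iff mult_zero_right power_not_zero)
          moreover have "r \<noteq> 0" using \<open>k = 0\<close> ekr(3) h0 gR(2) by auto
          ultimately show False using ekr(4) hdeg by simp
        qed
        then have "degree g \<le> degree k" using \<open>poly k x = 0\<close> ekr(1) by (intro g_min) (auto simp: alg_def)
        moreover have "degree (h * k) = degree h + degree k" using h0 \<open>k \<noteq> 0\<close> by (simp add: degree_mult_eq)
        moreover have "degree (h * k) \<le> degree g"
        proof -
          have "h * k = smult (lead_coeff h ^ e) g - r" using ekr(3) by simp
          then show ?thesis using ekr(4) hdeg by (auto intro!: degree_diff_le)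
        qed
        ultimately show False using hpos by simp
      qed
      then obtain s' where s': "h = [:s':]" using degree_eq_zeroE by blast
      have s'R: "s' \<in> R" "s' \<noteq> 0" "s' = s * t" using hR t(2) s' by (auto simp: polys_over_def)
        (metis coeff_pCons_0)
      have lcR: "lead_coeff g \<in> R" "lead_coeff g \<noteq> 0" using gR by (auto simp: polys_over_def)
      \<comment> \<open>Invertibility of this product makes \<open>g\<close> monic up to a unit
        modulo \<open>I\<close>, and makes \<open>s'\<close>, hence its divisor \<open>s\<close>, a
        unit.\<close>
      have "lead_coeff g * s' \<in> R" "lead_coeff g * s' \<noteq> 0" using s'R lcR is_subringD(4)[OF R] by auto
      then obtain I q where I: "is_ideal R I" "finite_index R I" "1 \<notin> I" "prime (q::nat)" "of_nat q \<in> I"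
        "unit_mod R I (lead_coeff g * s')" using assms unfolding separating_ideals_def by blast
      then have units: "unit_mod R I (lead_coeff g)" "unit_mod R I s'"
        using unit_mod_mult[OF R I(1) lcR(1) s'R(1)] by auto
      have lpow: "unit_mod R I (lead_coeff g ^ e)" for e
      proof (induction e)
        case 0
        show ?case using is_subringD(2)[OF R] is_idealD(2)[OF R I(1)] by (auto simp: unit_mod_def intro!: bexI[of _ 1])
      next
        case (Suc e)
        then show ?case using unit_mod_mult[OF R I(1) lcR(1) is_subringD(7)[OF R lcR(1)]] units by simp
      qed
      have ker: "\<exists>c k. unit_mod R I c \<and> k \<in> polys_over R \<and> smult c p = g * k"
        if p: "p \<in> polys_over R" "poly p x = 0" for p
      proof -
        obtain e k r where ekr: "k \<in> polys_over R" "r \<in> polys_over R" "smult (lead_coeff g ^ e) p = g * k + r"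
          "r = 0 \<or> degree r < degree g" using pseudo_division_over[OF R gR(1,2) p(1)] by blast
        have "poly (smult (lead_coeff g ^ e) p) x = poly (g * k + r) x" using ekr(3) by simp
        then have "poly r x = 0" using gR(3) p(2) by simp
        then have "r = 0" using ekr(2,4) g_min[of r] by (cases "r = 0") (auto simp: alg_def)
        then show ?thesis using ekr lpow by auto
      qed
      obtain J where J: "is_ideal (adjoin R x) J" "finite_index (adjoin R x) J" "1 \<notin> J" "I \<subseteq> J"
        using adjoin_quotient[OF R I(1-3) gR(1) units(1) gdeg ker] by blast
      have "unit_mod (adjoin R x) J s'" using units(2) J(4) A(2) by (auto simp: unit_mod_def)
      then have "unit_mod (adjoin R x) J s"
        using unit_mod_mult[OF A(1) J(1) \<open>s \<in> adjoin R x\<close> t(1)] s'R(3) by simp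
      then show ?goal using J I(4,5) by blast
    qed
  qed
qed

lemma separating_ideals_finite_set:
  assumes "CHAR('a::idom) = 0" "finite (X :: 'a set)"
  obtains R where "separating_ideals R" "X \<subseteq> R"
proof -
  have "\<exists>R. separating_ideals R \<and> X \<subseteq> R"
    using assms(2)
  proof (induction X rule: finite_induct)
    case empty
    then show ?case using separating_ideals_Ints[OF assms(1)] by blast
  next
    case (insert x X)
    then obtain R where R: "separating_ideals R" "X \<subseteq> R" by blast
    then have "is_subring R" by (simp add: separating_ideals_def)
    then show ?case using separating_ideals_adjoin[OF R(1), of x] is_subring_adjoin[of R x] R(2) by blast
  qed
  then show thesis using that by blast
qed

section \<open>Polynomials in a matrix\<close>

definition mat_poly :: "nat \<Rightarrow> 'a::comm_ring_1 poly \<Rightarrow> 'a mat \<Rightarrow> 'a mat" where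
  "mat_poly n p A = fold_coeffs (\<lambda>a B. a \<cdot>\<^sub>m 1\<^sub>m n + A * B) p (0\<^sub>m n n)"

lemma smult_one_mat_add:
  fixes X Y :: "'a::comm_ring_1 mat"
  assumes "X \<in> carrier_mat n n" "Y \<in> carrier_mat n n"
  shows "(a + b) \<cdot>\<^sub>m 1\<^sub>m n + (X + Y) = (a \<cdot>\<^sub>m 1\<^sub>m n + X) + (b \<cdot>\<^sub>m 1\<^sub>m n + Y)"
  using assms by (intro eq_matI) (auto simp: algebra_simps)

lemma smult_one_mat_smult:
  fixes X :: "'a::comm_ring_1 mat"
  assumes "X \<in> carrier_mat n n"
  shows "(c * a) \<cdot>\<^sub>m 1\<^sub>m n + c \<cdot>\<^sub>m X = c \<cdot>\<^sub>m (a \<cdot>\<^sub>m 1\<^sub>m n + X)"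
  using assms by (intro eq_matI) (auto simp: algebra_simps)

lemma zero_smult_one_mat_add:
  fixes X :: "'a::comm_ring_1 mat"
  assumes "X \<in> carrier_mat n n"
  shows "0 \<cdot>\<^sub>m 1\<^sub>m n + X = X"
  using assms by (intro eq_matI) auto

lemma smult_one_mat_mult_vec:
  fixes v :: "'a::comm_ring_1 Matrix.vec"
  assumes v: "v \<in> carrier_vec n"
  shows "(c \<cdot>\<^sub>m 1\<^sub>m n) *\<^sub>v v = c \<cdot>\<^sub>v v"
  using v by (intro eq_vecI) (auto simp: smult_scalar_prod_distrib[OF unit_vec_carrier v])

context
  fixes n :: nat and A :: "'a::comm_ring_1 mat"
  assumes A: "A \<in> carrier_mat n n"
begin

lemma mat_poly_0: "mat_poly n 0 A = 0\<^sub>m n n"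
  by (simp add: mat_poly_def)

lemma mat_poly_pCons: "mat_poly n (pCons a p) A = a \<cdot>\<^sub>m 1\<^sub>m n + A * mat_poly n p A"
proof (cases "a = 0 \<and> p = 0")
  case True
  then show ?thesis using A by (simp add: mat_poly_0) (intro eq_matI, auto)
next
  case False
  then show ?thesis by (auto simp: mat_poly_def)
qed

lemma mat_poly_carrier: "mat_poly n p A \<in> carrier_mat n n"
  using A by (induction p) (auto simp: mat_poly_0 mat_poly_pCons)

lemma mat_poly_dim [simp]: "dim_row (mat_poly n p A) = n" "dim_col (mat_poly n p A) = n"
  using mat_poly_carrier[of p] by auto

lemma mat_poly_add: "mat_poly n (p + q) A = mat_poly n p A + mat_poly n q A"
proof (induction p arbitrary: q)
  case 0
  then show ?case using mat_poly_carrier by (simp add: mat_poly_0)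
next
  case (pCons a p)
  obtain b r where q: "q = pCons b r" by (cases q)
  note c = mat_poly_carrier[of p] mat_poly_carrier[of r]
  have "A * (mat_poly n p A + mat_poly n r A) = A * mat_poly n p A + A * mat_poly n r A"
    by (rule mult_add_distrib_mat[OF A c])
  then show ?case unfolding q add_pCons mat_poly_pCons pCons.IH
    using smult_one_mat_add[of "A * mat_poly n p A" n "A * mat_poly n r A" a b] A c by simp
qed

lemma mat_poly_smult: "mat_poly n (smult c p) A = c \<cdot>\<^sub>m mat_poly n p A"
proof (induction p)
  case (pCons a p)
  note c = mat_poly_carrier[of p]
  show ?case unfolding smult_pCons mat_poly_pCons pCons.IH mult_smult_distrib[OF A c]
    using A c by (intro smult_one_mat_smult) auto
qed (simp add: mat_poly_0)

lemma mat_poly_mult: "mat_poly n (p * q) A = mat_poly n p A * mat_poly n q A"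
proof (induction p)
  case 0
  show ?case using left_mult_zero_mat[OF mat_poly_carrier[of q], of n] by (simp add: mat_poly_0)
next
  case (pCons a p)
  note c = mat_poly_carrier[of p] mat_poly_carrier[of q]
  have "mat_poly n (pCons a p * q) A = a \<cdot>\<^sub>m mat_poly n q A + (0 \<cdot>\<^sub>m 1\<^sub>m n + A * (mat_poly n p A * mat_poly n q A))"
    by (simp add: mat_poly_add mat_poly_smult mat_poly_pCons pCons.IH)
  also have "\<dots> = a \<cdot>\<^sub>m mat_poly n q A + A * (mat_poly n p A * mat_poly n q A)"
    using A c by (subst zero_smult_one_mat_add) auto
  also have "a \<cdot>\<^sub>m mat_poly n q A = (a \<cdot>\<^sub>m 1\<^sub>m n) * mat_poly n q A"
    using mult_smult_assoc_mat[OF one_carrier_mat c(2), of a] c by simp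
  also have "A * (mat_poly n p A * mat_poly n q A) = (A * mat_poly n p A) * mat_poly n q A"
    by (rule assoc_mult_mat[OF A c, symmetric])
  also have "(a \<cdot>\<^sub>m 1\<^sub>m n) * mat_poly n q A + (A * mat_poly n p A) * mat_poly n q A
      = (a \<cdot>\<^sub>m 1\<^sub>m n + A * mat_poly n p A) * mat_poly n q A"
    using A c by (intro add_mult_distrib_mat[symmetric, of _ n n]) auto
  finally show ?case by (simp add: mat_poly_pCons)
qed

lemma mat_poly_const: "mat_poly n [:c:] A = c \<cdot>\<^sub>m 1\<^sub>m n"
  using A by (simp add: mat_poly_pCons mat_poly_0)

lemma mat_poly_1: "mat_poly n 1 A = 1\<^sub>m n"
  by (simp add: one_pCons mat_poly_const) (intro eq_matI, auto)

lemma mat_poly_monom: "mat_poly n (monom c i) A = c \<cdot>\<^sub>m (A ^\<^sub>m i)"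
proof (induction i)
  case 0
  then show ?case using A by (simp add: monom_0 mat_poly_const)
next
  case (Suc i)
  have "A * (A ^\<^sub>m i) = A ^\<^sub>m i * A"
  proof (induction i)
    case (Suc i)
    then show ?case using A assoc_mult_mat[OF A pow_carrier_mat[OF A] A, of i] by simp
  qed (use A in simp)
  then have "mat_poly n (monom c (Suc i)) A = 0 \<cdot>\<^sub>m 1\<^sub>m n + c \<cdot>\<^sub>m (A ^\<^sub>m i * A)"
    unfolding monom_Suc mat_poly_pCons Suc
    using mult_smult_distrib[OF A pow_carrier_mat[OF A]] by simp
  also have "\<dots> = c \<cdot>\<^sub>m (A ^\<^sub>m Suc i)" using A pow_carrier_mat[OF A, of i] by (intro eq_matI) auto
  finally show ?case .
qed

lemma mat_poly_sum:
  "finite S \<Longrightarrow> i < n \<Longrightarrow> j < n \<Longrightarrow>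
    mat_poly n (\<Sum>k\<in>S. p k) A $$ (i, j) = (\<Sum>k\<in>S. mat_poly n (p k) A $$ (i, j))"
proof (induction S rule: finite_induct)
  case (insert x S)
  then show ?case by (simp add: mat_poly_add)
qed (simp add: mat_poly_0)

lemma mat_poly_entries:
  assumes "\<And>x y. x \<in> R \<Longrightarrow> y \<in> R \<Longrightarrow> x + y \<in> R" "\<And>x y. x \<in> R \<Longrightarrow> y \<in> R \<Longrightarrow> x * y \<in> R"
    and "0 \<in> R" "1 \<in> R" "\<And>i. coeff p i \<in> R" "\<And>i j. i < n \<Longrightarrow> j < n \<Longrightarrow> A $$ (i, j) \<in> R"
  shows "i < n \<Longrightarrow> j < n \<Longrightarrow> mat_poly n p A $$ (i, j) \<in> R"
  using assms(5)
proof (induction p arbitrary: i j)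
  case 0
  then show ?case using assms(3) by (simp add: mat_poly_0)
next
  case (pCons a p)
  have sum: "sum f S \<in> R" if "\<And>k. k \<in> S \<Longrightarrow> f k \<in> R" for f and S :: "nat set"
    using that by (induction S rule: infinite_finite_induct) (auto simp: assms)
  have "a \<in> R" using pCons.prems(3)[of 0] by simp
  have "coeff p k \<in> R" for k using pCons.prems(3)[of "Suc k"] by simp
  then have IH: "mat_poly n p A $$ (k, j) \<in> R" if "k < n" for k using pCons.IH pCons.prems(2) that by blast
  have "mat_poly n (pCons a p) A $$ (i, j) = a * (if i = j then 1 else 0) + (\<Sum>k<n. A $$ (i, k) * mat_poly n p A $$ (k, j))"
    using A pCons.prems by (simp add: mat_poly_pCons scalar_prod_def atLeast0LessThan)
  also have "\<dots> \<in> R"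
    using pCons.prems IH \<open>a \<in> R\<close> by (intro assms(1,2) sum) (auto intro: assms)
  finally show ?case .
qed

end

text \<open>The first \<open>n * n + 1\<close> powers of \<open>A\<close> are linearly dependent,
  since matrices have \<open>n * n\<close> entries.\<close>

lemma annihilating_poly_exists:
  fixes A :: "'a::field mat"
  assumes A: "A \<in> carrier_mat n n"
  obtains p where "p \<noteq> 0" "mat_poly n p A = 0\<^sub>m n n"
proof -
  let ?N = "n * n"
  \<comment> \<open>Column \<open>k\<close> lists the entries of the \<open>k\<close>-th power, with
    position \<open>(i, j)\<close> in row \<open>i * n + j\<close>. A last row of zeros makes the
    matrix square and singular.\<close>
  define B where "B = mat (Suc ?N) (Suc ?N) (\<lambda>(r, k). if r < ?N then (A ^\<^sub>m k) $$ (r div n, r mod n) else 0)"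
  have B: "B \<in> carrier_mat (Suc ?N) (Suc ?N)" by (simp add: B_def)
  have "transpose_mat B *\<^sub>v unit_vec (Suc ?N) ?N = 0\<^sub>v (Suc ?N)"
    by (intro eq_vecI) (auto simp: B_def)
  then have "det (transpose_mat B) = 0"
    using det_0_iff_vec_prod_zero_field[of "transpose_mat B" "Suc ?N"] B
    by (metis lessI transpose_carrier_mat unit_vec_carrier unit_vec_nonzero)
  then have "det B = 0" using det_transpose[OF B] by simp
  then obtain v where v: "v \<in> carrier_vec (Suc ?N)" "v \<noteq> 0\<^sub>v (Suc ?N)" "B *\<^sub>v v = 0\<^sub>v (Suc ?N)"
    using det_0_iff_vec_prod_zero_field[OF B] by blast
  define p where "p = (\<Sum>k<Suc ?N. monom (v $ k) k)"
  have coeff_p: "coeff p k = (if k < Suc ?N then v $ k else 0)" for k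
    by (simp add: p_def coeff_sum)
  obtain k where "k < Suc ?N" "v $ k \<noteq> 0"
    using v(1,2) by (metis carrier_vecD eq_vecI index_zero_vec)
  then have "coeff p k \<noteq> 0" using coeff_p by simp
  then have "p \<noteq> 0" by auto
  moreover have "mat_poly n p A = 0\<^sub>m n n"
  proof (rule eq_matI)
    fix i j assume "i < dim_row (0\<^sub>m n n :: 'a mat)" "j < dim_col (0\<^sub>m n n :: 'a mat)"
    then have ij: "i < n" "j < n" by auto
    let ?r = "i * n + j"
    have "?r < ?N"
    proof -
      have "?r < i * n + n" using ij by simp
      also have "\<dots> = Suc i * n" by simp
      also have "\<dots> \<le> n * n" using ij(1) by (intro mult_le_mono1) simp
      finally show ?thesis .
    qed
    have rij: "?r div n = i" "?r mod n = j" using ij by auto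
    have Ak: "dim_row (A ^\<^sub>m k) = n" "dim_col (A ^\<^sub>m k) = n" for k
      using pow_carrier_mat[OF A, of k] by auto
    have "mat_poly n p A $$ (i, j) = (\<Sum>k<Suc ?N. v $ k * (A ^\<^sub>m k) $$ (i, j))"
      unfolding p_def using ij Ak by (subst mat_poly_sum[OF A]) (auto simp: mat_poly_monom[OF A] simp del: sum.lessThan_Suc)
    also have "\<dots> = (\<Sum>k<Suc ?N. B $$ (?r, k) * v $ k)"
      using \<open>?r < ?N\<close> rij by (intro sum.cong) (auto simp: B_def)
    also have "\<dots> = (B *\<^sub>v v) $ ?r"
      using \<open>?r < ?N\<close> B v(1) by (simp add: scalar_prod_def atLeast0LessThan del: sum.lessThan_Suc)
    also have "\<dots> = 0" using v(3) \<open>?r < ?N\<close> by simp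
    finally show "mat_poly n p A $$ (i, j) = 0\<^sub>m n n $$ (i, j)" using ij by simp
  qed (use mat_poly_carrier[OF A, of p] in auto)
  ultimately show thesis using that by blast
qed

text \<open>Split a root \<open>c\<close> off an annihilating polynomial of least degree. The
  cofactor does not annihilate \<open>A\<close>, and any nonzero column of its value at
  \<open>A\<close> is an eigenvector for \<open>c\<close>.\<close>

lemma minimal_annihilating_poly:
  fixes A :: "'a::field mat"
  assumes A: "A \<in> carrier_mat n n"
  obtains p where "p \<noteq> 0" "mat_poly n p A = 0\<^sub>m n n"
    "\<And>c. poly p c = 0 \<Longrightarrow> \<exists>v\<in>carrier_vec n. v \<noteq> 0\<^sub>v n \<and> A *\<^sub>v v = c \<cdot>\<^sub>v v"
proof -
  define ann where "ann p \<longleftrightarrow> p \<noteq> 0 \<and> mat_poly n p A = 0\<^sub>m n n" for p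
  obtain p where p: "ann p" and min: "\<And>q. ann q \<Longrightarrow> degree p \<le> degree q"
    using arg_min_nat_lemma[of ann _ degree] annihilating_poly_exists[OF A] by (metis ann_def)
  have "\<exists>v\<in>carrier_vec n. v \<noteq> 0\<^sub>v n \<and> A *\<^sub>v v = c \<cdot>\<^sub>v v" if c: "poly p c = 0" for c
  proof -
    obtain r where r: "p = [:- c, 1:] * r" using c by (metis poly_eq_0_iff_dvd dvdE)
    have r0: "r \<noteq> 0" using p r by (auto simp: ann_def)
    then have "degree p = Suc (degree r)" unfolding r by (subst degree_mult_eq) auto
    then have "\<not> ann r" using min[of r] by auto
    then have "mat_poly n r A \<noteq> 0\<^sub>m n n" using r0 by (simp add: ann_def)
    define B where "B = mat_poly n r A"
    have B: "B \<in> carrier_mat n n" using mat_poly_carrier[OF A] by (simp add: B_def)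
    have "B \<noteq> 0\<^sub>m n n" using \<open>mat_poly n r A \<noteq> _\<close> by (simp add: B_def)
    then obtain i j where ij: "i < n" "j < n" "B $$ (i, j) \<noteq> 0"
      using B by (metis (no_types, lifting) carrier_matD eq_matI index_zero_mat)
    have "mat_poly n [:- c, 1:] A * B = 0\<^sub>m n n"
      using p unfolding ann_def r mat_poly_mult[OF A] B_def by blast
    moreover have "mat_poly n [:- c, 1:] A = (- c) \<cdot>\<^sub>m 1\<^sub>m n + A"
      using A by (simp add: mat_poly_pCons[OF A] mat_poly_0[OF A]) (intro eq_matI, auto)
    ultimately have zero: "((- c) \<cdot>\<^sub>m 1\<^sub>m n + A) * B = 0\<^sub>m n n" by simp
    let ?v = "col B j"
    have v: "?v \<in> carrier_vec n" by (rule col_carrier_vec[OF ij(2) B])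
    have "((- c) \<cdot>\<^sub>m 1\<^sub>m n + A) *\<^sub>v ?v = 0\<^sub>v n"
      using zero A B ij by (metis (no_types, lifting) add_carrier_mat col_mult2 col_zero)
    moreover have "((- c) \<cdot>\<^sub>m 1\<^sub>m n + A) *\<^sub>v ?v = (- c) \<cdot>\<^sub>v ?v + A *\<^sub>v ?v"
    proof -
      have "((- c) \<cdot>\<^sub>m 1\<^sub>m n) *\<^sub>v ?v = (- c) \<cdot>\<^sub>v ?v"
        by (rule smult_one_mat_mult_vec[OF v])
      then show ?thesis using A v by (subst add_mult_distrib_mat_vec[of _ n n]) auto
    qed
    ultimately have sum: "(- c) \<cdot>\<^sub>v ?v + A *\<^sub>v ?v = 0\<^sub>v n" by simp
    have "A *\<^sub>v ?v = c \<cdot>\<^sub>v ?v"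
    proof (rule eq_vecI)
      fix k assume "k < dim_vec (c \<cdot>\<^sub>v ?v)"
      then have k: "k < n" using carrier_vecD[OF v] by simp
      have "((- c) \<cdot>\<^sub>v ?v + A *\<^sub>v ?v) $ k = 0" using sum k by simp
      then show "(A *\<^sub>v ?v) $ k = (c \<cdot>\<^sub>v ?v) $ k" using k A B by simp
    qed (use A B in simp)
    moreover have "?v $ i \<noteq> 0" using ij B by simp
    then have "?v \<noteq> 0\<^sub>v n" using ij(1) by auto
    ultimately show ?thesis using v by blast
  qed
  then show thesis using that p by (auto simp: ann_def)
qed

text \<open>Put \<open>y = u ^ (q ^ j)\<close>. The geometric sum with \<open>q\<close> terms is
  \<open>q\<close> modulo \<open>y - 1\<close>, so modulo \<open>q\<close> the element
  \<open>y ^ q - 1\<close> is divisible by the square of \<open>y - 1\<close>, and the exponent of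
  \<open>u - 1\<close> grows.\<close>

lemma power_minus_one_expansion:
  fixes u :: "'a::comm_ring_1"
  shows "\<exists>a b. u ^ (q ^ j) - 1 = (u - 1) ^ Suc j * a + of_nat q * b"
proof (induction j)
  case 0
  show ?case by (intro exI[of _ 1] exI[of _ 0]) simp
next
  case (Suc j)
  then obtain a b where ab: "u ^ (q ^ j) - 1 = (u - 1) ^ Suc j * a + of_nat q * b" by blast
  define y where "y = u ^ (q ^ j)"
  have "\<exists>t. (\<Sum>i<k. y ^ i) = of_nat k + (y - 1) * t" for k
  proof (induction k)
    case (Suc k)
    then obtain t where "(\<Sum>i<k. y ^ i) = of_nat k + (y - 1) * t" by blast
    moreover have "y ^ k = 1 + (y - 1) * (\<Sum>i<k. y ^ i)" using power_diff_1_eq[of y k] by (simp add: algebra_simps)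
    ultimately have "(\<Sum>i<Suc k. y ^ i) = of_nat (Suc k) + (y - 1) * (t + (\<Sum>i<k. y ^ i))"
      by (simp add: distrib_left)
    then show ?case by blast
  next
    case 0
    show ?case by (intro exI[of _ 0]) simp
  qed
  then obtain t where t: "(\<Sum>i<q. y ^ i) = of_nat q + (y - 1) * t" by blast
  have sq: "(y - 1) * (y - 1) = (u - 1) ^ Suc (Suc j) * ((u - 1) ^ j * a * a) +
      of_nat q * (b * (y - 1) + (u - 1) ^ Suc j * a * b)"
  proof -
    have "(y - 1) * (y - 1) = ((u - 1) ^ Suc j * a + of_nat q * b) * ((u - 1) ^ Suc j * a + of_nat q * b)"
      using ab by (simp add: y_def)
    moreover have "b * (y - 1) = b * ((u - 1) ^ Suc j * a + of_nat q * b)" using ab by (simp add: y_def)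
    moreover have "(X * a + Q * b) * (X * a + Q * b) = X * X * a * a + Q * (b * (X * a + Q * b) + X * a * b)" for X Q
      by (simp add: algebra_simps)
    moreover have "(u - 1) ^ Suc j * (u - 1) ^ Suc j = (u - 1) ^ Suc (Suc j) * (u - 1) ^ j"
      by (simp add: ac_simps)
    ultimately show ?thesis by (metis mult.assoc)
  qed
  have "u ^ (q ^ Suc j) - 1 = y ^ q - 1" by (simp add: y_def mult.commute flip: power_mult)
  also have "\<dots> = (y - 1) * (of_nat q + (y - 1) * t)" using power_diff_1_eq[of y q] t by simp
  also have "\<dots> = ((y - 1) * (y - 1)) * t + of_nat q * (y - 1)" by (simp add: algebra_simps)
  also have "\<dots> = (u - 1) ^ Suc (Suc j) * ((u - 1) ^ j * a * a * t) +
      of_nat q * ((b * (y - 1) + (u - 1) ^ Suc j * a * b) * t + (y - 1))"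
    unfolding sq by (simp add: algebra_simps)
  finally show ?case by blast
qed

text \<open>The correction term is \<open>q\<close> times an integral polynomial in
  \<open>A\<close>. It has entries in an ideal containing \<open>q\<close> if \<open>A\<close> has
  entries in the ring, and it is zero if \<open>q\<close> is the characteristic; both cases are
  used.\<close>

lemma unipotent_power:
  fixes A :: "'a::comm_ring_1 mat"
  assumes A: "A \<in> carrier_mat n n" and zero: "mat_poly n ((monom 1 N - 1) ^ k) A = 0\<^sub>m n n"
  obtains b :: "int poly"
  where "A ^\<^sub>m (N * q ^ k) = 1\<^sub>m n + of_nat q \<cdot>\<^sub>m mat_poly n (map_poly of_int b) A"
proof -
  obtain a b :: "int poly" where ab:
    "monom 1 N ^ (q ^ k) - 1 = (monom 1 N - 1) ^ Suc k * a + of_nat q * b"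
    using power_minus_one_expansion by blast
  let ?h = "map_poly of_int :: int poly \<Rightarrow> 'a poly"
  interpret h: map_poly_comm_ring_hom "of_int :: int \<Rightarrow> 'a" ..
  have "?h (monom 1 N ^ (q ^ k) - 1) = ?h ((monom 1 N - 1) ^ Suc k * a + of_nat q * b)" using ab by simp
  then have "monom 1 N ^ (q ^ k) - 1 = (monom 1 N - 1) ^ k * ((monom 1 N - 1) * ?h a) + of_nat q * ?h b"
    by (simp add: hom_distribs ac_simps)
  moreover have "(monom 1 N :: 'a poly) ^ (q ^ k) = monom 1 (N * q ^ k)" by (simp add: monom_power)
  moreover have "(of_nat q :: 'a poly) * ?h b = smult (of_nat q) (?h b)" by (simp add: of_nat_poly)
  ultimately have "monom 1 (N * q ^ k) = 1 + (monom 1 N - 1) ^ k * ((monom 1 N - 1) * ?h a) + smult (of_nat q) (?h b)"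
    by (simp add: algebra_simps)
  then have "mat_poly n (monom 1 (N * q ^ k)) A =
      1\<^sub>m n + 0\<^sub>m n n * mat_poly n ((monom 1 N - 1) * ?h a) A + of_nat q \<cdot>\<^sub>m mat_poly n (?h b) A"
    by (simp only: mat_poly_add[OF A] mat_poly_1[OF A] mat_poly_mult[OF A, of "(monom 1 N - 1) ^ k"] zero mat_poly_smult[OF A])
  moreover have "0\<^sub>m n n * mat_poly n ((monom 1 N - 1) * ?h a) A = 0\<^sub>m n n"
    using mat_poly_carrier[OF A] by (intro left_mult_zero_mat) 
  moreover have "1 \<cdot>\<^sub>m (A ^\<^sub>m (N * q ^ k)) = A ^\<^sub>m (N * q ^ k)"
    by (intro eq_matI) auto
  ultimately have "A ^\<^sub>m (N * q ^ k) = 1\<^sub>m n + of_nat q \<cdot>\<^sub>m mat_poly n (?h b) A"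
    by (simp add: mat_poly_monom[OF A])
  then show thesis using that by blast
qed

section \<open>Eigenvalues of central elements of the derived subgroup\<close>

lemma mult_GL: "monoid.mult (GL TYPE('k::field) n) = (*)"
  by (simp add: GL_def units_of_def ring_mat_def)

lemma one_GL: "one (GL TYPE('k::field) n) = 1\<^sub>m n"
  by (simp add: GL_def units_of_def ring_mat_def)

lemma (in group) hom_GL_facts:
  assumes "\<rho> \<in> hom G (GL TYPE('k::field) n)"
  shows "x \<in> carrier G \<Longrightarrow> \<rho> x \<in> carrier_mat n n"
    and "x \<in> carrier G \<Longrightarrow> y \<in> carrier G \<Longrightarrow> \<rho> (x \<otimes> y) = \<rho> x * \<rho> y"
    and "\<rho> \<one> = 1\<^sub>m n"
    and "x \<in> carrier G \<Longrightarrow> \<rho> (x [^] (k::nat)) = \<rho> x ^\<^sub>m k"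
proof -
  show c: "\<And>x. x \<in> carrier G \<Longrightarrow> \<rho> x \<in> carrier_mat n n"
    using hom_in_carrier[OF assms] by (simp add: carrier_GL)
  show m: "\<And>x y. x \<in> carrier G \<Longrightarrow> y \<in> carrier G \<Longrightarrow> \<rho> (x \<otimes> y) = \<rho> x * \<rho> y"
    using hom_mult[OF assms] by (simp add: mult_GL)
  show one: "\<rho> \<one> = 1\<^sub>m n" using hom_one[OF assms is_group group_GL] by (simp add: one_GL)
  show "\<rho> (x [^] k) = \<rho> x ^\<^sub>m k" if x: "x \<in> carrier G"
  proof (induction k)
    case 0
    then show ?case using carrier_matD[OF c[OF x]] one by simp
  next
    case (Suc k)
    then show ?case using m[of "x [^] k" x] x by simp
  qed
qed

text \<open>The columns of \<open>W\<close> form a basis of the kernel. In this form, restricting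
  commuting matrices to an eigenspace becomes a matrix equation.\<close>

lemma kernel_matrix_exists:
  fixes A :: "'k::field mat"
  assumes A: "A \<in> carrier_mat n n"
  obtains d W where "W \<in> carrier_mat n d"
    "\<And>u. u \<in> carrier_vec d \<Longrightarrow> W *\<^sub>v u = 0\<^sub>v n \<Longrightarrow> u = 0\<^sub>v d"
    "\<And>u. u \<in> carrier_vec d \<Longrightarrow> A *\<^sub>v (W *\<^sub>v u) = 0\<^sub>v n"
    "\<And>v. v \<in> carrier_vec n \<Longrightarrow> A *\<^sub>v v = 0\<^sub>v n \<Longrightarrow> \<exists>u\<in>carrier_vec d. v = W *\<^sub>v u"
proof -
  interpret kernel n n A by unfold_locales (rule A)
  obtain B where fin: "finite B" and basis: "basis B" using kernel_basis_exists[OF A] by blast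
  then have indep: "lin_indpt B" and gen: "span B = mat_kernel A" and sub: "B \<subseteq> mat_kernel A"
    by (auto simp: Ker.basis_def)
  obtain bs where bs: "set bs = B" "distinct bs" using finite_distinct_list[OF fin] by blast
  let ?d = "length bs"
  define W where "W = mat n ?d (\<lambda>(i, j). (bs ! j) $ i)"
  have W: "W \<in> carrier_mat n ?d" by (simp add: W_def)
  have nth_bij: "bij_betw ((!) bs) {..<?d} B" using bij_betw_nth[OF bs(2) refl] bs(1) by simp
  have lin: "W *\<^sub>v u = lincomb a B" if u: "u \<in> carrier_vec ?d" and a: "\<And>j. j < ?d \<Longrightarrow> a (bs ! j) = u $ j" for u a
  proof (rule eq_vecI)
    have lc: "lincomb a B \<in> mat_kernel A" using Ker.lincomb_closed[of B a] sub by auto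
    then have lcn: "lincomb a B \<in> carrier_vec n" using mat_kernelD[OF A] by blast
    then show "dim_vec (W *\<^sub>v u) = dim_vec (lincomb a B)" using W by auto
    fix i assume "i < dim_vec (lincomb a B)"
    then have i: "i < n" using lcn by auto
    have "(W *\<^sub>v u) $ i = (\<Sum>j<?d. a (bs ! j) * (bs ! j) $ i)"
      using i u a by (auto simp: W_def scalar_prod_def atLeast0LessThan mult.commute intro!: sum.cong)
    also have "\<dots> = (\<Sum>v\<in>B. a v * v $ i)"
      by (rule sum.reindex_bij_betw[OF nth_bij])
    also have "\<dots> = lincomb a B $ i" using lincomb_index[OF i sub] by simp
    finally show "(W *\<^sub>v u) $ i = lincomb a B $ i" .
  qed
  have "\<exists>a. \<forall>j<?d. a (bs ! j) = u $ j" for u :: "'k Matrix.vec"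
    using nth_bij by (intro exI[of _ "\<lambda>v. u $ (inv_into {..<?d} ((!) bs) v)"]) (auto simp: bij_betw_def)
  then obtain coord where coord: "\<And>u j. j < ?d \<Longrightarrow> coord u (bs ! j) = (u :: 'k Matrix.vec) $ j" by metis
  have "u = 0\<^sub>v ?d" if u: "u \<in> carrier_vec ?d" "W *\<^sub>v u = 0\<^sub>v n" for u
  proof (rule eq_vecI)
    have "lincomb (coord u) B = 0\<^sub>v n" using lin[OF u(1), of "coord u"] coord u(2) by simp
    then have "coord u \<in> B \<rightarrow> {0}"
      using Ker.not_lindepD[OF indep fin subset_refl, of "coord u"] by auto
    fix i assume "i < dim_vec (0\<^sub>v ?d :: 'k Matrix.vec)"
    then have "i < ?d" by simp
    then show "u $ i = 0\<^sub>v ?d $ i" using \<open>coord u \<in> B \<rightarrow> {0}\<close> coord[of i u] bs(1) by (auto simp: Pi_iff)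
  qed (use u in simp)
  moreover have "A *\<^sub>v (W *\<^sub>v u) = 0\<^sub>v n" if u: "u \<in> carrier_vec ?d" for u
  proof -
    have "W *\<^sub>v u = lincomb (coord u) B" using lin[OF u] coord by simp
    then have "W *\<^sub>v u \<in> mat_kernel A" using Ker.lincomb_closed[of B "coord u"] sub by auto
    then show ?thesis using mat_kernelD[OF A] by blast
  qed
  moreover have "\<exists>u\<in>carrier_vec ?d. v = W *\<^sub>v u" if v: "v \<in> carrier_vec n" "A *\<^sub>v v = 0\<^sub>v n" for v
  proof -
    have "v \<in> span B" using mat_kernelI[OF A v] gen by simp
    then obtain a where a: "v = lincomb a B" using Ker.finite_in_span[OF fin sub] by blast
    define u where "u = Matrix.vec ?d (\<lambda>j. a (bs ! j))"
    have "v = W *\<^sub>v u" using lin[of u a] a by (simp add: u_def)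
    moreover have "u \<in> carrier_vec ?d" by (simp add: u_def)
    ultimately show ?thesis by blast
  qed
  ultimately show thesis using that W by blast
qed

lemma injective_matrix_cancel:
  fixes W :: "'k::field mat"
  assumes W: "W \<in> carrier_mat n d" and inj: "\<And>u. u \<in> carrier_vec d \<Longrightarrow> W *\<^sub>v u = 0\<^sub>v n \<Longrightarrow> u = 0\<^sub>v d"
    and AB: "A \<in> carrier_mat d m" "B \<in> carrier_mat d m" and eq: "W * A = W * B"
  shows "A = B"
proof -
  have "A - B = 0\<^sub>m d m"
  proof (rule eq_matI)
    fix i j assume "i < dim_row (0\<^sub>m d m :: 'k mat)" "j < dim_col (0\<^sub>m d m :: 'k mat)"
    then have ij: "i < d" "j < m" by auto
    have "W * (A - B) = 0\<^sub>m n m" using mult_minus_distrib_mat[OF W AB] eq mult_carrier_mat[OF W AB(2)] by simp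
    then have "col (W * (A - B)) j = 0\<^sub>v n" using ij by simp
    then have "W *\<^sub>v col (A - B) j = 0\<^sub>v n"
      using col_mult2[OF W minus_carrier_mat[OF AB(2), of A] ij(2)] by simp
    then have "col (A - B) j = 0\<^sub>v d"
      using inj[of "col (A - B) j"] col_carrier_vec[OF ij(2) minus_carrier_mat[OF AB(2), of A]] by blast
    moreover have "(A - B) $$ (i, j) = col (A - B) j $ i" using ij AB by simp
    ultimately show "(A - B) $$ (i, j) = 0\<^sub>m d m $$ (i, j)" using ij by simp
  qed (use AB in auto)
  then have eq: "(A - B) $$ (i, j) = 0" if "i < d" "j < m" for i j using that by simp
  show ?thesis
  proof (rule eq_matI)
    fix i j assume "i < dim_row B" "j < dim_col B"
    then show "A $$ (i, j) = B $$ (i, j)" using eq[of i j] AB by simp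
  qed (use AB in auto)
qed

text \<open>The determinant of the action on an eigenspace of a central element is a character of \<open>M\<close>,
  hence trivial on commutators.\<close>

lemma (in group) eigenvalue_root_of_unity:
  fixes \<rho> :: "'a \<Rightarrow> 'k::field mat"
  assumes M: "subgroup M G" and \<rho>: "\<rho> \<in> hom G (GL TYPE('k) n)"
    and b: "b \<in> derived G M" and comm: "\<And>x. x \<in> M \<Longrightarrow> x \<otimes> b = b \<otimes> x"
    and v: "v \<in> carrier_vec n" "v \<noteq> 0\<^sub>v n" "\<rho> b *\<^sub>v v = c \<cdot>\<^sub>v v"
  shows "\<exists>d>0. c ^ d = 1"
proof -
  note \<rho>c = hom_GL_facts(1)[OF \<rho>] and \<rho>m = hom_GL_facts(2)[OF \<rho>] and \<rho>1 = hom_GL_facts(3)[OF \<rho>]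
  have Mc: "x \<in> carrier G" if "x \<in> M" for x using subgroup.mem_carrier[OF M that] .
  have bM: "b \<in> M" using derived_incl[OF subset_refl M] b by blast
  let ?B = "\<rho> b"
  have B: "?B \<in> carrier_mat n n" using \<rho>c Mc bM by blast
  let ?A = "(- c) \<cdot>\<^sub>m 1\<^sub>m n + ?B"
  have A: "?A \<in> carrier_mat n n" using B by simp
  have eig: "?A *\<^sub>v u = 0\<^sub>v n \<longleftrightarrow> ?B *\<^sub>v u = c \<cdot>\<^sub>v u" if u: "u \<in> carrier_vec n" for u
  proof -
    have Bu: "?B *\<^sub>v u \<in> carrier_vec n" using B u by simp
    have "?A *\<^sub>v u = (- c) \<cdot>\<^sub>v u + ?B *\<^sub>v u"
      using u B add_mult_distrib_mat_vec[of "(- c) \<cdot>\<^sub>m 1\<^sub>m n" n n ?B u] smult_one_mat_mult_vec[OF u, of "- c"] by simp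
    moreover have "(- c) \<cdot>\<^sub>v u + ?B *\<^sub>v u = 0\<^sub>v n \<longleftrightarrow> ?B *\<^sub>v u = c \<cdot>\<^sub>v u"
    proof
      assume h: "(- c) \<cdot>\<^sub>v u + ?B *\<^sub>v u = 0\<^sub>v n"
      show "?B *\<^sub>v u = c \<cdot>\<^sub>v u"
      proof (rule eq_vecI)
        fix i assume "i < dim_vec (c \<cdot>\<^sub>v u)"
        then have i: "i < n" using u by simp
        have "((- c) \<cdot>\<^sub>v u + ?B *\<^sub>v u) $ i = 0" using h i by simp
        moreover have "((- c) \<cdot>\<^sub>v u + ?B *\<^sub>v u) $ i = - c * u $ i + (?B *\<^sub>v u) $ i"
          using i u carrier_vecD[OF Bu] by (simp del: index_mult_mat_vec)
        ultimately show "(?B *\<^sub>v u) $ i = (c \<cdot>\<^sub>v u) $ i" using i u by (simp del: index_mult_mat_vec)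
      qed (use u B in simp)
    qed (use u in \<open>auto intro!: eq_vecI\<close>)
    ultimately show ?thesis by simp
  qed
  obtain d W where W: "W \<in> carrier_mat n d"
    and inj: "\<And>u. u \<in> carrier_vec d \<Longrightarrow> W *\<^sub>v u = 0\<^sub>v n \<Longrightarrow> u = 0\<^sub>v d"
    and ker: "\<And>u. u \<in> carrier_vec d \<Longrightarrow> ?A *\<^sub>v (W *\<^sub>v u) = 0\<^sub>v n"
    and img: "\<And>u. u \<in> carrier_vec n \<Longrightarrow> ?A *\<^sub>v u = 0\<^sub>v n \<Longrightarrow> \<exists>y\<in>carrier_vec d. u = W *\<^sub>v y"
    by (rule kernel_matrix_exists[OF A]) (rule that; assumption)
  have "d > 0"
  proof (rule ccontr)
    assume "\<not> d > 0"
    have "?A *\<^sub>v v = 0\<^sub>v n" using eig[OF v(1)] v(3) by simp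
    then obtain y where y: "y \<in> carrier_vec d" "v = W *\<^sub>v y" using img[OF v(1)] by blast
    have "W *\<^sub>v y = 0\<^sub>v n" using W y(1) \<open>\<not> d > 0\<close> by (intro eq_vecI) (auto simp: scalar_prod_def)
    then show False using y(2) v(2) by simp
  qed
  have Weig: "?B *\<^sub>v (W *\<^sub>v u) = c \<cdot>\<^sub>v (W *\<^sub>v u)" if u: "u \<in> carrier_vec d" for u
    using ker[OF u] eig[of "W *\<^sub>v u"] W u by simp
  \<comment> \<open>Since \<open>x\<close> commutes with \<open>b\<close>, it preserves the
    eigenspace; \<open>C\<close> is the matrix of its action in the basis \<open>W\<close>.\<close>
  have ex: "\<exists>C\<in>carrier_mat d d. \<rho> x * W = W * C" if x: "x \<in> M" for x
  proof -
    have xc: "\<rho> x \<in> carrier_mat n n" using \<rho>c Mc x by blast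
    have "\<exists>y\<in>carrier_vec d. col (\<rho> x * W) j = W *\<^sub>v y" if j: "j < d" for j
    proof (rule img)
      let ?w = "col W j"
      have w: "?w \<in> carrier_vec n" using col_carrier_vec[OF j W] .
      have wu: "?w = W *\<^sub>v unit_vec d j" using W j by (intro eq_vecI) auto
      have Bw: "?B *\<^sub>v ?w = c \<cdot>\<^sub>v ?w" unfolding wu by (rule Weig) simp
      have col: "col (\<rho> x * W) j = \<rho> x *\<^sub>v ?w" using col_mult2[OF xc W j] .
      show c: "col (\<rho> x * W) j \<in> carrier_vec n" using col xc w by simp
      have "?B * \<rho> x = \<rho> x * ?B" using \<rho>m comm[OF x] Mc x bM by metis
      then have "?B *\<^sub>v (\<rho> x *\<^sub>v ?w) = \<rho> x *\<^sub>v (?B *\<^sub>v ?w)"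
        using assoc_mult_mat_vec[OF B xc w] assoc_mult_mat_vec[OF xc B w] by simp
      also have "\<dots> = c \<cdot>\<^sub>v (\<rho> x *\<^sub>v ?w)" unfolding Bw by (rule mult_mat_vec[OF xc w])
      finally show "?A *\<^sub>v col (\<rho> x * W) j = 0\<^sub>v n" using eig[OF c] col by simp
    qed
    then obtain y where y: "\<And>j. j < d \<Longrightarrow> y j \<in> carrier_vec d" "\<And>j. j < d \<Longrightarrow> col (\<rho> x * W) j = W *\<^sub>v y j" by metis
    define C where "C = mat d d (\<lambda>(i, j). y j $ i)"
    have C: "C \<in> carrier_mat d d" by (simp add: C_def)
    have colC: "col C j = y j" if "j < d" for j using y(1)[OF that] that by (intro eq_vecI) (auto simp: C_def)
    have "\<rho> x * W = W * C"
    proof (rule mat_col_eqI)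
      fix j assume "j < dim_col (W * C)"
      then have j: "j < d" using C by simp
      show "col (\<rho> x * W) j = col (W * C) j" using y(2)[OF j] colC[OF j] col_mult2[OF W C j] by simp
    qed (use xc W C in auto)
    then show ?thesis using C by blast
  qed
  then obtain C where C: "\<And>x. x \<in> M \<Longrightarrow> C x \<in> carrier_mat d d" "\<And>x. x \<in> M \<Longrightarrow> \<rho> x * W = W * C x" by metis
  have Cm: "C (x \<otimes> y) = C x * C y" if xy: "x \<in> M" "y \<in> M" for x y
  proof (rule injective_matrix_cancel[OF W inj])
    have xyM: "x \<otimes> y \<in> M" using xy subgroup.m_closed[OF M] by blast
    show "C (x \<otimes> y) \<in> carrier_mat d d" "C x * C y \<in> carrier_mat d d" 
      using C(1)[OF xyM] mult_carrier_mat[OF C(1)[OF xy(1)] C(1)[OF xy(2)]] by simp_all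
    have xc: "\<rho> x \<in> carrier_mat n n" "\<rho> y \<in> carrier_mat n n" using \<rho>c Mc xy by auto
    have "W * C (x \<otimes> y) = \<rho> x * (\<rho> y * W)"
      using C(2)[OF xyM] \<rho>m Mc xy assoc_mult_mat[OF xc W] by simp
    also have "\<dots> = (\<rho> x * W) * C y" using C(2)[OF xy(2)] assoc_mult_mat[OF xc(1) W C(1)[OF xy(2)]] by simp
    also have "\<dots> = W * (C x * C y)" using C(2)[OF xy(1)] assoc_mult_mat[OF W C(1)[OF xy(1)] C(1)[OF xy(2)]] by simp
    finally show "W * C (x \<otimes> y) = W * (C x * C y)" .
  qed
  have oneM: "\<one> \<in> M" using subgroup.one_closed[OF M] .
  have "W * C \<one> = W * 1\<^sub>m d"
    unfolding C(2)[OF oneM, symmetric] \<rho>1 using left_mult_one_mat[OF W] right_mult_one_mat[OF W] by simp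
  then have C1: "C \<one> = 1\<^sub>m d"
    using injective_matrix_cancel[OF W inj C(1)[OF oneM] one_carrier_mat] by blast
  define \<theta> where "\<theta> x = det (C x)" for x
  have \<theta>m: "\<theta> (x \<otimes> y) = \<theta> x * \<theta> y" if "x \<in> M" "y \<in> M" for x y
    using Cm[OF that] det_mult[OF C(1) C(1)] that by (simp add: \<theta>_def)
  have \<theta>1: "\<theta> \<one> = 1" by (simp add: \<theta>_def C1)
  have invM: "inv x \<in> M" if "x \<in> M" for x using subgroup.m_inv_closed[OF M that] .
  have \<theta>inv: "\<theta> x * \<theta> (inv x) = 1" if "x \<in> M" for x
    using \<theta>m[OF that invM[OF that]] Mc[OF that] \<theta>1 by simp
  have "\<theta> b = 1"
    using b unfolding derived_def
  proof (induction rule: generate.induct)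
    case (incl h)
    then obtain x y where xy: "x \<in> M" "y \<in> M" "h = x \<otimes> y \<otimes> inv x \<otimes> inv y" by auto
    have "\<theta> h = (\<theta> x * \<theta> (inv x)) * (\<theta> y * \<theta> (inv y))"
      unfolding xy(3) using xy(1,2) invM subgroup.m_closed[OF M] by (simp add: \<theta>m)
    then show ?case using \<theta>inv xy by simp
  next
    case (inv h)
    then obtain x y where xy: "x \<in> M" "y \<in> M" "h = x \<otimes> y \<otimes> inv x \<otimes> inv y" by auto
    have hM: "h \<in> M" unfolding xy(3) using xy(1,2) invM subgroup.m_closed[OF M] by simp
    have "\<theta> h = (\<theta> x * \<theta> (inv x)) * (\<theta> y * \<theta> (inv y))"
      unfolding xy(3) using xy(1,2) invM subgroup.m_closed[OF M] by (simp add: \<theta>m)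
    then have "\<theta> h = 1" using \<theta>inv xy by simp
    then show ?case using \<theta>inv[OF hM] by simp
  next
    case (eng h1 h2)
    have "derived G M \<subseteq> M" using derived_incl[OF subset_refl M] .
    then have "h1 \<in> M" "h2 \<in> M" using eng.hyps unfolding derived_def by auto
    then show ?case using \<theta>m eng.IH by simp
  qed (rule \<theta>1)
  \<comment> \<open>On its eigenspace \<open>b\<close> is the scalar \<open>c\<close>, so its
    determinant there is \<open>c ^ d\<close>; \<open>d\<close> is positive because of the
    eigenvector \<open>v\<close>.\<close>
  moreover have "C b = c \<cdot>\<^sub>m 1\<^sub>m d"
  proof (rule injective_matrix_cancel[OF W inj C(1)[OF bM]])
    show "c \<cdot>\<^sub>m 1\<^sub>m d \<in> carrier_mat d d" by simp
    have "W * C b = ?B * W" using C(2)[OF bM] by simp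
    also have "\<dots> = c \<cdot>\<^sub>m W"
    proof (rule mat_col_eqI)
      fix j assume "j < dim_col (c \<cdot>\<^sub>m W)"
      then have j: "j < d" using W by simp
      have wu: "col W j = W *\<^sub>v unit_vec d j" using W j by (intro eq_vecI) auto
      have "col (?B * W) j = ?B *\<^sub>v col W j" using col_mult2[OF B W j] .
      also have "\<dots> = c \<cdot>\<^sub>v col W j" unfolding wu by (rule Weig) simp
      also have "\<dots> = col (c \<cdot>\<^sub>m W) j" using j W by simp
      finally show "col (?B * W) j = col (c \<cdot>\<^sub>m W) j" .
    qed (use B W in auto)
    also have "\<dots> = W * (c \<cdot>\<^sub>m 1\<^sub>m d)" using mult_smult_distrib[OF W one_carrier_mat, of c] W by simp
    finally show "W * C b = W * (c \<cdot>\<^sub>m 1\<^sub>m d)" .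
  qed
  then have "\<theta> b = c ^ d" by (simp add: \<theta>_def det_smult)
  ultimately show ?thesis using \<open>d > 0\<close> by auto
qed

section \<open>Torsion of word values in linear groups\<close>

text \<open>Split off the roots of \<open>p\<close> one at a time: every linear factor divides
  \<open>u\<close>, so \<open>degree p\<close> copies of \<open>u\<close> suffice.\<close>

lemma alg_closed_dvd_power:
  fixes p u :: "'k::alg_closed_field poly"
  assumes "p \<noteq> 0" "\<And>c. poly p c = 0 \<Longrightarrow> poly u c = 0"
  shows "p dvd u ^ degree p"
  using assms
proof (induction "degree p" arbitrary: p rule: less_induct)
  case less
  show ?case
  proof (cases "degree p = 0")
    case True
    then obtain c where "p = [:c:]" using degree_eq_zeroE by blast
    then have "p dvd 1" using less.prems(1) by (simp add: is_unit_const_poly_iff)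
    then show ?thesis using True by simp
  next
    case False
    then obtain c where c: "poly p c = 0" using alg_closed_imp_poly_has_root[of p] by blast
    then obtain r where r: "p = [:- c, 1:] * r" by (metis poly_eq_0_iff_dvd dvdE)
    have r0: "r \<noteq> 0" using less.prems(1) r by auto
    then have deg: "degree p = Suc (degree r)" unfolding r by (subst degree_mult_eq) auto
    have "poly u a = 0" if "poly r a = 0" for a
      using that less.prems(2)[of a] by (simp add: r)
    then have "r dvd u ^ degree r" using less.hyps[of r] deg r0 by simp
    moreover have "[:- c, 1:] dvd u" using less.prems(2)[OF c] by (simp add: poly_eq_0_iff_dvd)
    ultimately have "[:- c, 1:] * r dvd u * u ^ degree r" by (intro mult_dvd_mono)
    then show ?thesis using deg r by simp
  qed
qed

section \<open>Congruences of matrices and congruence subgroups\<close>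

definition mat_cong :: "nat \<Rightarrow> 'k::comm_ring_1 set \<Rightarrow> 'k mat \<Rightarrow> 'k mat \<Rightarrow> bool" where
  "mat_cong n I A B \<longleftrightarrow> (\<forall>i<n. \<forall>j<n. A $$ (i, j) - B $$ (i, j) \<in> I)"

lemma mat_cong_mult:
  assumes R: "is_subring R" "is_ideal R I"
    and c: "A \<in> carrier_mat n n" "B \<in> carrier_mat n n" "A' \<in> carrier_mat n n" "B' \<in> carrier_mat n n"
    and e: "\<And>i j. i < n \<Longrightarrow> j < n \<Longrightarrow> A' $$ (i, j) \<in> R" "\<And>i j. i < n \<Longrightarrow> j < n \<Longrightarrow> B $$ (i, j) \<in> R"
    and "mat_cong n I A A'" "mat_cong n I B B'"
  shows "mat_cong n I (A * B) (A' * B')"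
  unfolding mat_cong_def
proof (intro allI impI)
  fix i j assume ij: "i < n" "j < n"
  have "(A * B) $$ (i, j) - (A' * B') $$ (i, j) = (\<Sum>k<n. A $$ (i, k) * B $$ (k, j) - A' $$ (i, k) * B' $$ (k, j))"
    using ij c by (simp add: scalar_prod_def atLeast0LessThan sum_subtractf)
  \<comment> \<open>Splitting the difference in this way asks only the entries of \<open>A'\<close>
    and \<open>B\<close> to lie in \<open>R\<close>.\<close>
  also have "\<dots> = (\<Sum>k<n. (A $$ (i, k) - A' $$ (i, k)) * B $$ (k, j) + A' $$ (i, k) * (B $$ (k, j) - B' $$ (k, j)))"
    by (intro sum.cong) (auto simp: algebra_simps)
  also have "\<dots> \<in> I"
    using assms(9,10) ij e unfolding mat_cong_def
    by (intro is_ideal_sum[OF R] is_idealD(3)[OF R] is_idealD(4,5)[OF R]) auto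
  finally show "(A * B) $$ (i, j) - (A' * B') $$ (i, j) \<in> I" .
qed

lemma finite_image_factor:
  assumes "finite (f ` S)" "\<And>x y. x \<in> S \<Longrightarrow> y \<in> S \<Longrightarrow> f x = f y \<Longrightarrow> g x = g y"
  shows "finite (g ` S)"
proof -
  have "g ` S \<subseteq> (\<lambda>z. g (inv_into S f z)) ` f ` S"
  proof
    fix y assume "y \<in> g ` S"
    then obtain x where x: "x \<in> S" "y = g x" by blast
    then have "inv_into S f (f x) \<in> S" "f (inv_into S f (f x)) = f x"
      by (auto intro: inv_into_into f_inv_into_f)
    then have "y = g (inv_into S f (f x))" using assms(2)[OF x(1)] x(2) by metis
    then show "y \<in> (\<lambda>z. g (inv_into S f z)) ` f ` S" using x(1) by blast
  qed
  then show ?thesis using assms(1) finite_surj by blast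
qed

text \<open>Elements whose matrices have the same residues modulo \<open>I\<close> lie in one coset,
  and there are only finitely many matrices of residues.\<close>

lemma (in group) congruence_kernel:
  assumes \<rho>: "\<rho> \<in> hom G (GL TYPE('k::field) n)"
    and R: "is_subring R" "is_ideal R I" and fin: "finite_index R I"
    and entries: "\<And>x i j. x \<in> carrier G \<Longrightarrow> i < n \<Longrightarrow> j < n \<Longrightarrow> \<rho> x $$ (i, j) \<in> R"
  defines "N \<equiv> {x \<in> carrier G. mat_cong n I (\<rho> x) (1\<^sub>m n)}"
  shows "N \<lhd> G" "finite (rcosets N)"
proof -
  note \<rho>f = hom_GL_facts[OF \<rho>]
  have refl: "mat_cong n I A A" for A using is_idealD(2)[OF R] by (simp add: mat_cong_def)
  have sym: "mat_cong n I A B \<Longrightarrow> mat_cong n I B A" for A B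
    using is_idealD(6)[OF R] unfolding mat_cong_def by (metis minus_diff_eq)
  have one_entries: "1\<^sub>m n $$ (i, j) \<in> R" if "i < n" "j < n" for i j
    using is_subringD(1,2)[OF R(1)] that by simp
  have mult: "mat_cong n I (\<rho> (x \<otimes> y)) (A * B)"
    if "x \<in> carrier G" "y \<in> carrier G" "A \<in> carrier_mat n n" "B \<in> carrier_mat n n"
      "mat_cong n I (\<rho> x) A" "mat_cong n I (\<rho> y) B" "\<And>i j. i < n \<Longrightarrow> j < n \<Longrightarrow> A $$ (i, j) \<in> R" for x y A B
    unfolding \<rho>f(2)[OF that(1,2)] using that \<rho>f(1) entries by (intro mat_cong_mult[OF R]) auto
  have sub: "subgroup N G"
  proof
    show "N \<subseteq> carrier G" by (auto simp: N_def)
    show "\<one> \<in> N" using refl \<rho>f(3) by (simp add: N_def)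
    show "x \<otimes> y \<in> N" if "x \<in> N" "y \<in> N" for x y
      using that mult[of x y "1\<^sub>m n" "1\<^sub>m n"] one_entries by (auto simp: N_def)
    show "inv x \<in> N" if "x \<in> N" for x
    proof -
      have x: "x \<in> carrier G" "mat_cong n I (\<rho> x) (1\<^sub>m n)" using that by (auto simp: N_def)
      have "mat_cong n I (\<rho> (inv x \<otimes> x)) (\<rho> (inv x) * 1\<^sub>m n)"
        using x \<rho>f(1) entries by (intro mult refl) auto
      then have "mat_cong n I (1\<^sub>m n) (\<rho> (inv x))"
        using x(1) \<rho>f(3) right_mult_one_mat[OF \<rho>f(1)[OF inv_closed[OF x(1)]]] by simp
      then show ?thesis using x sym by (simp add: N_def)
    qed
  qed
  show normal: "N \<lhd> G"
    unfolding normal_inv_iff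
  proof (intro conjI ballI sub)
    fix x h assume x: "x \<in> carrier G" and "h \<in> N"
    then have h: "h \<in> carrier G" "mat_cong n I (\<rho> h) (1\<^sub>m n)" by (auto simp: N_def)
    have "mat_cong n I (\<rho> (x \<otimes> h)) (\<rho> x * 1\<^sub>m n)"
      using x h \<rho>f(1) entries by (intro mult refl) auto
    then have "mat_cong n I (\<rho> (x \<otimes> h)) (\<rho> x)" using \<rho>f(1)[OF x] by simp
    then have "mat_cong n I (\<rho> (x \<otimes> h \<otimes> inv x)) (\<rho> x * \<rho> (inv x))"
      using x h \<rho>f(1) entries by (intro mult refl) auto
    also have "\<rho> x * \<rho> (inv x) = 1\<^sub>m n" using \<rho>f(2)[of x "inv x"] \<rho>f(3) x by simp
    finally show "x \<otimes> h \<otimes> inv x \<in> N" using x h by (simp add: N_def)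
  qed
  obtain F where F: "finite F" "\<And>r. r \<in> R \<Longrightarrow> \<exists>f\<in>F. r - f \<in> I" using fin by (auto simp: finite_index_def)
  then obtain \<phi> where \<phi>: "\<And>r. r \<in> R \<Longrightarrow> \<phi> r \<in> F" "\<And>r. r \<in> R \<Longrightarrow> r - \<phi> r \<in> I" by metis
  define f where "f x = (\<lambda>(i, j)\<in>{..<n} \<times> {..<n}. \<phi> (\<rho> x $$ (i, j)))" for x
  have "finite ((\<lambda>x. N #> x) ` carrier G)"
  proof (rule finite_image_factor)
    have "f ` carrier G \<subseteq> ({..<n} \<times> {..<n}) \<rightarrow>\<^sub>E F"
      unfolding f_def using entries \<phi>(1) by (intro image_subsetI restrict_PiE_iff[THEN iffD2]) auto
    then show "finite (f ` carrier G)" by (rule finite_subset) (intro finite_PiE F(1), simp)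
    fix x y assume xy: "x \<in> carrier G" "y \<in> carrier G" "f x = f y"
    have "mat_cong n I (\<rho> x) (\<rho> y)"
      unfolding mat_cong_def
    proof (intro allI impI)
      fix i j assume ij: "i < n" "j < n"
      have "\<phi> (\<rho> x $$ (i, j)) = \<phi> (\<rho> y $$ (i, j))" using fun_cong[OF xy(3), of "(i, j)"] ij by (simp add: f_def)
      then have "\<rho> x $$ (i, j) - \<rho> y $$ (i, j) =
          (\<rho> x $$ (i, j) - \<phi> (\<rho> x $$ (i, j))) - (\<rho> y $$ (i, j) - \<phi> (\<rho> y $$ (i, j)))" by simp
      also have "\<dots> \<in> I"
        by (rule is_idealD(7)[OF R \<phi>(2)[OF entries[OF xy(1) ij]] \<phi>(2)[OF entries[OF xy(2) ij]]])
      finally show "\<rho> x $$ (i, j) - \<rho> y $$ (i, j) \<in> I" .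
    qed
    then have "mat_cong n I (\<rho> (x \<otimes> inv y)) (\<rho> y * \<rho> (inv y))"
      using xy \<rho>f(1) entries by (intro mult refl) auto
    also have "\<rho> y * \<rho> (inv y) = 1\<^sub>m n" using \<rho>f(2)[of y "inv y"] \<rho>f(3) xy by simp
    finally have "x \<otimes> inv y \<in> N" using xy by (simp add: N_def)
    then show "N #> x = N #> y" using normal.factor_eq_iff[OF normal] xy by simp
  qed
  moreover have "rcosets N = (\<lambda>x. N #> x) ` carrier G" by (auto simp: RCOSETS_def)
  ultimately show "finite (rcosets N)" by simp
qed

text \<open>Entries of inverses are assumed separately, since \<open>R\<close> need not contain the
  inverse of the determinant of a generator.\<close>

lemma (in group) entries_generate:
  assumes \<rho>: "\<rho> \<in> hom G (GL TYPE('k::field) n)" and R: "is_subring R"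
    and T: "T \<subseteq> carrier G" "\<And>t i j. t \<in> T \<Longrightarrow> i < n \<Longrightarrow> j < n \<Longrightarrow> \<rho> t $$ (i, j) \<in> R"
      "\<And>t i j. t \<in> T \<Longrightarrow> i < n \<Longrightarrow> j < n \<Longrightarrow> \<rho> (inv t) $$ (i, j) \<in> R"
    and "x \<in> generate G T"
  shows "i < n \<Longrightarrow> j < n \<Longrightarrow> \<rho> x $$ (i, j) \<in> R"
  using assms(6)
proof (induction arbitrary: i j rule: generate.induct)
  case one
  then show ?case using hom_GL_facts(3)[OF \<rho>] is_subringD(1,2)[OF R] by simp
next
  case (eng h1 h2)
  have c: "h1 \<in> carrier G" "h2 \<in> carrier G" using eng.hyps generate_in_carrier[OF T(1)] by auto
  have "\<rho> (h1 \<otimes> h2) $$ (i, j) = (\<Sum>k<n. \<rho> h1 $$ (i, k) * \<rho> h2 $$ (k, j))"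
    using hom_GL_facts(1,2)[OF \<rho>] c eng.prems
    by (simp add: scalar_prod_def atLeast0LessThan carrier_matD[OF hom_GL_facts(1)[OF \<rho>]])
  also have "\<dots> \<in> R" using eng by (intro is_subring_sum[OF R] is_subringD(4)[OF R]) auto
  finally show ?case .
qed (use T in auto)

text \<open>The hypothesis \<open>unip\<close> says that \<open>b [^] N\<close> is unipotent; it is
  the element to be detected in a finite quotient.\<close>

lemma (in normal) unipotent_marginal_value_trivial:
  fixes \<rho> :: "'a \<Rightarrow> 'k::field mat"
  assumes char: "CHAR('k) = 0" and \<rho>: "\<rho> \<in> mon G (GL TYPE('k) n)"
    and T: "carrier G = generate G T" "finite T" "T \<subseteq> carrier G"
    and fin: "finite (rcosets H)" and marg: "marginal G w H" and g: "range g \<subseteq> carrier G"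
    and b: "b = word_value G w g [^] (l::nat)"
    and unip: "mat_poly n ((monom 1 N - 1) ^ k) (\<rho> b) = 0\<^sub>m n n"
  shows "b [^] N = \<one>"
proof (rule ccontr)
  assume neq: "b [^] N \<noteq> \<one>"
  have \<rho>h: "\<rho> \<in> hom G (GL TYPE('k) n)" and \<rho>inj: "inj_on \<rho> (carrier G)" using \<rho> by (auto simp: mon_def)
  note \<rho>f = hom_GL_facts[OF \<rho>h]
  let ?v = "word_value G w g"
  have v: "?v \<in> carrier G" using word_value_closed[of g w] g by auto
  have bc: "b \<in> carrier G" using v b by simp
  have "\<rho> (b [^] N) \<noteq> 1\<^sub>m n" using neq inj_onD[OF \<rho>inj, of "b [^] N" \<one>] \<rho>f(3) bc by auto
  then obtain i0 j0 where ij0: "i0 < n" "j0 < n" "\<rho> (b [^] N) $$ (i0, j0) \<noteq> 1\<^sub>m n $$ (i0, j0)"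
    using \<rho>f(1)[of "b [^] N"] bc
    by (metis (no_types, lifting) carrier_matD(1,2) eq_matI index_one_mat(2,3) nat_pow_closed)
  define s where "s = \<rho> (b [^] N) $$ (i0, j0) - 1\<^sub>m n $$ (i0, j0)"
  define S where "S = (\<lambda>(t, i, j). \<rho> t $$ (i, j)) ` (T \<times> {..<n} \<times> {..<n}) \<union>
    (\<lambda>(t, i, j). \<rho> (inv t) $$ (i, j)) ` (T \<times> {..<n} \<times> {..<n})"
  have "finite S" using T(2) by (simp add: S_def)
  then obtain R where sep: "separating_ideals R" and SR: "S \<subseteq> R"
    using separating_ideals_finite_set[OF char] by blast
  have R: "is_subring R" using sep by (simp add: separating_ideals_def)
  have entries: "\<rho> x $$ (i, j) \<in> R" if "x \<in> carrier G" "i < n" "j < n" for x i j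
  proof (rule entries_generate[OF \<rho>h R T(3)])
    show "\<rho> t $$ (i, j) \<in> R" "\<rho> (inv t) $$ (i, j) \<in> R" if "t \<in> T" "i < n" "j < n" for t i j
      using SR that by (force simp: S_def)+
  qed (use that T(1) in auto)
  define m where "m = card (rcosets H)"
  have sR: "s \<in> R" unfolding s_def using entries[of "b [^] N"] bc ij0 is_subringD(1,2,6)[OF R] by simp
  have fR: "of_nat (fact m) \<in> R" by (rule is_subringD(8)[OF R])
  have "s \<noteq> 0" using ij0(3) by (simp add: s_def)
  moreover have "(of_nat (fact m) :: 'k) \<noteq> 0" using char by (simp only: of_nat_eq_0_iff_char_dvd) simp
  ultimately have "s * of_nat (fact m) \<noteq> 0" by simp
  moreover have "s * of_nat (fact m) \<in> R" using is_subringD(4)[OF R sR fR] .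
  \<comment> \<open>Invertibility of \<open>s\<close> keeps \<open>b [^] N\<close> nontrivial modulo
    \<open>I\<close>. Invertibility of the factorial excludes all primes up to the index
    \<open>m\<close>.\<close>
  ultimately obtain I q where I: "is_ideal R I" "finite_index R I" "1 \<notin> I" "prime (q::nat)" "of_nat q \<in> I"
    "unit_mod R I (s * of_nat (fact m))" using sep unfolding separating_ideals_def by blast
  have units: "unit_mod R I s" "unit_mod R I (of_nat (fact m))"
    using unit_mod_mult[OF R I(1) sR fR] I(6) by auto
  have one: "(1::'k) \<in> R" using is_subringD(2)[OF R] .
  have "m < q"
  proof (rule ccontr)
    assume "\<not> m < q"
    then have "q dvd fact m" using I(4) by (simp add: prime_dvd_fact_iff)
    then obtain l where "fact m = l * q" by (metis dvd_def mult.commute)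
    then have "(of_nat (fact m) :: 'k) = of_nat l * of_nat q" by (metis of_nat_mult)
    then have "of_nat (fact m) * (1::'k) \<in> I" using is_idealD(4)[OF R I(1) is_subringD(8)[OF R] I(5)] by simp
    then show False using unit_mod_cancel[OF R I(1) units(2) _ one] I(3) by blast
  qed
  define K where "K = {x \<in> carrier G. mat_cong n I (\<rho> x) (1\<^sub>m n)}"
  have K: "K \<lhd> G" "finite (rcosets K)"
    unfolding K_def using congruence_kernel[OF \<rho>h R I(1,2) entries] by auto
  interpret K: normal K G by (rule K(1))
  let ?E = "G Mod K" and ?\<pi> = "\<lambda>x. K #> x"
  interpret \<pi>: group_hom G ?E ?\<pi> by (rule K.group_hom_factor)
  have surj: "?\<pi> ` carrier G = carrier ?E" by (simp add: carrier_FactGroup)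
  interpret EM: normal "?\<pi> ` H" ?E
    by (rule surj_hom_normal_subgroup[OF \<pi>.group_hom_axioms surj])
  have finE: "finite (carrier ?E)" using K(2) by (simp add: FactGroup_def)
  have cosets: "rcosets\<^bsub>?E\<^esub> (?\<pi> ` H) = (\<lambda>C. ?\<pi> ` C) ` (rcosets H)"
    by (rule \<pi>.rcosets_image[OF surj is_subgroup])
  have "card (rcosets\<^bsub>?E\<^esub> (?\<pi> ` H)) \<le> m" unfolding cosets m_def by (rule card_image_le[OF fin])
  moreover have "card (rcosets\<^bsub>?E\<^esub> (?\<pi> ` H)) > 0"
    using fin EM.subgroup_in_rcosets[OF K.factorgroup_is_group] cosets by (auto simp: card_gt_0_iff)
  ultimately have index: "\<not> q dvd card (rcosets\<^bsub>?E\<^esub> (?\<pi> ` H))"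
    using \<open>m < q\<close> by (auto dest: dvd_imp_le)
  have pow: "?\<pi> (x [^] i) = ?\<pi> x [^]\<^bsub>?E\<^esub> i" if "x \<in> carrier G" for x and i :: nat
    using \<pi>.hom_nat_pow[OF that] by simp
  have val: "word_value ?E w (\<lambda>i. ?\<pi> (g i)) = ?\<pi> ?v"
    using \<pi>.word_value_hom_image[OF g] .
  \<comment> \<open>The image of \<open>b [^] N\<close> in the finite quotient is a q-element: its
    power differs from 1 by a multiple of \<open>q\<close>, and \<open>q\<close> lies in
    \<open>I\<close>.\<close>
  have bpow: "b [^] (N * q ^ k) \<in> K"
  proof -
    obtain p :: "int poly" where p: "\<rho> b ^\<^sub>m (N * q ^ k) = 1\<^sub>m n + of_nat q \<cdot>\<^sub>m mat_poly n (map_poly of_int p) (\<rho> b)"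
      using unipotent_power[OF \<rho>f(1)[OF bc] unip] by blast
    have "mat_cong n I (\<rho> (b [^] (N * q ^ k))) (1\<^sub>m n)"
      unfolding mat_cong_def \<rho>f(4)[OF bc] p
    proof (intro allI impI)
      fix i j assume ij: "i < n" "j < n"
      have "mat_poly n (map_poly of_int p) (\<rho> b) $$ (i, j) \<in> R"
        using ij by (intro mat_poly_entries[OF \<rho>f(1)[OF bc]])
          (auto simp: is_subringD[OF R] entries bc coeff_map_poly)
      then have "of_nat q * mat_poly n (map_poly of_int p) (\<rho> b) $$ (i, j) \<in> I"
        using is_idealD(5)[OF R I(1) _ I(5)] by simp
      then show "(1\<^sub>m n + of_nat q \<cdot>\<^sub>m mat_poly n (map_poly of_int p) (\<rho> b)) $$ (i, j) - 1\<^sub>m n $$ (i, j) \<in> I"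
        using ij carrier_matD[OF mat_poly_carrier[OF \<rho>f(1)[OF bc]]] by simp
    qed
    then show ?thesis unfolding K_def using nat_pow_closed[OF bc] by blast
  qed
  \<comment> \<open>The value in the quotient is killed by \<open>l * N * q ^ k\<close>. Its order
    is prime to \<open>q\<close>, so the factor \<open>q ^ k\<close> can be removed.\<close>
  have "word_value ?E w (\<lambda>i. ?\<pi> (g i)) [^]\<^bsub>?E\<^esub> (l * N) = \<one>\<^bsub>?E\<^esub>"
  proof (rule EM.finite_marginal_coprime[OF finE _ I(4) index])
    show "marginal ?E w (?\<pi> ` H)" by (rule \<pi>.marginal_image[OF surj subset marg])
    show "range (\<lambda>i. ?\<pi> (g i)) \<subseteq> carrier ?E" using g \<pi>.hom_closed by (simp add: image_subset_iff)
    have "?v [^] (l * N * q ^ k) = b [^] (N * q ^ k)" using v by (simp add: b nat_pow_pow mult.assoc)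
    then have "?\<pi> (?v [^] (l * N * q ^ k)) = K" using bpow K.factor_eq_self_iff bc by simp
    then show "word_value ?E w (\<lambda>i. ?\<pi> (g i)) [^]\<^bsub>?E\<^esub> (l * N * q ^ k) = \<one>\<^bsub>?E\<^esub>"
      unfolding val pow[OF v] by simp
  qed
  then have "?\<pi> (?v [^] (l * N)) = K" unfolding val pow[OF v] by simp
  moreover have "?v [^] (l * N) = b [^] N" using v by (simp add: b nat_pow_pow)
  ultimately have "b [^] N \<in> K" using K.factor_eq_self_iff[of "b [^] N"] bc by simp
  then have "mat_cong n I (\<rho> (b [^] N)) (1\<^sub>m n)" unfolding K_def by blast
  then have "s \<in> I" unfolding mat_cong_def s_def using ij0(1,2) by blast
  then have "s * 1 \<in> I" by simp
  then show False using unit_mod_cancel[OF R I(1) units(1) _ one] I(3) by blast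
qed

lemma (in normal) marginal_value_torsion_fg:
  fixes \<rho> :: "'a \<Rightarrow> 'k::alg_closed_field mat"
  assumes \<rho>: "\<rho> \<in> mon G (GL TYPE('k) n)"
    and T: "carrier G = generate G T" "finite T" "T \<subseteq> carrier G"
    and fin: "finite (rcosets H)" and marg: "marginal G w H" and g: "range g \<subseteq> carrier G"
  shows "\<exists>e>0. word_value G w g [^] (e::nat) = \<one>"
proof -
  have \<rho>h: "\<rho> \<in> hom G (GL TYPE('k) n)" and \<rho>inj: "inj_on \<rho> (carrier G)" using \<rho> by (auto simp: mon_def)
  note \<rho>f = hom_GL_facts[OF \<rho>h]
  let ?v = "word_value G w g"
  have v: "?v \<in> carrier G" using word_value_closed[of g w] g by auto
  define j where "j = card (rcosets H)"
  have "j > 0" using fin subgroup_in_rcosets[OF is_group] by (auto simp: j_def card_gt_0_iff)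
  interpret Q: group "G Mod H" by (rule factorgroup_is_group)
  interpret \<pi>: group_hom G "G Mod H" "\<lambda>x. H #> x" by (rule group_hom_factor)
  have "(H #> ?v) [^]\<^bsub>G Mod H\<^esub> Coset.order (G Mod H) = \<one>\<^bsub>G Mod H\<^esub>"
    by (rule Q.pow_order_eq_1) (use \<pi>.hom_closed[OF v] in blast)
  then have "H #> (?v [^] j) = H"
    using \<pi>.hom_nat_pow[OF v, of j] by (simp add: j_def Coset.order_def FactGroup_def)
  then have vj: "?v [^] j \<in> H" using factor_eq_self_iff v by simp
  obtain e where e: "e > 0" "?v [^] (j * e) \<in> derived G H"
    using marginal_torsion_mod_derived[OF fin marg g vj] by blast
  define b where "b = ?v [^] (j * e)"
  have bc: "b \<in> carrier G" using v by (simp add: b_def)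
  have bD: "b \<in> derived G H" using e by (simp add: b_def)
  \<comment> \<open>\<open>H\<close> commutes with the value and hence with its power
    \<open>b\<close>. So \<open>b\<close> acts on its own eigenspaces together with all of
    \<open>H\<close>.\<close>
  have comm: "x \<otimes> b = b \<otimes> x" if x: "x \<in> H" for x
  proof -
    have xv: "x \<otimes> ?v = ?v \<otimes> x" by (rule marginal_commutes[OF marg g x])
    have xc: "x \<in> carrier G" using x by simp
    have "x \<otimes> ?v [^] i = ?v [^] i \<otimes> x" for i :: nat
    proof (induction i)
      case (Suc i)
      have "x \<otimes> ?v [^] Suc i = (x \<otimes> ?v [^] i) \<otimes> ?v" using xc v by (simp add: m_assoc)
      also have "\<dots> = ?v [^] i \<otimes> (x \<otimes> ?v)" unfolding Suc using xc v by (simp add: m_assoc)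
      also have "\<dots> = ?v [^] Suc i \<otimes> x" unfolding xv using xc v by (simp add: m_assoc)
      finally show ?case .
    qed (use xc in simp)
    then show ?thesis by (simp add: b_def)
  qed
  obtain p where p: "p \<noteq> 0" "mat_poly n p (\<rho> b) = 0\<^sub>m n n"
    "\<And>c. poly p c = 0 \<Longrightarrow> \<exists>u\<in>carrier_vec n. u \<noteq> 0\<^sub>v n \<and> \<rho> b *\<^sub>v u = c \<cdot>\<^sub>v u"
    using minimal_annihilating_poly[OF \<rho>f(1)[OF bc]] by blast
  have "\<exists>d>0. c ^ d = 1" if "poly p c = 0" for c
    using p(3)[OF that] eigenvalue_root_of_unity[OF is_subgroup \<rho>h bD comm] by blast
  then obtain f where f: "\<And>c. poly p c = 0 \<Longrightarrow> f c > (0::nat)" "\<And>c. poly p c = 0 \<Longrightarrow> c ^ f c = 1" by metis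
  \<comment> \<open>A common exponent for all eigenvalues, so each root of \<open>p\<close> is a
    root of \<open>monom 1 N - 1\<close>.\<close>
  define N where "N = prod f {c. poly p c = 0}"
  have fin_roots: "finite {c. poly p c = 0}" using p(1) by (rule poly_roots_finite)
  have "N > 0" unfolding N_def by (rule prod_pos) (use f(1) in auto)
  have "poly (monom 1 N - 1) c = 0" if c: "poly p c = 0" for c
  proof -
    have "f c dvd N" unfolding N_def using fin_roots c by (intro dvd_prodI) auto
    then obtain l where "N = f c * l" by (elim dvdE)
    then have "c ^ N = 1" using f(2)[OF c] by (simp add: power_mult)
    then show ?thesis by (simp add: poly_monom)
  qed
  then have "p dvd (monom 1 N - 1) ^ degree p" by (rule alg_closed_dvd_power[OF p(1)])
  then obtain r where r: "(monom 1 N - 1) ^ degree p = p * r" by (elim dvdE)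
  define k where "k = degree p"
  have unip: "mat_poly n ((monom 1 N - 1) ^ k) (\<rho> b) = 0\<^sub>m n n"
    unfolding k_def r mat_poly_mult[OF \<rho>f(1)[OF bc]] p(2)
    by (rule left_mult_zero_mat[OF mat_poly_carrier[OF \<rho>f(1)[OF bc]]])
  show ?thesis
  proof (cases "CHAR('k) = 0")
    case True
    have "b [^] N = \<one>"
      by (rule unipotent_marginal_value_trivial[OF True \<rho> T fin marg g b_def unip])
    then have "?v [^] (j * e * N) = \<one>" using v by (simp add: b_def nat_pow_pow)
    then show ?thesis using \<open>j > 0\<close> \<open>e > 0\<close> \<open>N > 0\<close> by (intro exI[of _ "j * e * N"]) simp
  next
    case False
    define q where "q = CHAR('k)"
    \<comment> \<open>Here \<open>q\<close> vanishes in the field, so the expansion of the power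
      leaves the identity matrix.\<close>
    have "(of_nat q :: 'k) = 0" by (simp add: q_def)
    obtain a :: "int poly" where a: "\<rho> b ^\<^sub>m (N * q ^ k) = 1\<^sub>m n + of_nat q \<cdot>\<^sub>m mat_poly n (map_poly of_int a) (\<rho> b)"
      using unipotent_power[OF \<rho>f(1)[OF bc] unip] by blast
    have "\<rho> (b [^] (N * q ^ k)) = \<rho> \<one>"
      unfolding \<rho>f(4)[OF bc] a \<rho>f(3) \<open>of_nat q = 0\<close>
      using carrier_matD[OF mat_poly_carrier[OF \<rho>f(1)[OF bc]]] by (intro eq_matI) simp_all
    then have "b [^] (N * q ^ k) = \<one>" using inj_onD[OF \<rho>inj] bc by auto
    then have "?v [^] (j * e * (N * q ^ k)) = \<one>" using v by (simp add: b_def nat_pow_pow)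
    moreover have "q > 0" using False by (simp add: q_def)
    ultimately show ?thesis using \<open>j > 0\<close> \<open>e > 0\<close> \<open>N > 0\<close>
      by (intro exI[of _ "j * e * (N * q ^ k)"]) simp
  qed
qed

section \<open>Functions of bounded degree on a linear group\<close>

lemma word_value_cong:
  "(\<And>i. i \<in> fst ` set w \<Longrightarrow> g i = h i) \<Longrightarrow> word_value G w g = word_value G w h"
proof (induction w)
  case (Cons a w)
  then show ?case by (simp add: word_value_def letter_value_def)
qed (simp add: word_value_def)

abbreviation fun_scale :: "'k::field \<Rightarrow> ('a \<Rightarrow> 'k) \<Rightarrow> 'a \<Rightarrow> 'k" where
  "fun_scale c f \<equiv> \<lambda>x. c * f x"

interpretation fun_space: vector_space fun_scale
  by unfold_locales (auto simp: algebra_simps plus_fun_def)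

lemma fun_space_sum_apply: "(\<Sum>i\<in>A. f i) x = (\<Sum>i\<in>A. (f i :: 'a \<Rightarrow> 'k::field) x)"
  by (induction A rule: infinite_finite_induct) (auto simp: zero_fun_def plus_fun_def)

lemma fun_space_span_sum:
  "(\<And>i. i \<in> A \<Longrightarrow> f i \<in> fun_space.span B) \<Longrightarrow> (\<lambda>x. \<Sum>i\<in>A. c i * f i x) \<in> fun_space.span B"
proof -
  assume f: "\<And>i. i \<in> A \<Longrightarrow> f i \<in> fun_space.span B"
  have "(\<Sum>i\<in>A. fun_scale (c i) (f i)) \<in> fun_space.span B"
    using f by (intro fun_space.span_sum fun_space.span_scale) auto
  moreover have "(\<Sum>i\<in>A. fun_scale (c i) (f i)) = (\<lambda>x. \<Sum>i\<in>A. c i * f i x)"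
    by (rule ext) (simp add: fun_space_sum_apply)
  ultimately show ?thesis by simp
qed

text \<open>In a finite-dimensional space of functions, the annihilators of the members of a family of sets
  cannot grow indefinitely.\<close>

lemma stable_annihilator:
  fixes B :: "('a \<Rightarrow> 'k::field) set"
  assumes fin: "finite B" and ne: "V1 \<in> \<V>"
  obtains V where "V \<in> \<V>"
    "\<forall>V'\<in>\<V>. \<forall>f\<in>fun_space.span B. V' \<subseteq> V \<longrightarrow> (\<forall>x\<in>V'. f x = 0) \<longrightarrow> (\<forall>x\<in>V. f x = 0)"
proof -
  define ann where "ann V = {f \<in> fun_space.span B. \<forall>x\<in>V. f x = 0}" for V
  \<comment> \<open>\<open>P c\<close> says that some member of the family has \<open>c\<close>
    independent annihilating functions. The dimension bounds \<open>c\<close>, and a member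
    attaining the maximum is the one wanted.\<close>
  define P where "P c \<longleftrightarrow> (\<exists>V\<in>\<V>. \<exists>C. C \<subseteq> ann V \<and> fun_space.independent C \<and> finite C \<and> card C = c)" for c
  have bound: "c \<le> card B" if "P c" for c
  proof -
    from that obtain V C where C: "C \<subseteq> ann V" "fun_space.independent C" "card C = c" by (auto simp: P_def)
    then have "C \<subseteq> fun_space.span B" by (auto simp: ann_def)
    then show ?thesis using fun_space.independent_span_bound[OF fin C(2)] C(3) by simp
  qed
  have "P 0" unfolding P_def using ne by (intro bexI[of _ V1] exI[of _ "{}"]) (auto simp: fun_space.independent_empty)
  then obtain c where c: "P c" "\<And>d. P d \<Longrightarrow> d \<le> c"
    using Greatest_le_nat[of P _ "card B"] GreatestI_nat[of P 0 "card B"] bound by metis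
  then obtain V C where VC: "V \<in> \<V>" "C \<subseteq> ann V" "fun_space.independent C" "finite C" "card C = c"
    by (auto simp: P_def)
  have "f x = 0" if V': "V' \<in> \<V>" "V' \<subseteq> V" and f: "f \<in> fun_space.span B" "\<And>x. x \<in> V' \<Longrightarrow> f x = 0" and x: "x \<in> V"
    for V' f x
  proof -
    \<comment> \<open>Otherwise \<open>f\<close> would enlarge \<open>C\<close>, because the
      functions in \<open>C\<close> vanish on the smaller set \<open>V'\<close> as well.\<close>
    have "f \<in> fun_space.span C"
    proof (rule ccontr)
      assume nf: "f \<notin> fun_space.span C"
      have "fun_space.independent (insert f C)" using fun_space.independent_insertI[OF nf VC(3)] .
      moreover have "insert f C \<subseteq> ann V'" using VC(2) V' f by (auto simp: ann_def)
      moreover have "f \<notin> C" using nf fun_space.span_base by blast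
      ultimately have "P (Suc c)" unfolding P_def using V' VC(4,5)
        by (intro bexI[of _ V'] exI[of _ "insert f C"]) auto
      then show False using c(2) by fastforce
    qed
    then show "f x = 0"
    proof (induction rule: fun_space.span_induct_alt)
      case base
      then show ?case by (simp add: zero_fun_def)
    next
      case (step d g h)
      have "g x = 0" using VC(2) step(1) x by (auto simp: ann_def)
      then show ?case using step by (simp add: plus_fun_def)
    qed
  qed
  then show thesis using that VC(1) by blast
qed

text \<open>Monomials of degree at most \<open>l\<close> in the functions from \<open>E\<close>. The
  monomial of degree 0 is the indicator of \<open>X\<close>, so all of them vanish off
  \<open>X\<close> and are determined by their values on the group.\<close>

fun coord_monomials :: "'a set \<Rightarrow> ('a \<Rightarrow> 'k::field) set \<Rightarrow> nat \<Rightarrow> ('a \<Rightarrow> 'k) set" where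
  "coord_monomials X E 0 = {\<lambda>x. if x \<in> X then 1 else 0}"
| "coord_monomials X E (Suc l) = coord_monomials X E l \<union>
     (\<lambda>(p, e). \<lambda>x. p x * e x) ` (coord_monomials X E l \<times> E)"

lemma finite_coord_monomials: "finite E \<Longrightarrow> finite (coord_monomials X E l)"
  by (induction l) auto

lemma coord_monomials_mono: "l \<le> l' \<Longrightarrow> coord_monomials X E l \<subseteq> coord_monomials X E l'"
  by (induction l' rule: nat_induct) (auto simp: le_Suc_eq)

lemma coord_monomials_outside: "f \<in> fun_space.span (coord_monomials X E l) \<Longrightarrow> x \<notin> X \<Longrightarrow> f x = 0"
proof (induction rule: fun_space.span_induct_alt)
  case base
  then show ?case by (simp add: zero_fun_def)
next
  case (step c p g)
  have "p x = 0" if "p \<in> coord_monomials X E l" for p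
    using that step.prems by (induction l arbitrary: p) auto
  then show ?case using step by (simp add: plus_fun_def)
qed

lemma coord_monomials_mult:
  assumes "f \<in> fun_space.span (coord_monomials X E l)" "e \<in> E"
  shows "(\<lambda>x. f x * e x) \<in> fun_space.span (coord_monomials X E (Suc l))"
  using assms(1)
proof (induction rule: fun_space.span_induct_alt)
  case base
  then show ?case using fun_space.span_zero by (simp add: zero_fun_def)
next
  case (step c p g)
  have "(\<lambda>x. p x * e x) \<in> coord_monomials X E (Suc l)" using step(1) assms(2) by auto
  then have "fun_scale c (\<lambda>x. p x * e x) + (\<lambda>x. g x * e x) \<in> fun_space.span (coord_monomials X E (Suc l))"
    by (rule fun_space.span_add[OF fun_space.span_scale[OF fun_space.span_base] step(2)])
  then show ?case by (simp add: plus_fun_def algebra_simps)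
qed

text \<open>The entries of the inverse are coordinates too, because words contain inverse
  letters.\<close>

definition coords :: "('a, 'm) monoid_scheme \<Rightarrow> ('a \<Rightarrow> 'k::field mat) \<Rightarrow> nat \<Rightarrow> ('a \<Rightarrow> 'k) set" where
  "coords G \<rho> n = (\<lambda>(i, j). \<lambda>x. \<rho> x $$ (i, j)) ` ({..<n} \<times> {..<n}) \<union>
    (\<lambda>(i, j). \<lambda>x. \<rho> (inv\<^bsub>G\<^esub> x) $$ (i, j)) ` ({..<n} \<times> {..<n})"

abbreviation coord_space :: "('a, 'm) monoid_scheme \<Rightarrow> ('a \<Rightarrow> 'k::field mat) \<Rightarrow> nat \<Rightarrow> nat \<Rightarrow> ('a \<Rightarrow> 'k) set" where
  "coord_space G \<rho> n l \<equiv> fun_space.span (coord_monomials (carrier G) (coords G \<rho> n) l)"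

definition translate :: "('a, 'm) monoid_scheme \<Rightarrow> 'a \<Rightarrow> ('a \<Rightarrow> 'k::field) \<Rightarrow> 'a \<Rightarrow> 'k" where
  "translate G g f = (\<lambda>x. if x \<in> carrier G then f (g \<otimes>\<^bsub>G\<^esub> x) else 0)"

lemma coords_intros:
  "i < n \<Longrightarrow> j < n \<Longrightarrow> (\<lambda>x. \<rho> x $$ (i, j)) \<in> coords G \<rho> n"
  "i < n \<Longrightarrow> j < n \<Longrightarrow> (\<lambda>x. \<rho> (inv\<^bsub>G\<^esub> x) $$ (i, j)) \<in> coords G \<rho> n"
  unfolding coords_def by force+

lemma finite_coords: "finite (coords G \<rho> n)"
  by (simp add: coords_def)

lemma (in group) hom_GL_mult_entry:
  assumes \<rho>: "\<rho> \<in> hom G (GL TYPE('k::field) n)" and "x \<in> carrier G" "y \<in> carrier G" "i < n" "j < n"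
  shows "\<rho> (x \<otimes> y) $$ (i, j) = (\<Sum>k<n. \<rho> x $$ (i, k) * \<rho> y $$ (k, j))"
  using assms hom_GL_facts(1,2)[OF \<rho>]
  by (simp add: scalar_prod_def atLeast0LessThan carrier_matD[OF hom_GL_facts(1)[OF \<rho>]])

text \<open>Entries of \<open>\<rho> (g \<otimes> x)\<close> are linear combinations of entries of
  \<open>\<rho> x\<close>, and likewise for inverses, so translation does not raise the
  degree.\<close>

lemma (in group) translate_coord_space:
  assumes \<rho>: "\<rho> \<in> hom G (GL TYPE('k::field) n)" and g: "g \<in> carrier G"
    and f: "f \<in> coord_space G \<rho> n l"
  shows "translate G g f \<in> coord_space G \<rho> n l"
proof -
  have gen: "translate G g p \<in> coord_space G \<rho> n l" if "p \<in> coord_monomials (carrier G) (coords G \<rho> n) l" for p l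
    using that
  proof (induction l arbitrary: p)
    case 0
    then have "translate G g p = p" using g by (auto simp: translate_def)
    then show ?case using 0 by (simp add: fun_space.span_base)
  next
    case (Suc l)
    let ?P = "coord_monomials (carrier G) (coords G \<rho> n)"
    have mono: "fun_space.span (?P l) \<subseteq> fun_space.span (?P (Suc l))"
      by (intro fun_space.span_mono coord_monomials_mono) simp
    consider "p \<in> ?P l" | q e where "q \<in> ?P l" "e \<in> coords G \<rho> n" "p = (\<lambda>x. q x * e x)"
      using Suc.prems by auto
    then show ?case
    proof cases
      case 1
      then show ?thesis using Suc.IH mono by blast
    next
      case 2
      note IH = Suc.IH[OF 2(1)]
      have step: "(\<lambda>x. \<Sum>k<n. c k * (translate G g q x * d k x)) \<in> fun_space.span (?P (Suc l))"
        if "\<And>k. k < n \<Longrightarrow> d k \<in> coords G \<rho> n" for c d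
        using that IH by (intro fun_space_span_sum coord_monomials_mult) auto
      from 2(2) consider i j where "i < n" "j < n" "e = (\<lambda>x. \<rho> x $$ (i, j))"
        | i j where "i < n" "j < n" "e = (\<lambda>x. \<rho> (inv x) $$ (i, j))"
        by (auto simp: coords_def)
      then show ?thesis
      proof cases
        case e: 1
        have "translate G g p = (\<lambda>x. \<Sum>k<n. \<rho> g $$ (i, k) * (translate G g q x * \<rho> x $$ (k, j)))"
          unfolding 2(3) e(3) using g e(1,2)
          by (intro ext) (auto simp: translate_def hom_GL_mult_entry[OF \<rho>] sum_distrib_left ac_simps)
        then show ?thesis using step[of "\<lambda>k x. \<rho> x $$ (k, j)" "\<lambda>k. \<rho> g $$ (i, k)"] e(2) by (simp add: coords_intros)
      next
        case e: 2
        have "translate G g p = (\<lambda>x. \<Sum>k<n. \<rho> (inv g) $$ (k, j) * (translate G g q x * \<rho> (inv x) $$ (i, k)))"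
          unfolding 2(3) e(3) using g e(1,2)
          by (intro ext) (auto simp: translate_def hom_GL_mult_entry[OF \<rho>] inv_mult_group sum_distrib_left ac_simps)
        then show ?thesis using step[of "\<lambda>k x. \<rho> (inv x) $$ (i, k)" "\<lambda>k. \<rho> (inv g) $$ (k, j)"] e(1) by (simp add: coords_intros)
      qed
    qed
  qed
  show ?thesis using f
  proof (induction rule: fun_space.span_induct_alt)
    case base
    have "translate G g 0 = (0 :: 'a \<Rightarrow> 'k)" by (auto simp: translate_def zero_fun_def)
    then show ?case using fun_space.span_zero by metis
  next
    case (step c p h)
    have "translate G g (fun_scale c p + h) = fun_scale c (translate G g p) + translate G g h"
      by (auto simp: translate_def plus_fun_def)
    then show ?case
      using fun_space.span_add[OF fun_space.span_scale[OF gen[OF step(1)]] step(2)] by metis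
  qed
qed

text \<open>With all variables but one fixed, each letter contributes a factor that is constant or
  linear in the entries of \<open>x\<close> or of its inverse. Hence the degree is at most the
  length of \<open>w\<close>.\<close>

lemma (in group) word_value_coord_space:
  assumes \<rho>: "\<rho> \<in> hom G (GL TYPE('k::field) n)" and h: "\<And>a. a \<in> set w \<Longrightarrow> h (fst a) \<in> carrier G"
    and "r < n" "s < n"
  shows "(\<lambda>x. if x \<in> carrier G then \<rho> (word_value G w (h(i := x))) $$ (r, s) else 0) \<in> coord_space G \<rho> n (length w)"
  using assms(2-4)
proof (induction w arbitrary: r s)
  case Nil
  have "fun_scale (1\<^sub>m n $$ (r, s)) (\<lambda>x. if x \<in> carrier G then 1 else 0 :: 'k) \<in> coord_space G \<rho> n 0"
    by (intro fun_space.span_scale fun_space.span_base) simp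
  then show ?case using hom_GL_facts(3)[OF \<rho>] by (simp add: word_value_def if_distrib cong: if_cong)
next
  case (Cons a w)
  let ?P = "coord_monomials (carrier G) (coords G \<rho> n)"
  let ?f = "\<lambda>r x. if x \<in> carrier G then \<rho> (word_value G w (h(i := x))) $$ (r, s) else 0"
  have mono: "fun_space.span (?P (length w)) \<subseteq> fun_space.span (?P (Suc (length w)))"
    by (intro fun_space.span_mono coord_monomials_mono) simp
  have IH: "?f r \<in> coord_space G \<rho> n (length w)" if "r < n" for r using Cons.IH[of r s] Cons.prems that by simp
  have closed: "word_value G w (h(i := x)) \<in> carrier G" if "x \<in> carrier G" for x
    using Cons.prems that by (intro word_value_closed) auto
  have lc: "letter_value G (h(i := x)) a \<in> carrier G" if "x \<in> carrier G" for x
    using Cons.prems that by (intro letter_value_closed) auto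
  have expand: "(\<lambda>x. if x \<in> carrier G then \<rho> (word_value G (a # w) (h(i := x))) $$ (r, s) else 0)
      = (\<lambda>x. \<Sum>k<n. \<rho> (letter_value G (h(i := x)) a) $$ (r, k) * ?f k x)"
    using closed lc Cons.prems by (intro ext) (auto simp: word_value_def hom_GL_mult_entry[OF \<rho>])
  show ?case
  proof (cases "fst a = i")
    case False
    define c where "c = letter_value G h a"
    have "letter_value G (h(i := x)) a = c" for x using False by (simp add: letter_value_def c_def)
    then have "(\<lambda>x. \<Sum>k<n. \<rho> (letter_value G (h(i := x)) a) $$ (r, k) * ?f k x) = (\<lambda>x. \<Sum>k<n. \<rho> c $$ (r, k) * ?f k x)"
      by simp
    moreover have "(\<lambda>x. \<Sum>k<n. \<rho> c $$ (r, k) * ?f k x) \<in> fun_space.span (?P (Suc (length w)))"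
      using IH mono by (intro fun_space_span_sum) auto
    ultimately show ?thesis unfolding expand by simp
  next
    case True
    define e where "e k = (\<lambda>x. \<rho> (if snd a then x else inv x) $$ (r, k))" for k
    have e: "e k \<in> coords G \<rho> n" if "k < n" for k
      using that Cons.prems by (cases "snd a") (auto simp: e_def coords_intros)
    have "(\<lambda>x. \<Sum>k<n. \<rho> (letter_value G (h(i := x)) a) $$ (r, k) * ?f k x) = (\<lambda>x. \<Sum>k<n. 1 * (?f k x * e k x))"
      using True by (intro ext sum.cong refl) (auto simp: letter_value_def e_def)
    moreover have "(\<lambda>x. \<Sum>k<n. 1 * (?f k x * e k x)) \<in> fun_space.span (?P (Suc (length w)))"
      using IH e by (intro fun_space_span_sum coord_monomials_mult) auto
    ultimately show ?thesis unfolding expand by simp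
  qed
qed

section \<open>Compact groups\<close>

context profinite_group
begin

lemma continuous_map_mult:
  assumes "continuous_map Z T f" "continuous_map Z T g"
  shows "continuous_map Z T (\<lambda>x. f x \<otimes> g x)"
  using continuous_map_compose[OF continuous_map_pairedI[OF assms] continuous_mult] by (simp add: o_def)

lemma continuous_map_inverse:
  assumes "continuous_map Z T f"
  shows "continuous_map Z T (\<lambda>x. inv (f x))"
  using continuous_map_compose[OF assms continuous_inv] by (simp add: o_def)

lemma open_subset_carrier: "openin T V \<Longrightarrow> V \<subseteq> carrier G"
  using openin_subset topspace_eq by metis

lemma openin_preimage:
  assumes "continuous_map T T f" "openin T V"
  shows "openin T {x \<in> carrier G. f x \<in> V}"
  using openin_continuous_map_preimage[OF assms] by (simp add: topspace_eq)

lemma continuous_map_constant: "g \<in> carrier G \<Longrightarrow> continuous_map Z T (\<lambda>_. g)"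
  by (simp add: topspace_eq)

lemma continuous_map_ident: "continuous_map T T (\<lambda>x. x)"
  using continuous_map_id by (simp add: id_def)

lemma open_subgroupI:
  assumes K: "subgroup K G" and U: "openin T U" "\<one> \<in> U" "U \<subseteq> K"
  shows "openin T K"
proof (subst openin_subopen, intro ballI)
  fix x assume x: "x \<in> K"
  have xc: "x \<in> carrier G" using subgroup.mem_carrier[OF K x] .
  let ?V = "{y \<in> carrier G. inv x \<otimes> y \<in> U}"
  have "openin T ?V"
    using xc by (intro openin_preimage continuous_map_mult continuous_map_constant continuous_map_ident U(1)) simp_all
  moreover have "x \<in> ?V" using xc U(2) by simp
  moreover have "?V \<subseteq> K"
  proof
    fix y assume "y \<in> ?V"
    then have y: "y \<in> carrier G" "inv x \<otimes> y \<in> K" using U(3) by auto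
    then have "x \<otimes> (inv x \<otimes> y) \<in> K" using subgroup.m_closed[OF K x] by blast
    then show "y \<in> K" using xc y(1) by (simp add: inv_mult_cancel)
  qed
  ultimately show "\<exists>V. openin T V \<and> x \<in> V \<and> V \<subseteq> K" by blast
qed

text \<open>The cosets form a disjoint open cover, so by compactness there are finitely many, and
  the complement of one is the union of the others.\<close>

lemma open_subgroup_cosets:
  assumes K: "subgroup K G" and op: "openin T K"
  shows "finite (rcosets K)" "\<And>C. C \<in> rcosets K \<Longrightarrow> openin T C" "\<And>C. C \<in> rcosets K \<Longrightarrow> closedin T C"
proof -
  show coset_open: "openin T C" if C: "C \<in> rcosets K" for C
  proof -
    obtain g where g: "g \<in> carrier G" "C = K #> g" using C by (auto simp: RCOSETS_def)
    have "K #> g = {x \<in> carrier G. x \<otimes> inv g \<in> K}"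
    proof
      show "K #> g \<subseteq> {x \<in> carrier G. x \<otimes> inv g \<in> K}"
        using g(1) subgroup.mem_carrier[OF K] by (auto simp: r_coset_def m_assoc)
      show "{x \<in> carrier G. x \<otimes> inv g \<in> K} \<subseteq> K #> g"
      proof
        fix x assume x: "x \<in> {x \<in> carrier G. x \<otimes> inv g \<in> K}"
        then have "x = (x \<otimes> inv g) \<otimes> g" using g(1) by (simp add: m_assoc)
        then show "x \<in> K #> g" using x unfolding r_coset_def by blast
      qed
    qed
    moreover have "openin T {x \<in> carrier G. x \<otimes> inv g \<in> K}"
      using g(1) by (intro openin_preimage continuous_map_mult continuous_map_constant continuous_map_ident op) simp_all
    ultimately show ?thesis using g(2) by simp
  qed
  have union: "\<Union>(rcosets K) = carrier G" by (rule rcosets_part_G[OF K])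
  have disj: "C = D" if "C \<in> rcosets K" "D \<in> rcosets K" "x \<in> C" "x \<in> D" for C D x
    using rcos_disjoint[OF K] that by (auto simp: pairwise_def disjnt_def)
  have "(\<forall>U\<in>rcosets K. openin T U) \<and> carrier G \<subseteq> \<Union>(rcosets K) \<longrightarrow>
      (\<exists>\<F>. finite \<F> \<and> \<F> \<subseteq> rcosets K \<and> carrier G \<subseteq> \<Union>\<F>)"
    using compact unfolding compact_space_alt topspace_eq by (rule spec)
  then obtain \<F> where \<F>: "finite \<F>" "\<F> \<subseteq> rcosets K" "carrier G \<subseteq> \<Union>\<F>"
    using coset_open union by auto
  have "rcosets K \<subseteq> \<F>"
  proof
    fix C assume C: "C \<in> rcosets K"
    then obtain x where x: "x \<in> C" using subgroup.rcosets_non_empty[OF K C] by blast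
    then have "x \<in> carrier G" using C union by blast
    then obtain D where "D \<in> \<F>" "x \<in> D" using \<F>(3) by blast
    then show "C \<in> \<F>" using disj[OF C _ x] \<F>(2) by blast
  qed
  then show "finite (rcosets K)" using \<F>(1) finite_subset by blast
  show "closedin T C" if C: "C \<in> rcosets K" for C
  proof -
    have "carrier G - C = \<Union>(rcosets K - {C})"
    proof
      show "carrier G - C \<subseteq> \<Union>(rcosets K - {C})" using union by auto
      show "\<Union>(rcosets K - {C}) \<subseteq> carrier G - C"
      proof
        fix x assume "x \<in> \<Union>(rcosets K - {C})"
        then obtain D where D: "D \<in> rcosets K" "D \<noteq> C" "x \<in> D" by blast
        then have "x \<in> carrier G" using union by blast
        moreover have "x \<notin> C" using disj[OF D(1) C D(3)] D(2) by blast
        ultimately show "x \<in> carrier G - C" by blast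
      qed
    qed
    then have "openin T (carrier G - C)" using coset_open by (auto intro: openin_Union)
    moreover have "C \<subseteq> carrier G" using union C by blast
    ultimately show ?thesis by (simp add: closedin_def topspace_eq)
  qed
qed

text \<open>The intersection of all conjugates is open because a conjugate depends only on a coset
  of \<open>K\<close>, and there are finitely many cosets.\<close>

lemma open_normal_core:
  assumes K: "subgroup K G" and op: "openin T K"
  obtains N where "N \<lhd> G" "openin T N" "N \<subseteq> K"
proof -
  note Kc = subgroup.mem_carrier[OF K]
  define N where "N = {x \<in> carrier G. \<forall>g\<in>carrier G. g \<otimes> x \<otimes> inv g \<in> K}"
  have sub: "subgroup N G"
  proof
    show "N \<subseteq> carrier G" by (auto simp: N_def)
    show "\<one> \<in> N" using subgroup.one_closed[OF K] by (simp add: N_def)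
    show "x \<otimes> y \<in> N" if xy: "x \<in> N" "y \<in> N" for x y
    proof -
      have c: "x \<in> carrier G" "y \<in> carrier G" using xy by (auto simp: N_def)
      have "g \<otimes> (x \<otimes> y) \<otimes> inv g \<in> K" if g: "g \<in> carrier G" for g
      proof -
        have "g \<otimes> (x \<otimes> y) \<otimes> inv g = (g \<otimes> x \<otimes> inv g) \<otimes> (g \<otimes> y \<otimes> inv g)"
          using g c by (simp add: m_assoc inv_mult_cancel)
        then show ?thesis using xy g subgroup.m_closed[OF K] by (simp add: N_def)
      qed
      then show ?thesis using c by (simp add: N_def)
    qed
    show "inv x \<in> N" if x: "x \<in> N" for x
    proof -
      have c: "x \<in> carrier G" using x by (auto simp: N_def)
      have "g \<otimes> inv x \<otimes> inv g \<in> K" if g: "g \<in> carrier G" for g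
      proof -
        have "g \<otimes> inv x \<otimes> inv g = inv (g \<otimes> x \<otimes> inv g)"
          using g c by (simp add: m_assoc inv_mult_group)
        then show ?thesis using x g subgroup.m_inv_closed[OF K] by (simp add: N_def)
      qed
      then show ?thesis using c by (simp add: N_def)
    qed
  qed
  have "N \<lhd> G"
    unfolding normal_inv_iff
  proof (intro conjI ballI sub)
    fix a x assume a: "a \<in> carrier G" and x: "x \<in> N"
    have c: "x \<in> carrier G" using x by (auto simp: N_def)
    have "g \<otimes> (a \<otimes> x \<otimes> inv a) \<otimes> inv g \<in> K" if g: "g \<in> carrier G" for g
    proof -
      have "g \<otimes> (a \<otimes> x \<otimes> inv a) \<otimes> inv g = (g \<otimes> a) \<otimes> x \<otimes> inv (g \<otimes> a)"
        using g a c by (simp add: m_assoc inv_mult_group)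
      then show ?thesis using x g a by (simp add: N_def)
    qed
    then show "a \<otimes> x \<otimes> inv a \<in> N" using a c by (simp add: N_def)
  qed
  moreover have "openin T N"
  proof -
    define t where "t C = (SOME x. x \<in> C)" for C :: "'a set"
    have t: "t C \<in> C" if "C \<in> rcosets K" for C
      using subgroup.rcosets_non_empty[OF K that] unfolding t_def by (meson ex_in_conv someI_ex)
    have tc: "t C \<in> carrier G" if "C \<in> rcosets K" for C
      using t[OF that] rcosets_part_G[OF K] that by blast
    define U where "U C = {x \<in> carrier G. t C \<otimes> x \<otimes> inv (t C) \<in> K}" for C
    have "openin T (U C)" if "C \<in> rcosets K" for C
      unfolding U_def using tc[OF that]
      by (intro openin_preimage continuous_map_mult continuous_map_constant continuous_map_ident op) simp_all
    then have "openin T ((\<Inter>C\<in>rcosets K. U C) \<inter> topspace T)"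
      by (rule openin_INT[OF open_subgroup_cosets(1)[OF K op]])
    moreover have "(\<Inter>C\<in>rcosets K. U C) \<inter> topspace T = N"
    proof
      show "N \<subseteq> (\<Inter>C\<in>rcosets K. U C) \<inter> topspace T" using tc by (auto simp: N_def U_def topspace_eq)
      show "(\<Inter>C\<in>rcosets K. U C) \<inter> topspace T \<subseteq> N"
      proof
        fix x assume x: "x \<in> (\<Inter>C\<in>rcosets K. U C) \<inter> topspace T"
        then have xc: "x \<in> carrier G" by (simp add: topspace_eq)
        have "g \<otimes> x \<otimes> inv g \<in> K" if g: "g \<in> carrier G" for g
        proof -
          have C: "K #> g \<in> rcosets K" using g by (auto simp: RCOSETS_def)
          then obtain y where y: "y \<in> K" "t (K #> g) = y \<otimes> g" using t[OF C] by (auto simp: r_coset_def)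
          have yc: "y \<in> carrier G" using Kc[OF y(1)] .
          have "(y \<otimes> g) \<otimes> x \<otimes> inv (y \<otimes> g) \<in> K" using x C y(2) by (auto simp: U_def)
          then have "inv y \<otimes> ((y \<otimes> g) \<otimes> x \<otimes> inv (y \<otimes> g)) \<otimes> y \<in> K"
            using y(1) by (simp add: subgroup.m_closed[OF K] subgroup.m_inv_closed[OF K])
          also have "inv y \<otimes> ((y \<otimes> g) \<otimes> x \<otimes> inv (y \<otimes> g)) \<otimes> y = g \<otimes> x \<otimes> inv g"
            using yc g xc by (simp add: m_assoc inv_mult_group inv_mult_cancel)
          finally show ?thesis .
        qed
        then show "x \<in> N" using xc by (simp add: N_def)
      qed
    qed
    ultimately show ?thesis by simp
  qed
  moreover have "N \<subseteq> K"
  proof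
    fix x assume "x \<in> N"
    then have x: "x \<in> carrier G" "\<forall>g\<in>carrier G. g \<otimes> x \<otimes> inv g \<in> K" unfolding N_def by blast+
    have "\<one> \<otimes> x \<otimes> inv \<one> \<in> K" by (rule bspec[OF x(2) one_closed])
    then show "x \<in> K" using x(1) by simp
  qed
  ultimately show thesis using that by blast
qed

text \<open>\<open>M\<close> plays the role of the identity component for the Zariski topology in bounded degree.\<close>

lemma zariski_component:
  assumes \<rho>: "\<rho> \<in> hom G (GL TYPE('k::field) n)"
  obtains M where "M \<lhd> G" "openin T M"
    "\<forall>V. openin T V \<longrightarrow> \<one> \<in> V \<longrightarrow> (\<forall>f\<in>coord_space G \<rho> n l. (\<forall>y\<in>V. f y = 0) \<longrightarrow> (\<forall>x\<in>M. f x = 0))"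
proof -
  let ?B = "coord_monomials (carrier G) (coords G \<rho> n) l"
  let ?\<V> = "{V. openin T V \<and> \<one> \<in> V}"
  have finB: "finite ?B" by (intro finite_coord_monomials finite_coords)
  have topV: "carrier G \<in> ?\<V>" using openin_topspace[of T] by (simp add: topspace_eq)
  \<comment> \<open>A neighbourhood of \<open>\<one>\<close> whose annihilator \<open>A\<close> no
    longer grows when the neighbourhood shrinks.\<close>
  obtain V0 where V0_mem: "V0 \<in> ?\<V>"
    and V0_stable: "\<forall>V'\<in>?\<V>. \<forall>f\<in>coord_space G \<rho> n l. V' \<subseteq> V0 \<longrightarrow> (\<forall>x\<in>V'. f x = 0) \<longrightarrow> (\<forall>x\<in>V0. f x = 0)"
    by (rule stable_annihilator[OF finB topV])
  have stable: "f x = 0" if "V' \<in> ?\<V>" "V' \<subseteq> V0" "f \<in> coord_space G \<rho> n l" "\<And>x. x \<in> V' \<Longrightarrow> f x = 0" "x \<in> V0"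
    for V' f x
    using V0_stable[rule_format, OF that(1,3,2,4,5)] .
  have V0: "openin T V0" "\<one> \<in> V0" using V0_mem by auto
  define A where "A = {f \<in> coord_space G \<rho> n l. \<forall>x\<in>V0. f x = 0}"
  \<comment> \<open>The stabilizer of \<open>A\<close> under translations, written as an equivalence
    so that inverses are included.\<close>
  define M where "M = {g \<in> carrier G. \<forall>f\<in>coord_space G \<rho> n l. f \<in> A \<longleftrightarrow> translate G g f \<in> A}"
  have tr: "translate G g f \<in> coord_space G \<rho> n l" if "g \<in> carrier G" "f \<in> coord_space G \<rho> n l" for g f
    by (rule translate_coord_space[OF \<rho> that])
  have tr_mult: "translate G (g \<otimes> h) f = translate G h (translate G g f)"
    if "g \<in> carrier G" "h \<in> carrier G" for g h and f :: "'a \<Rightarrow> 'k"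
    using that by (auto simp: translate_def m_assoc)
  have tr_one: "translate G \<one> f = f" if "f \<in> coord_space G \<rho> n l" for f
    using coord_monomials_outside[OF that] by (auto simp: translate_def)
  have sub: "subgroup M G"
  proof
    show "M \<subseteq> carrier G" by (auto simp: M_def)
    show "\<one> \<in> M" using tr_one by (simp add: M_def)
    show "g \<otimes> h \<in> M" if gh: "g \<in> M" "h \<in> M" for g h
    proof -
      have c: "g \<in> carrier G" "h \<in> carrier G" using gh by (auto simp: M_def)
      have "f \<in> A \<longleftrightarrow> translate G (g \<otimes> h) f \<in> A" if f: "f \<in> coord_space G \<rho> n l" for f
      proof -
        have "f \<in> A \<longleftrightarrow> translate G g f \<in> A" using gh(1) f unfolding M_def by blast
        also have "\<dots> \<longleftrightarrow> translate G h (translate G g f) \<in> A"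
          using gh(2) tr[OF c(1) f] unfolding M_def by blast
        finally show ?thesis using tr_mult[OF c] by simp
      qed
      then show ?thesis using c by (simp add: M_def)
    qed
    show "inv g \<in> M" if g: "g \<in> M" for g
    proof -
      have gc: "g \<in> carrier G" using g by (simp add: M_def)
      have "f \<in> A \<longleftrightarrow> translate G (inv g) f \<in> A" if f: "f \<in> coord_space G \<rho> n l" for f
      proof -
        have "translate G g (translate G (inv g) f) = f"
          using tr_mult[of "inv g" g f] gc tr_one[OF f] by simp
        moreover have "translate G (inv g) f \<in> A \<longleftrightarrow> translate G g (translate G (inv g) f) \<in> A"
          using g tr[OF inv_closed[OF gc] f] unfolding M_def by blast
        ultimately show ?thesis by simp
      qed
      then show ?thesis using gc by (simp add: M_def)
    qed
  qed
  \<comment> \<open>The translate vanishes on a smaller neighbourhood of \<open>\<one>\<close>,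
    hence on \<open>V0\<close> by stability.\<close>
  have half: "translate G g f \<in> A" if g: "g \<in> V0" and f: "f \<in> A" for g f
  proof -
    have gc: "g \<in> carrier G" using g open_subset_carrier[OF V0(1)] by blast
    let ?W = "V0 \<inter> {x \<in> carrier G. g \<otimes> x \<in> V0}"
    have "openin T ?W" using gc
      by (intro openin_Int V0 openin_preimage continuous_map_mult continuous_map_constant continuous_map_ident) simp_all
    moreover have "\<one> \<in> ?W" using g gc V0(2) by simp
    moreover have fs: "translate G g f \<in> coord_space G \<rho> n l" using tr[OF gc] f by (simp add: A_def)
    moreover have "translate G g f x = 0" if "x \<in> ?W" for x using that f by (simp add: A_def translate_def)
    ultimately have "translate G g f x = 0" if "x \<in> V0" for x
      using stable[of ?W "translate G g f" x] that by simp
    then show ?thesis using fs by (simp add: A_def)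
  qed
  let ?U = "V0 \<inter> {g \<in> carrier G. inv g \<in> V0}"
  have "openin T ?U"
    by (intro openin_Int V0 openin_preimage continuous_map_inverse continuous_map_ident)
  moreover have "\<one> \<in> ?U" using V0(2) by simp
  moreover have "?U \<subseteq> M"
  proof
    fix g assume g: "g \<in> ?U"
    then have gc: "g \<in> carrier G" by simp
    have "f \<in> A \<longleftrightarrow> translate G g f \<in> A" if f: "f \<in> coord_space G \<rho> n l" for f
    proof
      show "translate G g f \<in> A" if "f \<in> A" using half g that by blast
      assume "translate G g f \<in> A"
      then have "translate G (inv g) (translate G g f) \<in> A" using half g by blast
      then show "f \<in> A" using tr_mult[of g "inv g" f] gc tr_one[OF f] by simp
    qed
    then show "g \<in> M" using gc by (simp add: M_def)
  qed
  ultimately have op: "openin T M" by (rule open_subgroupI[OF sub])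
  \<comment> \<open>A function vanishing near \<open>\<one>\<close> belongs to \<open>A\<close>. Its
    translate by \<open>x\<close> does so too, and the value of the translate at
    \<open>\<one>\<close> is \<open>f x\<close>.\<close>
  have vanish: "f x = 0" if V: "openin T V" "\<one> \<in> V" and f: "f \<in> coord_space G \<rho> n l" "\<And>y. y \<in> V \<Longrightarrow> f y = 0"
    and x: "x \<in> M" for V f x
  proof -
    have "f y = 0" if "y \<in> V0" for y
      by (rule stable[of "V \<inter> V0" f y]) (use V V0 f that in auto)
    then have "f \<in> A" using f by (simp add: A_def)
    then have "translate G x f \<in> A" using x f(1) by (simp add: M_def)
    then have "translate G x f \<one> = 0" using V0(2) by (simp add: A_def)
    then show ?thesis using x by (simp add: translate_def M_def)
  qed
  obtain N where "N \<lhd> G" "openin T N" "N \<subseteq> M" using open_normal_core[OF sub op] by blast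
  then show thesis by (intro that) (use vanish in blast)+
qed

section \<open>Continuity of the word map and its constancy on products of cosets\<close>

lemma continuous_map_word_value:
  assumes "fst ` set w \<subseteq> {..<k}"
  shows "continuous_map (product_topology (\<lambda>_. T) {..<k}) T (word_value G w)"
  using assms
proof (induction w)
  case Nil
  have "word_value G [] = (\<lambda>_. \<one>)" by (rule ext) (simp add: word_value_def)
  then show ?case using continuous_map_constant[OF one_closed] by simp
next
  case (Cons a w)
  have "continuous_map (product_topology (\<lambda>_. T) {..<k}) T (\<lambda>g. g (fst a))"
    using Cons.prems by (intro continuous_map_product_projection) auto
  then have "continuous_map (product_topology (\<lambda>_. T) {..<k}) T (\<lambda>g. letter_value G g a)"
    using continuous_map_inverse by (cases "snd a") (simp_all add: letter_value_def)
  moreover have "word_value G (a # w) = (\<lambda>g. letter_value G g a \<otimes> word_value G w g)"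
    by (rule ext) (simp add: word_value_def)
  ultimately show ?case using continuous_map_mult Cons by simp
qed

lemma word_constant_on_cosets:
  assumes \<rho>: "\<rho> \<in> mon G (GL TYPE('k::field) n)" and w: "fst ` set w \<subseteq> {..<k}"
    and small: "word_values G k w \<prec> (UNIV :: nat set set)"
    and M: "M \<lhd> G" "openin T M"
    and zar: "\<forall>V. openin T V \<longrightarrow> \<one> \<in> V \<longrightarrow>
      (\<forall>f\<in>coord_space G \<rho> n (length w). (\<forall>y\<in>V. f y = 0) \<longrightarrow> (\<forall>x\<in>M. f x = 0))"
    and C: "\<And>i. i < k \<Longrightarrow> C i \<in> rcosets M"
    and gh: "g \<in> {..<k} \<rightarrow>\<^sub>E carrier G" "h \<in> {..<k} \<rightarrow>\<^sub>E carrier G" "\<And>i. i < k \<Longrightarrow> g i \<in> C i" "\<And>i. i < k \<Longrightarrow> h i \<in> C i"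
  shows "word_value G w g = word_value G w h"
proof -
  interpret M: normal M G by (rule M(1))
  have \<rho>h: "\<rho> \<in> hom G (GL TYPE('k) n)" and \<rho>inj: "inj_on \<rho> (carrier G)" using \<rho> by (auto simp: mon_def)
  let ?X = "product_topology (\<lambda>_. T) {..<k}"
  let ?D = "Pi\<^sub>E {..<k} C"
  note cosets = open_subgroup_cosets[OF M.is_subgroup M(2)]
  have Cc: "C i \<subseteq> carrier G" if "i < k" for i using open_subset_carrier[OF cosets(2)[OF C[OF that]]] .
  have gD: "g \<in> ?D" using gh(1,3) by (auto simp: PiE_iff)
  have hD: "h \<in> ?D" using gh(2,4) by (auto simp: PiE_iff)
  have cont: "continuous_map ?X T (word_value G w)" by (rule continuous_map_word_value[OF w])
  have "closedin ?X ?D" using cosets(3) C by (simp add: closedin_product_topology)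
  moreover have "compact_space ?X" using compact by (simp add: compact_space_product_topology)
  ultimately have "compactin ?X ?D" using closedin_compact_space by blast
  then have compS: "compactin T (word_value G w ` ?D)" using image_compactin cont by blast
  let ?S = "word_value G w ` ?D"
  have closedS: "closedin T ?S" by (rule compactin_imp_closedin[OF Hausdorff compS])
  \<comment> \<open>A nonempty perfect set in a locally compact Hausdorff space has at least
    continuum many points, which \<open>small\<close> forbids.\<close>
  have "T derived_set_of ?S \<noteq> ?S"
  proof
    assume perfect: "T derived_set_of ?S = ?S"
    have "?S \<noteq> {}" using gD by blast
    then have "(UNIV :: real set) \<lesssim> ?S"
      using lepoll_perfect_set[OF _ perfect] compact_imp_locally_compact_space[OF compact] Hausdorff by blast
    moreover have "?S \<subseteq> word_values G k w"
    proof -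
      have "?D \<subseteq> {..<k} \<rightarrow>\<^sub>E carrier G" using Cc by (intro PiE_mono) auto
      then show ?thesis by (auto simp: word_values_def)
    qed
    then have "?S \<lesssim> word_values G k w" by (rule subset_imp_lepoll)
    moreover have "(UNIV :: nat set set) \<lesssim> (UNIV :: real set)" using nat_sets_eqpoll_reals eqpoll_imp_lepoll by blast
    ultimately have "(UNIV :: nat set set) \<lesssim> word_values G k w" by (meson lepoll_trans)
    then show False using small by (meson lesspoll_def lepoll_antisym)
  qed
  then obtain c where c: "c \<in> ?S" "c \<notin> T derived_set_of ?S"
    using closedS by (auto simp: closedin_contains_derived_set)
  have "c \<in> topspace T" using c(1) compS compactin_subset_topspace by blast
  then obtain O' where O': "openin T O'" "c \<in> O'" "\<And>y. y \<in> ?S \<Longrightarrow> y \<in> O' \<Longrightarrow> y = c"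
    using c(2) by (auto simp: in_derived_set_of)
  obtain h0 where h0: "h0 \<in> ?D" "word_value G w h0 = c" using c(1) by blast
  let ?W = "{x \<in> topspace ?X. word_value G w x \<in> O'} \<inter> ?D"
  have "openin ?X ?W"
    using openin_continuous_map_preimage[OF cont O'(1)] cosets(2) C
    by (intro openin_Int) (auto simp: openin_PiE)
  moreover have "h0 \<in> ?W"
    using h0 O'(2) Cc by (auto simp: topspace_eq PiE_iff)
  ultimately obtain U where U: "\<And>i. i < k \<Longrightarrow> openin T (U i)" "h0 \<in> Pi\<^sub>E {..<k} U" "Pi\<^sub>E {..<k} U \<subseteq> ?W"
    unfolding openin_product_topology_alt by (metis (no_types, lifting) lessThan_iff)
  have Uc: "U i \<subseteq> carrier G" if "i < k" for i using open_subset_carrier[OF U(1)[OF that]] .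
  have h0c: "h0 i \<in> carrier G" "h0 i \<in> U i" "h0 i \<in> C i" if "i < k" for i
    using h0(1) U(2) Cc[OF that] that by (auto simp: PiE_iff)
  \<comment> \<open>The first \<open>j\<close> coordinates already range over their full cosets,
    while the others stay in the neighbourhoods \<open>U i\<close> of \<open>h0 i\<close>.\<close>
  have claim: "word_value G w f = c"
    if "j \<le> k" "f \<in> {..<k} \<rightarrow>\<^sub>E carrier G" "\<And>i. i < j \<Longrightarrow> f i \<in> C i" "\<And>i. j \<le> i \<Longrightarrow> i < k \<Longrightarrow> f i \<in> U i" for j f
    using that
  proof (induction j arbitrary: f)
    case 0
    then have "f \<in> Pi\<^sub>E {..<k} U" by (auto simp: PiE_iff)
    then have "f \<in> ?W" using U(3) by blast
    then show ?case using O'(3) by blast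
  next
    case (Suc j)
    have j: "j < k" using Suc.prems(1) by simp
    have fc: "f i \<in> carrier G" if "i < k" for i using Suc.prems(2) that by auto
    have near: "word_value G w (f(j := x)) = c" if x: "x \<in> U j" for x
    proof (rule Suc.IH)
      show "f(j := x) \<in> {..<k} \<rightarrow>\<^sub>E carrier G"
        using Suc.prems(2) j x Uc[OF j] by (auto simp: PiE_iff extensional_def)
    qed (use Suc.prems x j in auto)
    have closed: "word_value G w (f(j := x)) \<in> carrier G" if "x \<in> carrier G" for x
      using fc w that by (intro word_value_closed) auto
    have cc: "c \<in> carrier G" using \<open>c \<in> topspace T\<close> by (simp add: topspace_eq)
    have fj: "f j \<in> carrier G" by (rule fc[OF j])
    \<comment> \<open>The cosets are right cosets, so normality is what allows \<open>f j\<close> to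
      be written as \<open>h0 j\<close> times an element of \<open>M\<close>.\<close>
    define y where "y = inv (h0 j) \<otimes> f j"
    have "f j \<in> C j" using Suc.prems(3) by simp
    moreover obtain a where a: "a \<in> carrier G" "C j = M #> a" using C[OF j] by (auto simp: RCOSETS_def)
    ultimately have "M #> f j = M #> h0 j"
      using h0c(3)[OF j] repr_independence[OF _ a(1) M.is_subgroup] by auto
    then have "f j \<otimes> inv (h0 j) \<in> M" using M.factor_eq_iff fj h0c(1)[OF j] by simp
    then have "inv (h0 j) \<otimes> (f j \<otimes> inv (h0 j)) \<otimes> h0 j \<in> M"
      using M.inv_op_closed1[OF h0c(1)[OF j]] by blast
    then have yM: "y \<in> M" using fj h0c(1)[OF j] by (simp add: y_def m_assoc)
    have yc: "y \<in> carrier G" using yM by simp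
    have fjy: "f j = h0 j \<otimes> y" using fj h0c(1)[OF j] by (simp add: y_def inv_mult_cancel)
    have "\<rho> (word_value G w (f(j := f j))) $$ (r, s) = \<rho> c $$ (r, s)" if rs: "r < n" "s < n" for r s
    proof -
      let ?P = "coord_monomials (carrier G) (coords G \<rho> n)"
      define p where "p x = (if x \<in> carrier G then \<rho> (word_value G w (f(j := x))) $$ (r, s) else 0)" for x
      \<comment> \<open>The indicator of the group serves as the constant function 1 of the
        space.\<close>
      define e where "e x = (if x \<in> carrier G then 1 else 0 :: 'k)" for x
      have "p \<in> coord_space G \<rho> n (length w)"
        unfolding p_def[abs_def] using w fc by (intro word_value_coord_space[OF \<rho>h _ rs]) auto
      moreover have "e \<in> coord_space G \<rho> n (length w)"
        using coord_monomials_mono[of 0 "length w" "carrier G" "coords G \<rho> n"]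
        by (intro fun_space.span_base) (auto simp: e_def[abs_def])
      ultimately have "p - fun_scale (\<rho> c $$ (r, s)) e \<in> coord_space G \<rho> n (length w)"
        by (intro fun_space.span_diff fun_space.span_scale)
      then have q: "translate G (h0 j) (p - fun_scale (\<rho> c $$ (r, s)) e) \<in> coord_space G \<rho> n (length w)"
        by (rule translate_coord_space[OF \<rho>h h0c(1)[OF j]])
      have q_eq: "translate G (h0 j) (p - fun_scale (\<rho> c $$ (r, s)) e) x =
          \<rho> (word_value G w (f(j := h0 j \<otimes> x))) $$ (r, s) - \<rho> c $$ (r, s)" if "x \<in> carrier G" for x
        using that h0c(1)[OF j] by (simp add: translate_def p_def e_def fun_diff_def)
      \<comment> \<open>Moving \<open>h0 j\<close> to the identity turns constancy on
        \<open>U j\<close> into vanishing near \<open>\<one>\<close>, and \<open>zar\<close> extends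
        this to \<open>y\<close>.\<close>
      have "translate G (h0 j) (p - fun_scale (\<rho> c $$ (r, s)) e) y = 0"
      proof (rule zar[rule_format, OF _ _ q _ yM])
        show "openin T {x \<in> carrier G. h0 j \<otimes> x \<in> U j}"
          using h0c(1)[OF j] U(1)[OF j]
          by (intro openin_preimage continuous_map_mult continuous_map_constant continuous_map_ident) simp_all
        show "\<one> \<in> {x \<in> carrier G. h0 j \<otimes> x \<in> U j}" using h0c[OF j] by simp
        fix x assume "x \<in> {x \<in> carrier G. h0 j \<otimes> x \<in> U j}"
        then show "translate G (h0 j) (p - fun_scale (\<rho> c $$ (r, s)) e) x = 0" using near q_eq by simp
      qed
      then show ?thesis using q_eq[OF yc] fjy by simp
    qed
    then have "\<rho> (word_value G w f) = \<rho> c"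
      using carrier_matD[OF hom_GL_facts(1)[OF \<rho>h cc]] carrier_matD[OF hom_GL_facts(1)[OF \<rho>h closed[OF fj]]]
      by (intro eq_matI) auto
    then show ?case using inj_onD[OF \<rho>inj] closed[OF fj] cc by auto
  qed
  have "word_value G w g = c" by (rule claim[of k]) (use gh in auto)
  moreover have "word_value G w h = c" by (rule claim[of k]) (use gh in auto)
  ultimately show ?thesis by simp
qed

end

section \<open>Strong conciseness\<close>

text \<open>Trades extensional assignments on \<open>{..<k}\<close> for total ones, as in
  \<open>marginal\<close>.\<close>

lemma (in group) word_values_eq:
  assumes w: "fst ` set w \<subseteq> {..<k}"
  shows "word_values G k w = word_value G w ` {g. range g \<subseteq> carrier G}"
proof
  show "word_values G k w \<subseteq> word_value G w ` {g. range g \<subseteq> carrier G}"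
  proof
    fix v assume "v \<in> word_values G k w"
    then obtain g where g: "g \<in> {..<k} \<rightarrow>\<^sub>E carrier G" "v = word_value G w g" by (auto simp: word_values_def)
    let ?g = "\<lambda>i. if i < k then g i else \<one>"
    have "v = word_value G w ?g" unfolding g(2) using w by (intro word_value_cong) auto
    moreover have "range ?g \<subseteq> carrier G" using g(1) by auto
    ultimately show "v \<in> word_value G w ` {g. range g \<subseteq> carrier G}" by blast
  qed
  show "word_value G w ` {g. range g \<subseteq> carrier G} \<subseteq> word_values G k w"
  proof
    fix v assume "v \<in> word_value G w ` {g. range g \<subseteq> carrier G}"
    then obtain g where g: "range g \<subseteq> carrier G" "v = word_value G w g" by blast
    have "v = word_value G w (restrict g {..<k})" unfolding g(2) using w by (intro word_value_cong) auto
    moreover have "restrict g {..<k} \<in> {..<k} \<rightarrow>\<^sub>E carrier G" using g(1) by auto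
    ultimately show "v \<in> word_values G k w" unfolding word_values_def by blast
  qed
qed

text \<open>Over the algebraic closure the annihilating polynomial splits, so that information on
  its roots suffices.\<close>

lemma mon_GL_alg_closure:
  assumes "h \<in> mon G (GL TYPE('k::field) n)"
  shows "(\<lambda>x. map_mat to_ac (h x)) \<in> mon G (GL TYPE('k alg_closure) n)"
proof -
  interpret ac: field_hom "to_ac :: 'k \<Rightarrow> 'k alg_closure" by unfold_locales auto
  have hom: "h \<in> hom G (GL TYPE('k) n)" and inj: "inj_on h (carrier G)" using assms by (auto simp: mon_def)
  have hc: "h x \<in> carrier_mat n n" "det (h x) \<noteq> 0" if "x \<in> carrier G" for x
    using hom_in_carrier[OF hom that] by (auto simp: carrier_GL)
  have "(\<lambda>x. map_mat to_ac (h x)) \<in> hom G (GL TYPE('k alg_closure) n)"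
  proof (rule homI)
    show "map_mat to_ac (h x) \<in> carrier (GL TYPE('k alg_closure) n)" if "x \<in> carrier G" for x
      using hc[OF that] by (simp add: carrier_GL)
    show "map_mat to_ac (h (x \<otimes>\<^bsub>G\<^esub> y)) =
        map_mat to_ac (h x) \<otimes>\<^bsub>GL TYPE('k alg_closure) n\<^esub> map_mat to_ac (h y)"
      if "x \<in> carrier G" "y \<in> carrier G" for x y
      using hom_mult[OF hom that] ac.mat_hom_mult[OF hc(1)[OF that(1)] hc(1)[OF that(2)]] by (simp add: mult_GL)
  qed
  moreover have "inj_on (\<lambda>x. map_mat to_ac (h x)) (carrier G)"
  proof (rule inj_onI)
    fix x y assume xy: "x \<in> carrier G" "y \<in> carrier G" "map_mat to_ac (h x) = map_mat to_ac (h y)"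
    then have "h x = h y" using ac.mat_hom_inj by blast
    then show "x = y" using inj_onD[OF inj _ xy(1,2)] by blast
  qed
  ultimately show ?thesis by (simp add: mon_def)
qed

text \<open>A value lies in the subgroup generated by its finitely many arguments, where finite
  index, marginality and the embedding persist.\<close>

lemma (in normal) marginal_value_torsion:
  fixes \<rho> :: "'a \<Rightarrow> 'k::alg_closed_field mat"
  assumes \<rho>: "\<rho> \<in> mon G (GL TYPE('k) n)"
    and fin: "finite (rcosets H)" and marg: "marginal G w H" and g: "range g \<subseteq> carrier G"
  shows "\<exists>e>0. word_value G w g [^] (e::nat) = \<one>"
proof -
  define g' where "g' i = (if i \<in> fst ` set w then g i else \<one>)" for i
  have val: "word_value G w g = word_value G w g'" by (rule word_value_cong) (simp add: g'_def)
  have "range g' \<subseteq> insert \<one> (g ` fst ` set w)" by (auto simp: g'_def)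
  then have fing: "finite (range g')" by (rule finite_subset) simp
  have g'c: "range g' \<subseteq> carrier G" using g by (auto simp: g'_def)
  define L where "L = generate G (range g')"
  have L: "subgroup L G" unfolding L_def by (rule generate_is_subgroup[OF g'c])
  have g'L: "range g' \<subseteq> L" unfolding L_def by (auto intro: generate.incl)
  let ?L = "G\<lparr>carrier := L\<rparr>"
  interpret GL: group ?L using L subgroup_imp_group by blast
  have LH: "L \<inter> H \<lhd> ?L" using normal_Int_subgroup[OF L normal_axioms] by (simp add: Int_commute)
  interpret LH: normal "L \<inter> H" ?L by (rule LH)
  have gen: "carrier ?L = generate ?L (range g')"
    using generate_consistent[OF g'L L] by (simp add: L_def)
  have "\<rho> \<in> mon ?L (GL TYPE('k) n)"
  proof -
    have "\<rho> \<in> hom G (GL TYPE('k) n)" "inj_on \<rho> L"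
      using \<rho> inj_on_subset[OF _ subgroup.subset[OF L]] by (auto simp: mon_def)
    then show ?thesis using subgroup.mem_carrier[OF L] by (simp add: mon_def hom_def Pi_iff)
  qed
  moreover have "finite (rcosets\<^bsub>?L\<^esub> (L \<inter> H))"
  proof -
    have "finite ((\<lambda>x. (L \<inter> H) #>\<^bsub>?L\<^esub> x) ` L)"
    proof (rule finite_image_factor)
      have "(\<lambda>x. H #> x) ` L \<subseteq> rcosets H" using subgroup.subset[OF L] by (auto simp: RCOSETS_def)
      then show "finite ((\<lambda>x. H #> x) ` L)" using fin finite_subset by blast
      fix x y assume xy: "x \<in> L" "y \<in> L" "H #> x = H #> y"
      then have "x \<otimes> inv y \<in> H" using factor_eq_iff subgroup.mem_carrier[OF L] by blast
      moreover have "x \<otimes> inv y \<in> L" using xy subgroup.m_closed[OF L] subgroup.m_inv_closed[OF L] by blast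
      ultimately have "x \<otimes>\<^bsub>?L\<^esub> inv\<^bsub>?L\<^esub> y \<in> L \<inter> H" using m_inv_consistent[OF L xy(2)] by simp
      then show "(L \<inter> H) #>\<^bsub>?L\<^esub> x = (L \<inter> H) #>\<^bsub>?L\<^esub> y" using LH.factor_eq_iff[of x y] xy(1,2) by simp
    qed
    moreover have "rcosets\<^bsub>?L\<^esub> (L \<inter> H) = (\<lambda>x. (L \<inter> H) #>\<^bsub>?L\<^esub> x) ` L" by (auto simp: RCOSETS_def)
    ultimately show ?thesis by simp
  qed
  moreover have "range g' \<subseteq> carrier ?L" using g'L by simp
  ultimately obtain e where e: "e > 0" "word_value ?L w g' [^]\<^bsub>?L\<^esub> (e::nat) = \<one>\<^bsub>?L\<^esub>"
    using LH.marginal_value_torsion_fg[OF _ gen fing _ _ marginal_subgroup[OF L marg], of \<rho> n g'] by blast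
  have "word_value G w g [^] e = \<one>"
    using e(2) unfolding val word_value_subgroup[OF L g'L] by (simp add: nat_pow_consistent[symmetric])
  with e(1) show ?thesis by blast
qed

text \<open>A value depends only on the cosets of the arguments that occur in
  \<open>w\<close>.\<close>

lemma (in normal) finite_word_values_marginal:
  assumes fin: "finite (rcosets H)" and marg: "marginal G w H"
  shows "finite (word_value G w ` {g. range g \<subseteq> carrier G})"
proof (rule finite_image_factor)
  let ?f = "\<lambda>g. \<lambda>i\<in>fst ` set w. H #> g i"
  have "H #> g i \<in> rcosets H" if "range g \<subseteq> carrier G" for g :: "nat \<Rightarrow> 'a" and i
    using that rcosetsI[OF subset] by auto
  then have "?f ` {g. range g \<subseteq> carrier G} \<subseteq> (fst ` set w) \<rightarrow>\<^sub>E rcosets H"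
    by (intro image_subsetI restrict_PiE_iff[THEN iffD2]) simp
  then show "finite (?f ` {g. range g \<subseteq> carrier G})"
    by (rule finite_subset) (intro finite_PiE fin, simp)
  fix g h assume "g \<in> {g. range g \<subseteq> carrier G}" "h \<in> {g. range g \<subseteq> carrier G}" and eq: "?f g = ?f h"
  then have gh: "g i \<in> carrier G" "h i \<in> carrier G" for i by auto
  define x where "x i = (if i \<in> fst ` set w then g i \<otimes> inv (h i) else \<one>)" for i
  have "x i \<in> H" for i
  proof (cases "i \<in> fst ` set w")
    case True
    then have "H #> g i = H #> h i" using fun_cong[OF eq, of i] by simp
    then show ?thesis using True factor_eq_iff gh by (simp add: x_def)
  qed (simp add: x_def one_closed)
  then have "word_value G w (\<lambda>i. x i \<otimes> h i) = word_value G w h"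
    using gh by (intro marginalD[OF marg]) auto
  moreover have "word_value G w (\<lambda>i. x i \<otimes> h i) = word_value G w g"
    using gh by (intro word_value_cong) (simp add: x_def m_assoc)
  ultimately show "word_value G w g = word_value G w h" by simp
qed

lemma (in profinite_group) marginal_subgroup_exists:
  assumes \<rho>: "\<rho> \<in> mon G (GL TYPE('k::field) n)" and w: "fst ` set w \<subseteq> {..<k}"
    and small: "word_values G k w \<prec> (UNIV :: nat set set)"
  obtains M where "M \<lhd> G" "finite (rcosets M)" "marginal G w M"
proof -
  have \<rho>h: "\<rho> \<in> hom G (GL TYPE('k) n)" using \<rho> by (simp add: mon_def)
  obtain M where M: "M \<lhd> G" "openin T M"
    and zar: "\<forall>V. openin T V \<longrightarrow> \<one> \<in> V \<longrightarrow>
      (\<forall>f\<in>coord_space G \<rho> n (length w). (\<forall>y\<in>V. f y = 0) \<longrightarrow> (\<forall>x\<in>M. f x = 0))"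
    by (rule zariski_component[OF \<rho>h])
  interpret M: normal M G by (rule M(1))
  have "marginal G w M"
    unfolding marginal_def
  proof (intro allI impI)
    fix g x :: "nat \<Rightarrow> 'a" assume gx: "range g \<subseteq> carrier G" "range x \<subseteq> M"
    have c: "g i \<in> carrier G" "x i \<in> M" for i using gx by auto
    let ?h = "\<lambda>i\<in>{..<k}. x i \<otimes> g i" and ?g = "\<lambda>i\<in>{..<k}. g i"
    have "word_value G w ?h = word_value G w ?g"
    proof (rule word_constant_on_cosets[OF \<rho> w small M zar, of "\<lambda>i. M #> g i"])
      show "M #> g i \<in> rcosets M" for i using c by (auto simp: RCOSETS_def)
      show "?h i \<in> M #> g i" "?g i \<in> M #> g i" if "i < k" for i
        using that c rcos_self[OF c(1) M.is_subgroup] by (auto simp: r_coset_def)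
    qed (use c in auto)
    moreover have "word_value G w (\<lambda>i. x i \<otimes> g i) = word_value G w ?h" "word_value G w g = word_value G w ?g"
      using w by (auto intro!: word_value_cong)
    ultimately show "word_value G w (\<lambda>i. x i \<otimes> g i) = word_value G w g" by simp
  qed
  then show thesis using that M(1) open_subgroup_cosets(1)[OF M.is_subgroup M(2)] by blast
qed

lemma (in normal) finite_verbal_subgroup:
  fixes \<rho> :: "'a \<Rightarrow> 'k::alg_closed_field mat"
  assumes \<rho>: "\<rho> \<in> mon G (GL TYPE('k) n)" and w: "fst ` set w \<subseteq> {..<k}"
    and fin: "finite (rcosets H)" and marg: "marginal G w H"
  shows "finite (verbal_subgroup G k w)"
  unfolding verbal_subgroup_def word_values_eq[OF w]
proof (rule finite_generate_torsion)
  show "finite (word_value G w ` {g. range g \<subseteq> carrier G})"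
    by (rule finite_word_values_marginal[OF fin marg])
  show sub: "word_value G w ` {g. range g \<subseteq> carrier G} \<subseteq> carrier G"
    by (auto intro: word_value_closed)
  show "\<exists>e>0. x [^] (e::nat) = \<one>" if "x \<in> word_value G w ` {g. range g \<subseteq> carrier G}" for x
    using that marginal_value_torsion[OF \<rho> fin marg] by auto
  \<comment> \<open>Conjugating all arguments conjugates the value.\<close>
  show "inv x \<otimes> y \<otimes> x \<in> word_value G w ` {g. range g \<subseteq> carrier G}"
    if x: "x \<in> word_value G w ` {g. range g \<subseteq> carrier G}"
      and y: "y \<in> word_value G w ` {g. range g \<subseteq> carrier G}" for x y
  proof -
    obtain g where g: "range g \<subseteq> carrier G" "y = word_value G w g" using y by blast
    have xc: "inv x \<in> carrier G" using x sub by blast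
    have "word_value G w (\<lambda>i. inv x \<otimes> g i \<otimes> inv (inv x)) = inv x \<otimes> y \<otimes> inv (inv x)"
      using group_hom.word_value_hom_image[OF group_hom_conj[OF xc] g(1)] g(2) by simp
    moreover have "range (\<lambda>i. inv x \<otimes> g i \<otimes> inv (inv x)) \<subseteq> carrier G" using xc g(1) by auto
    moreover have "inv (inv x) = x" using x sub by auto
    ultimately show ?thesis by (metis (no_types, lifting) image_eqI mem_Collect_eq)
  qed
qed

theorem corollary1p2:
  fixes k :: nat and w :: word
  assumes "w \<in> carrier (free_group k)"
  shows "strongly_concise k w
    (profinite_linear_groups TYPE('k::field) :: ('a monoid \<times> 'a topology) set)"
  unfolding strongly_concise_def
proof (intro ballI, clarify)
  fix G :: "'a monoid" and T :: "'a topology"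
  assume GT: "(G, T) \<in> profinite_linear_groups TYPE('k)"
    and small: "word_values G k w \<prec> (UNIV :: nat set set)"
  then obtain n h where pro: "profinite_group G T" and h: "h \<in> mon G (GL TYPE('k) n)"
    by (auto simp: profinite_linear_groups_def linear_over_def)
  interpret profinite_group G T by (rule pro)
  have w: "fst ` set w \<subseteq> {..<k}" using assms by (simp add: free_group_def)
  obtain M where M: "M \<lhd> G" "finite (rcosets\<^bsub>G\<^esub> M)" "marginal G w M"
    by (rule marginal_subgroup_exists[OF h w small])
  show "finite (verbal_subgroup G k w)"
    by (rule normal.finite_verbal_subgroup[OF M(1) mon_GL_alg_closure[OF h] w M(2,3)])
qed

end
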